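(* There exists an absolute constant $c$ such that, for every collection $\mathfrak{L}$ of $L$ (finitely many) lines in $\mathbb{R}^3$ and all positive integers $N$ and $k$, $$|J_N^k|\cdot N^{1/2} \leq c\cdot\left(\frac{L^{3/2}}{k^{1/2}}+\frac{L}{k}\cdot N^{1/2}\right).$$ (The constant $c$ is independent of $\mathfrak{L}$, $N$ and $k$.)
   Context: A point $x\in\mathbb{R}^3$ is a joint for a collection $\mathfrak{L}$ of lines in $\mathbb{R}^3$ if there are at least three lines of $\mathfrak{L}$ passing through $x$ whose directions span $\mathbb{R}^3$. The multiplicity $N(x)$ of a joint $x$ is the number of unordered triples of lines of $\mathfrak{L}$ through $x$ whose directions span $\mathbb{R}^3$. Let $J$ be the set of joints of $\mathfrak{L}$. For $N,k$, define $J_N:=\{x\in J: N\leq N(x)<2N\}$ and $J_N^k:=\{x\in J_N: x \text{ lies on at least } k \text{ and fewer than } 2k \text{ lines of } \mathfrak{L}\}$. *)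

theory Defs
  imports "HOL-Analysis.Analysis"
begin

definition is_line :: "(real^3) set \<Rightarrow> bool" where
  "is_line l \<longleftrightarrow> affine l \<and> aff_dim l = 1"

text \<open>The directions of a line, i.e. the one-dimensional linear subspace parallel to it
  (all direction vectors, including the zero vector).\<close>

definition direction :: "(real^3) set \<Rightarrow> (real^3) set" where
  "direction l = {q - p | p q. p \<in> l \<and> q \<in> l}"

definition directions_span :: "(real^3) set set \<Rightarrow> bool" where
  "directions_span T \<longleftrightarrow> span (\<Union>l\<in>T. direction l) = UNIV"

definition lines_through :: "(real^3) set set \<Rightarrow> real^3 \<Rightarrow> (real^3) set set" where
  "lines_through \<LL> x = {l \<in> \<LL>. x \<in> l}"

definition joints :: "(real^3) set set \<Rightarrow> (real^3) set" where
  "joints \<LL> = {x. \<exists>T \<subseteq> lines_through \<LL> x. 3 \<le> card T \<and> directions_span T}"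

definition multiplicity_at :: "(real^3) set set \<Rightarrow> real^3 \<Rightarrow> nat" where
  "multiplicity_at \<LL> x = card {T. T \<subseteq> lines_through \<LL> x \<and> card T = 3 \<and> directions_span T}"

definition joints_mult :: "(real^3) set set \<Rightarrow> nat \<Rightarrow> (real^3) set" where
  "joints_mult \<LL> N = {x \<in> joints \<LL>. N \<le> multiplicity_at \<LL> x \<and> multiplicity_at \<LL> x < 2 * N}"

definition joints_mult_lines :: "(real^3) set set \<Rightarrow> nat \<Rightarrow> nat \<Rightarrow> (real^3) set" where
  "joints_mult_lines \<LL> N k =
    {x \<in> joints_mult \<LL> N. k \<le> card (lines_through \<LL> x) \<and> card (lines_through \<LL> x) < 2 * k}"

text \<open>A finite collection of lines has finitely many joints, so \<^const>\<open>card\<close> counts them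
  without the degenerate value for infinite sets.\<close>

lemma line_eqI:
  assumes "is_line l" "is_line m" "x \<in> l" "y \<in> l" "x \<in> m" "y \<in> m" "x \<noteq> y"
  shows "l = m"
proof -
  have *: "affine hull {x, y} = n" if "is_line n" "x \<in> n" "y \<in> n" for n
  proof (rule affine_dim_equal)
    show "affine n" using that(1) by (simp add: is_line_def)
    then show "affine hull {x, y} \<subseteq> n" using that by (simp add: hull_minimal)
    show "aff_dim (affine hull {x, y}) = aff_dim n"
      using that(1) \<open>x \<noteq> y\<close> by (simp add: is_line_def)
  qed simp_all
  show ?thesis
    using *[OF assms(1,3,4)] *[OF assms(2,5,6)] by simp
qed

lemma finite_joints:
  assumes fin: "finite \<LL>" and lines: "\<And>l. l \<in> \<LL> \<Longrightarrow> is_line l"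
  shows "finite (joints \<LL>)"
proof (rule finite_subset)
  let ?P = "{p \<in> \<LL> \<times> \<LL>. fst p \<noteq> snd p}"
  show "joints \<LL> \<subseteq> (\<Union>p\<in>?P. fst p \<inter> snd p)"
  proof
    fix x assume "x \<in> joints \<LL>"
    then obtain T where T: "T \<subseteq> lines_through \<LL> x" "3 \<le> card T"
      unfolding joints_def by blast
    have "finite T" using T(2) by (intro card_ge_0_finite) simp
    moreover have "\<not> card T \<le> Suc 0" using T(2) by simp
    ultimately obtain l m where "l \<in> T" "m \<in> T" "l \<noteq> m"
      by (auto simp: card_le_Suc0_iff_eq)
    then have "(l, m) \<in> ?P" "x \<in> fst (l, m) \<inter> snd (l, m)"
      using T(1) by (auto simp: lines_through_def)
    then show "x \<in> (\<Union>p\<in>?P. fst p \<inter> snd p)" by (rule UN_I)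
  qed
  show "finite (\<Union>p\<in>?P. fst p \<inter> snd p)"
  proof (rule finite_UN_I)
    show "finite ?P" using fin by simp
    fix p assume p: "p \<in> ?P"
    show "finite (fst p \<inter> snd p)"
    proof (cases "fst p \<inter> snd p = {}")
      case False
      then obtain x where x: "x \<in> fst p" "x \<in> snd p" by blast
      have "y = x" if "y \<in> fst p \<inter> snd p" for y
        using line_eqI[of "fst p" "snd p" x y] lines p x that by auto
      then have "fst p \<inter> snd p \<subseteq> {x}" by auto
      then show ?thesis by (rule finite_subset) simp
    qed simp
  qed
qed

end

theory Submission
  imports Defs "HOL-Homology.Simplices"
begin

text \<open>The proof is a polynomial partitioning argument. A polynomial of degree \<open>O(2\<^sup>q)\<close> cuts space into
  \<open>2\<^sup>3\<^sup>q\<close> cells containing equally few joints, and a line off its zero set meets only \<open>O(2\<^sup>q)\<close> of them;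
  so if most joints lie in the cells, the trivial incidence bound in each cell gives
  \<open>|J| \<lesssim> L\<^sup>3\<^sup>/\<^sup>2 k\<^sup>-\<^sup>2 + L k\<^sup>-\<^sup>1\<close>, which is stronger than required because \<open>N \<lesssim> k\<^sup>3\<close>.
  If most joints lie on the zero set, then lines with many joints lie in it too. Take a polynomial of
  least degree vanishing on these lines. At a joint whose lines do not lie in a plane its gradient
  vanishes; at a joint with three coplanar lines its second fundamental form vanishes, so that
  along a line with many such joints either the gradient vanishes or the tangent plane is constant.
  In the first case for all lines, a partial derivative contradicts minimality of the degree.
  Hence most joints have almost all their lines in one plane, shared by many joints on these lines.
  In every such plane the Szemeredi-Trotter bound (proved in the same way) applies, while each line
  meets every plane not containing it at most once; as a joint has at least about \<open>N / k\<^sup>2\<close> lines outside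
  its plane, splitting the planes at a suitable number of popular lines balances the two bounds.\<close>

section \<open>The Borsuk-Ulam theorem\<close>

text \<open>The obstacle: lines must be discarded before a polynomial vanishing on the rest can be
  used, while a joint with nearly all its lines in one plane loses its spanning property when a
  small proportion of them goes. So joints enter \<open>incidence_core\<close> in a robust form:
  after losing at most \<open>w\<close> lines a joint still spans, or still has three lines in a
  prescribed plane, which on each of its lines is shared by at most \<open>\<tau>\<close> joints.
  Joints with too many lines violating the last demand are left to the planar argument. There, up to
  constants, a plane with \<open>m\<close> popular lines holds \<open>m / k + m^2 / k^3\<close>
  joints, and the \<open>m\<close> sum to \<open>L\<close>. Planes with \<open>m \<le> \<mu>\<close>
  hold \<open>L / k + \<mu> L / k^3\<close> joints; the other planes number \<open>L / \<mu>\<close>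
  and hold \<open>k^2 L^2 / (N \<mu>)\<close>. Equating the two terms in \<open>\<mu>\<close> gives
  \<open>L^(3/2) k^(-1/2) N^(-1/2)\<close>, the source of the square root of \<open>N\<close>.
  Borsuk-Ulam is reached through Ky Fan's combinatorial lemma, because subdivided singular chains
  supply small simplices without a triangulation of the sphere.\<close>

primrec alternating :: "bool \<Rightarrow> bool list \<Rightarrow> bool" where
  "alternating s [] \<longleftrightarrow> True"
| "alternating s (x # xs) \<longleftrightarrow> x = s \<and> alternating (\<not> s) xs"

text \<open>Induct on the head \<open>a\<close>. If its sign is \<open>s\<close>, deleting
  \<open>a\<close> supplies the missing term of the induction hypothesis for the opposite sign.
  Otherwise only deleting \<open>a\<close> can leave a list starting with \<open>s\<close>, and it
  does so exactly when \<open>a # l\<close> alternates from the other sign, so these two terms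
  cancel modulo 2.\<close>

lemma alternating_remove1_parity:
  assumes "distinct l"
  shows "even ((\<Sum>b\<in>set l. of_bool (alternating s (map g (remove1 b l))))
     + of_bool (alternating s (map g l)) + of_bool (alternating (\<not> s) (map g l)) :: int)"
  using assms
proof (induction l arbitrary: s)
  case (Cons a l)
  have "(\<Sum>b\<in>set l. of_bool (alternating s (map g (remove1 b (a # l)))) :: int)
     = (\<Sum>b\<in>set l. of_bool (g a = s \<and> alternating (\<not> s) (map g (remove1 b l))))"
    using Cons.prems by (intro sum.cong) auto
  then have "(\<Sum>b\<in>set (a # l). of_bool (alternating s (map g (remove1 b (a # l)))))
     = of_bool (alternating s (map g l)) +
       (\<Sum>b\<in>set l. of_bool (g a = s \<and> alternating (\<not> s) (map g (remove1 b l))) :: int)"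
    using Cons.prems by (simp del: sum_of_bool_eq)
  also have "\<dots> = of_bool (alternating s (map g l)) +
       (if g a = s then (\<Sum>b\<in>set l. of_bool (alternating (\<not> s) (map g (remove1 b l)))) else 0)"
    by simp
  finally show ?case
    using Cons.IH[of "\<not> s"] Cons.prems by (cases "g a = s") auto
qed simp

text \<open>The vertex \<open>i\<close> of a simplex is labelled by the signed number with absolute value \<open>n i\<close> and sign \<open>t i\<close>;
  the labels alternate if their absolute values are distinct and the signs alternate when
  the labels are sorted by absolute value. By the parity lemma below, modulo 2 the alternating simplices
  form a cochain whose coboundary counts simplices alternating from either sign.\<close>

definition alternating_on :: "nat set \<Rightarrow> bool \<Rightarrow> (nat \<Rightarrow> nat) \<Rightarrow> (nat \<Rightarrow> bool) \<Rightarrow> bool" where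
  "alternating_on I s n t \<longleftrightarrow> inj_on n I \<and>
     alternating s (map (\<lambda>j. \<exists>i\<in>I. n i = j \<and> t i) (sorted_list_of_set (n ` I)))"

lemma alternating_on_reindex:
  assumes "inj_on f I"
  shows "alternating_on I s (n \<circ> f) (t \<circ> f) \<longleftrightarrow> alternating_on (f ` I) s n t"
proof -
  have "inj_on (n \<circ> f) I \<longleftrightarrow> inj_on n (f ` I)"
    using assms by (simp add: comp_inj_on_iff)
  then show ?thesis by (simp add: alternating_on_def image_comp)
qed

lemma alternating_cong_list:
  assumes "\<And>j. j \<in> set l \<Longrightarrow> g j = h j"
  shows "alternating s (map g l) = alternating s (map h l)"
proof -
  have "map g l = map h l" using assms by simp
  then show ?thesis by (rule arg_cong)
qed

text \<open>If the absolute values are distinct, sorting reduces to the list version. If two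
  vertices share one, only deleting one of these two can leave distinct values, and as
  \<open>compl\<close> gives them the same sign, both deletions alternate or neither does. A pair of
  opposite labels would break the parity.\<close>

lemma alternating_on_parity:
  assumes fin: "finite I" and compl: "\<And>i j. i \<in> I \<Longrightarrow> j \<in> I \<Longrightarrow> n i = n j \<Longrightarrow> t i = t j"
  shows "even ((\<Sum>k\<in>I. of_bool (alternating_on (I - {k}) s n t))
     + of_bool (alternating_on I s n t) + of_bool (alternating_on I (\<not> s) n t) :: int)"
proof (cases "inj_on n I")
  case True
  define l where "l = sorted_list_of_set (n ` I)"
  define g where "g = (\<lambda>j. \<exists>i\<in>I. n i = j \<and> t i)"
  have *: "alternating_on (I - {k}) s n t = alternating s (map g (remove1 (n k) l))" if "k \<in> I" for k
  proof -
    have im: "n ` (I - {k}) = n ` I - {n k}" using True that by (auto simp: inj_on_def)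
    have "(\<exists>i\<in>I - {k}. n i = j \<and> t i) = g j" if "j \<in> n ` I - {n k}" for j
      using that unfolding g_def by auto
    then have "alternating s (map (\<lambda>j. \<exists>i\<in>I-{k}. n i = j \<and> t i) (sorted_list_of_set (n ` I - {n k})))
        = alternating s (map g (sorted_list_of_set (n ` I - {n k})))"
      using fin by (intro alternating_cong_list) auto
    moreover have "sorted_list_of_set (n ` I - {n k}) = remove1 (n k) l"
      unfolding l_def using fin by (simp add: sorted_list_of_set_remove)
    ultimately show ?thesis
      unfolding alternating_on_def im using True by (simp add: inj_on_diff)
  qed
  have "(\<Sum>k\<in>I. of_bool (alternating_on (I - {k}) s n t) :: int)
      = (\<Sum>k\<in>I. of_bool (alternating s (map g (remove1 (n k) l))))"
    using * by simp
  also have "\<dots> = (\<Sum>b\<in>n ` I. of_bool (alternating s (map g (remove1 b l))))"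
    using sum.reindex[OF True, of "\<lambda>b. of_bool (alternating s (map g (remove1 b l))) :: int"] by simp
  also have "n ` I = set l" unfolding l_def using fin by simp
  finally have "(\<Sum>k\<in>I. of_bool (alternating_on (I - {k}) s n t) :: int)
     = (\<Sum>b\<in>set l. of_bool (alternating s (map g (remove1 b l))))" .
  moreover have "alternating_on I s' n t = alternating s' (map g l)" for s'
    unfolding alternating_on_def l_def g_def using True by simp
  ultimately show ?thesis using alternating_remove1_parity[of l s g]
    unfolding l_def using fin by simp
next
  case False
  then obtain i j where ij: "i \<in> I" "j \<in> I" "n i = n j" "i \<noteq> j" by (auto simp: inj_on_def)
  have zero: "\<not> alternating_on (I - {k}) s n t" if "k \<in> I - {i} - {j}" for k
  proof -
    have "\<not> inj_on n (I - {k})" using ij that unfolding inj_on_def by blast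
    then show ?thesis by (simp add: alternating_on_def)
  qed
  have "alternating_on (I - {i}) s n t = alternating_on (I - {j}) s n t"
  proof -
    have im: "n ` (I - {i}) = n ` I" "n ` (I - {j}) = n ` I" using ij by (auto simp: image_iff) (metis Diff_iff singletonD)+
    have "inj_on n (I - {i}) = inj_on n (I - {j})"
      using im fin ij by (simp add: inj_on_iff_eq_card)
    moreover have "(\<exists>a\<in>I - {i}. n a = b \<and> t a) = (\<exists>a\<in>I - {j}. n a = b \<and> t a)" for b
      using ij compl by (metis Diff_iff singletonD)
    ultimately show ?thesis unfolding alternating_on_def im by simp
  qed
  moreover have "(\<Sum>k\<in>I. of_bool (alternating_on (I - {k}) s n t) :: int)
      = of_bool (alternating_on (I - {i}) s n t) + of_bool (alternating_on (I - {j}) s n t)"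
  proof -
    have "(\<Sum>k\<in>I - {i} - {j}. of_bool (alternating_on (I - {k}) s n t) :: int) = 0"
      using zero by (intro sum.neutral) auto
    then show ?thesis
      using ij fin sum.remove[of I i "\<lambda>k. of_bool (alternating_on (I - {k}) s n t) :: int"]
       sum.remove[of "I - {i}" j "\<lambda>k. of_bool (alternating_on (I - {k}) s n t) :: int"] by simp
  qed
  moreover have "\<not> alternating_on I s' n t" for s' using False by (simp add: alternating_on_def)
  ultimately show ?thesis by simp
qed

section \<open>Evaluation of integral cochains on singular chains\<close>

definition chain_eval :: "('a \<Rightarrow> int) \<Rightarrow> ('a \<Rightarrow>\<^sub>0 int) \<Rightarrow> int" where
  "chain_eval \<phi> c = (\<Sum>\<sigma>\<in>Poly_Mapping.keys c. Poly_Mapping.lookup c \<sigma> * \<phi> \<sigma>)"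

text \<open>Linearity is inherited: the pairing of a cochain with a chain is a linear extension into
  the free abelian group on one generator, read off at that generator.\<close>

lemma chain_eval_frag_extend:
  "chain_eval \<phi> c = Poly_Mapping.lookup (frag_extend (\<lambda>\<sigma>. frag_cmul (\<phi> \<sigma>) (frag_of ())) c) ()"
  unfolding chain_eval_def frag_extend_def by (simp add: lookup_sum)

lemma chain_eval_0 [simp]: "chain_eval \<phi> 0 = 0"
  by (simp add: chain_eval_def)

lemma chain_eval_of [simp]: "chain_eval \<phi> (frag_of \<sigma>) = \<phi> \<sigma>"
  by (simp add: chain_eval_def)

lemma chain_eval_add: "chain_eval \<phi> (a + b) = chain_eval \<phi> a + chain_eval \<phi> b"
  by (simp add: chain_eval_frag_extend frag_extend_add lookup_add)

lemma chain_eval_diff: "chain_eval \<phi> (a - b) = chain_eval \<phi> a - chain_eval \<phi> b"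
  by (simp add: chain_eval_frag_extend frag_extend_diff lookup_minus)

lemma chain_eval_cmul: "chain_eval \<phi> (frag_cmul k a) = k * chain_eval \<phi> a"
  by (simp add: chain_eval_frag_extend frag_extend_cmul)

lemma chain_eval_sum: "chain_eval \<phi> (sum f I) = (\<Sum>i\<in>I. chain_eval \<phi> (f i))"
  by (induction I rule: infinite_finite_induct) (simp_all add: chain_eval_add)

lemma chain_eval_even:
  assumes "\<And>\<sigma>. \<sigma> \<in> Poly_Mapping.keys c \<Longrightarrow> even (\<phi> \<sigma>)"
  shows "even (chain_eval \<phi> c)"
  unfolding chain_eval_def using assms by (intro dvd_sum) auto

lemma chain_eval_plus: "chain_eval (\<lambda>\<sigma>. \<phi> \<sigma> + \<psi> \<sigma>) c = chain_eval \<phi> c + chain_eval \<psi> c"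
  by (simp add: chain_eval_def sum.distrib algebra_simps)

lemma chain_eval_boundary:
  "chain_eval \<phi> (chain_boundary (Suc p) c) =
     chain_eval (\<lambda>\<sigma>. \<Sum>k\<le>Suc p. (-1)^k * \<phi> (singular_face (Suc p) k \<sigma>)) c"
  using subset_UNIV
proof (induction c rule: frag_induction)
  case (one x)
  show ?case
    by (simp add: chain_boundary_of chain_eval_sum chain_eval_cmul chain_eval_add del: sum.atMost_Suc)
next
  case (diff a b)
  then show ?case by (simp only: chain_boundary_diff chain_eval_diff)
qed auto

lemma chain_eval_chain_map:
  "chain_eval \<phi> (chain_map p g c) = chain_eval (\<lambda>\<sigma>. \<phi> (simplex_map p g \<sigma>)) c"
  using subset_UNIV
  by (induction c rule: frag_induction) (simp_all add: chain_map_diff chain_eval_diff)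

section \<open>Hemispheres as chains and the antipodal map\<close>

text \<open>Plays the role of the sphere of dimension \<open>q\<close>; the vectors are not
  normalised because only the antipodal map and open covers matter. All dimensions sit inside
  \<open>nat \<Rightarrow> real\<close>, the ambient type of the standard simplices.\<close>

definition support_space :: "nat \<Rightarrow> (nat \<Rightarrow> real) set" where
  "support_space q = {x. x \<noteq> (\<lambda>_. 0) \<and> (\<forall>i>q. x i = 0)}"

definition antipode :: "(nat \<Rightarrow> real) \<Rightarrow> nat \<Rightarrow> real" where
  "antipode x = (\<lambda>i. - x i)"

lemma antipode_antipode [simp]: "antipode (antipode x) = x"
  by (simp add: antipode_def)

lemma antipode_in_support_space [simp]: "antipode x \<in> support_space q \<longleftrightarrow> x \<in> support_space q"
  by (auto simp: support_space_def antipode_def fun_eq_iff)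

lemma support_space_mono: "q \<le> r \<Longrightarrow> support_space q \<subseteq> support_space r"
  by (auto simp: support_space_def)

lemma simplicial_chain_antipode:
  assumes "simplicial_chain p (support_space q) c"
  shows "simplicial_chain p (support_space q) (chain_map p antipode c)"
  using assms unfolding simplicial_chain_def
proof (induction c rule: frag_induction)
  case (one f)
  then obtain l where l: "f = oriented_simplex p l" and im: "f ` standard_simplex p \<subseteq> support_space q"
    by (auto simp: simplicial_simplex)
  have "simplex_map p antipode f = oriented_simplex p (\<lambda>j i. - l j i)"
    unfolding l simplex_map_def oriented_simplex_def antipode_def
    by (auto simp: fun_eq_iff sum_negf)
  moreover have "simplex_map p antipode f ` standard_simplex p \<subseteq> support_space q"
    using im by (auto simp: simplex_map_def)
  ultimately show ?case by (auto simp: simplicial_simplex)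
next
  case (diff a b)
  then show ?case using simplicial_chain_diff[of p "support_space q"]
    by (simp add: chain_map_diff simplicial_chain_def)
qed auto

lemma chain_map_antipode_antipode:
  assumes "simplicial_chain p S c"
  shows "chain_map p antipode (chain_map p antipode c) = c"
proof -
  have "chain_map p (antipode \<circ> antipode) c = c"
    using simplicial_imp_singular_chain[OF assms] by (rule chain_map_id_gen) simp
  then show ?thesis by (simp add: chain_map_compose)
qed

text \<open>The next hemisphere is a cone, with a new coordinate vector as apex, over the whole
  sphere of dimension \<open>q\<close>, written as a hemisphere plus or minus its antipodal image.
  The sign makes this sum a cycle: it is the degree of the antipodal map on that sphere.\<close>

primrec hemisphere :: "nat \<Rightarrow> (nat \<Rightarrow> real) chain" where
  "hemisphere 0 = frag_of (oriented_simplex 0 (\<lambda>_ i. if i = 0 then 1 else 0))"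
| "hemisphere (Suc q) = simplicial_cone q (\<lambda>i. if i = Suc q then 1 else 0)
     (hemisphere q + frag_cmul ((-1) ^ Suc q) (chain_map q antipode (hemisphere q)))"

lemma simplicial_chain_add:
  fixes a b :: "(nat \<Rightarrow> real) chain"
  assumes "simplicial_chain p S a" "simplicial_chain p S b"
  shows "simplicial_chain p S (a + b)"
  using simplicial_chain_diff[OF assms(1) simplicial_chain_cmul[OF assms(2), of "-1"]] by simp

text \<open>The apex has a nonzero coordinate on which the base vanishes, so no segment to the apex
  meets the origin.\<close>

lemma support_space_cone:
  assumes "0 \<le> u" "u \<le> 1" "x \<in> support_space q"
  shows "(\<lambda>i. (1 - u) * (if i = Suc q then 1 else 0) + u * x i) \<in> support_space (Suc q)"
proof (cases "u = 1")
  case True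
  then show ?thesis using assms(3) by (auto simp: support_space_def)
next
  case False
  then have "(1 - u) * (if Suc q = Suc q then 1 else 0) + u * x (Suc q) \<noteq> 0"
    using assms(3) by (simp add: support_space_def)
  then show ?thesis using assms(3) by (auto simp: support_space_def fun_eq_iff)
qed

lemma simplicial_chain_hemisphere: "simplicial_chain q (support_space q) (hemisphere q)"
proof (induction q)
  case 0
  have "(\<lambda>x i. (if i = 0 then 1 else 0) * x 0) ` standard_simplex 0 \<subseteq> support_space 0"
    by (auto simp: standard_simplex_0 support_space_def fun_eq_iff)
  then show ?case by (simp add: simplicial_simplex_oriented_simplex)
next
  case (Suc q)
  then have "simplicial_chain q (support_space q)
      (hemisphere q + frag_cmul ((-1) ^ Suc q) (chain_map q antipode (hemisphere q)))"
    by (intro simplicial_chain_add simplicial_chain_cmul simplicial_chain_antipode)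
  then show ?case
    unfolding hemisphere.simps
    by (rule simplicial_chain_simplicial_cone) (rule support_space_cone)
qed

text \<open>A cone over a cycle has that cycle as its boundary; the base is a cycle by the formula
  one dimension lower, the antipodal map being an involution.\<close>

lemma chain_boundary_hemisphere:
  "chain_boundary (Suc q) (hemisphere (Suc q)) =
     hemisphere q + frag_cmul ((-1) ^ Suc q) (chain_map q antipode (hemisphere q))"
proof (induction q)
  case 0
  let ?z = "hemisphere 0 + frag_cmul ((-1) ^ Suc 0) (chain_map 0 antipode (hemisphere 0))"
  have "simplicial_chain 0 (support_space 0) ?z"
    by (intro simplicial_chain_add simplicial_chain_cmul simplicial_chain_antipode simplicial_chain_hemisphere)
  \<comment> \<open>In degree 0 the boundary of a cone has an augmentation term; the two points
    enter with opposite coefficients, so it vanishes.\<close>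
  then show ?case
    unfolding hemisphere.simps(2) by (simp add: chain_boundary_simplicial_cone frag_extend_diff)
next
  case (Suc q)
  let ?e = "(-1) ^ Suc (Suc q) :: int"
  let ?H = "hemisphere (Suc q)"
  let ?z = "?H + frag_cmul ?e (chain_map (Suc q) antipode ?H)"
  have sc: "simplicial_chain (Suc q) (support_space (Suc q)) ?z"
    by (intro simplicial_chain_add simplicial_chain_cmul simplicial_chain_antipode simplicial_chain_hemisphere)
  have "chain_boundary (Suc q) (chain_map (Suc q) antipode ?H) = chain_map q antipode (chain_boundary (Suc q) ?H)"
    using chain_boundary_chain_map[OF simplicial_imp_singular_chain[OF simplicial_chain_hemisphere[of "Suc q"]]] by (simp del: hemisphere.simps)
  also have "\<dots> = chain_map q antipode (hemisphere q) + frag_cmul ((-1) ^ Suc q) (hemisphere q)"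
    unfolding Suc.IH chain_map_add chain_map_cmul
      chain_map_antipode_antipode[OF simplicial_chain_hemisphere] by simp
  finally have "chain_boundary (Suc q) ?z = 0"
    unfolding chain_boundary_add chain_boundary_cmul Suc.IH
    by (cases "even q") (simp_all add: frag_cmul_distrib)
  then show ?case
    using chain_boundary_simplicial_cone[OF sc, of "\<lambda>i. if i = Suc (Suc q) then 1 else 0"]
    by (simp add: simplicial_cone_def)
qed

abbreviation space_top :: "nat \<Rightarrow> (nat \<Rightarrow> real) topology" where
  "space_top q \<equiv> subtopology (powertop_real UNIV) (support_space q)"

text \<open>Subdivision is a natural chain map, so the boundary relation survives it. Degree 0 is
  unchanged, which keeps the base case of the parity argument a single point.\<close>

lemma subdivided_hemisphere:
  defines "H n q \<equiv> (singular_subdivision q ^^ n) (hemisphere q)"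
  shows "singular_chain q (space_top q) (H n q)"
    and "chain_boundary (Suc q) (H n (Suc q)) =
          H n q + frag_cmul ((-1) ^ Suc q) (chain_map q antipode (H n q))"
    and "H n 0 = hemisphere 0"
proof -
  show sc: "singular_chain q (space_top q) (H n q)" for n q
    unfolding H_def
    by (induction n) (auto intro: singular_chain_singular_subdivision
       simplicial_imp_singular_chain simplicial_chain_hemisphere)
  show "chain_boundary (Suc q) (H n (Suc q)) =
          H n q + frag_cmul ((-1) ^ Suc q) (chain_map q antipode (H n q))"
  proof (induction n)
    case 0
    then show ?case by (simp add: H_def chain_boundary_hemisphere del: hemisphere.simps)
  next
    case (Suc n)
    have H: "H (Suc n) r = singular_subdivision r (H n r)" for r by (simp add: H_def)
    have cm: "singular_subdivision q (frag_cmul ((-1) ^ Suc q) c) = frag_cmul ((-1) ^ Suc q) (singular_subdivision q c)" for c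
      by (simp add: singular_subdivision_def frag_extend_cmul)
    show ?case
      unfolding H using chain_boundary_singular_subdivision[OF sc[of "Suc q" n]]
      by (simp add: Suc singular_subdivision_add cm naturality_singular_subdivision[OF sc] del: power_Suc)
  qed
  show "H n 0 = hemisphere 0"
  proof (induction n)
    case (Suc n)
    have "H (Suc n) 0 = singular_subdivision 0 (H n 0)" by (simp add: H_def)
    then show ?case using singular_subdivision_zero[OF sc[of 0 n]] Suc by simp
  qed (simp add: H_def)
qed

section \<open>Ky Fan's labelling argument and Borsuk-Ulam\<close>

lemma alternating_on_cong:
  assumes "\<And>i. i \<in> I \<Longrightarrow> n i = n' i" "\<And>i. i \<in> I \<Longrightarrow> t i = t' i"
  shows "alternating_on I s n t = alternating_on I s n' t'"
proof -
  have 1: "inj_on n I = inj_on n' I" using assms(1) by (rule inj_on_cong)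
  have 2: "n ` I = n' ` I" using assms(1) by (intro image_cong) auto
  have 3: "(\<lambda>j. \<exists>i\<in>I. n i = j \<and> t i) = (\<lambda>j. \<exists>i\<in>I. n' i = j \<and> t' i)"
    using assms by (intro ext bex_cong) auto
  show ?thesis unfolding alternating_on_def 1 2 3 ..
qed

text \<open>Ky Fan's argument: for a fine subdivision, the number of alternating \<open>q\<close>-simplices (starting with
  either sign) in the \<open>q\<close>-dimensional hemisphere has a parity independent of \<open>q\<close>. It is 1 for \<open>q = 0\<close>,
  but for \<open>q = d\<close> there are too few labels.\<close>

lemma borsuk_ulam_labels:
  fixes idx :: "(nat \<Rightarrow> real) \<Rightarrow> nat" and sg :: "(nat \<Rightarrow> real) \<Rightarrow> bool"
  assumes idx: "\<And>x. x \<in> support_space d \<Longrightarrow> idx x < d"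
    and anti: "\<And>x. x \<in> support_space d \<Longrightarrow> idx (antipode x) = idx x"
      "\<And>x. x \<in> support_space d \<Longrightarrow> sg (antipode x) \<longleftrightarrow> \<not> sg x"
    and opn: "\<And>V. V \<in> \<C> \<Longrightarrow> openin (space_top d) V"
    and cover: "support_space d \<subseteq> \<Union>\<C>"
    and no_compl: "\<And>V x y. V \<in> \<C> \<Longrightarrow> x \<in> V \<Longrightarrow> y \<in> V \<Longrightarrow> x \<in> support_space d \<Longrightarrow> y \<in> support_space d \<Longrightarrow>
        idx x = idx y \<Longrightarrow> sg x = sg y"
  shows False
proof -
  define e where "e i = (\<lambda>j. if j = i then 1 else 0 :: real)" for i :: nat
  define alt where "alt q s \<sigma> = (of_bool (alternating_on {..q} s (\<lambda>i. idx (\<sigma> (e i))) (\<lambda>i. sg (\<sigma> (e i)))) :: int)"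
    for q s and \<sigma> :: "(nat \<Rightarrow> real) \<Rightarrow> nat \<Rightarrow> real"
  define H where "H n q = (singular_subdivision q ^^ n) (hemisphere q)" for n q
  have scH: "singular_chain q (space_top d) (H n q)" if "q \<le> d" for n q
    using subdivided_hemisphere(1)[of q n] support_space_mono[OF that] unfolding H_def
    by (metis singular_chain_mono)
  have "\<exists>n. \<forall>m\<ge>n. \<forall>f\<in>Poly_Mapping.keys (H m q). \<exists>V\<in>\<C>. f \<in> standard_simplex q \<rightarrow> V" if "q \<le> d" for q
  proof -
    have c: "singular_chain q (space_top d) (hemisphere q)"
      using scH[OF that, of 0] by (simp add: H_def)
    obtain n where "\<And>m f. \<lbrakk>n \<le> m; f \<in> Poly_Mapping.keys (H m q)\<rbrakk>
        \<Longrightarrow> \<exists>V \<in> \<C>. f \<in> (standard_simplex q) \<rightarrow> V"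
      unfolding H_def using sufficient_iterated_singular_subdivision_exists[OF opn _ c] cover by auto
    then show ?thesis by blast
  qed
  then obtain n where n: "\<And>q m f. q \<le> d \<Longrightarrow> n q \<le> m \<Longrightarrow> f\<in>Poly_Mapping.keys (H m q) \<Longrightarrow> \<exists>V\<in>\<C>. f \<in> standard_simplex q \<rightarrow> V"
    by metis
  \<comment> \<open>One number of subdivisions that makes the simplices small in all dimensions up
    to \<open>d\<close> at once, since hemispheres of consecutive dimensions must stay linked by the
    boundary relation.\<close>
  define m where "m = Max (n ` {..d})"
  have m: "\<exists>V\<in>\<C>. f \<in> standard_simplex q \<rightarrow> V" if "q \<le> d" "f\<in>Poly_Mapping.keys (H m q)" for q f
    using n[OF that(1) _ that(2)] that(1) unfolding m_def by auto
  have e_in: "e i \<in> standard_simplex q" if "i \<le> q" for i q using that by (simp add: e_def)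
  have vert: "\<sigma> (e i) \<in> support_space d"
    if "q \<le> d" "\<sigma> \<in> Poly_Mapping.keys (H m q)" "i \<le> q" for \<sigma> i q
  proof -
    have "singular_simplex q (space_top d) \<sigma>"
      using scH[OF that(1), of m] that(2) by (auto simp: singular_chain_def)
    then show ?thesis using e_in[OF that(3)] by (auto simp: singular_simplex_subtopology)
  qed
  define A where "A q = chain_eval (alt q True) (H m q) + chain_eval (alt q False) (H m q)" for q
  have face: "alt q s (singular_face (Suc q) k \<sigma>)
      = of_bool (alternating_on ({..Suc q} - {k}) s (\<lambda>i. idx (\<sigma> (e i))) (\<lambda>i. sg (\<sigma> (e i))))"
    if "k \<le> Suc q" for q s k \<sigma>
  proof -
    define sk where "sk i = (if i < k then i else Suc i)" for i
    have f: "singular_face (Suc q) k \<sigma> (e i) = \<sigma> (e (sk i))" if "i \<le> q" for i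
    proof -
      have "simplical_face k (e i) = e (sk i)"
        by (auto simp: simplical_face_def e_def sk_def fun_eq_iff)
      then show ?thesis using e_in[OF that] by (simp add: singular_face_def)
    qed
    have inj: "inj_on sk {..q}" by (auto simp: inj_on_def sk_def split: if_splits)
    have im: "sk ` {..q} = {..Suc q} - {k}"
    proof
      show "{..Suc q} - {k} \<subseteq> sk ` {..q}"
      proof
        fix j assume j: "j \<in> {..Suc q} - {k}"
        show "j \<in> sk ` {..q}"
        proof (cases "j < k")
          case True
          then show ?thesis using that by (intro image_eqI[of _ _ j]) (auto simp: sk_def)
        next
          case False
          then show ?thesis using j by (intro image_eqI[of _ _ "j - 1"]) (auto simp: sk_def)
        qed
      qed
    qed (auto simp: sk_def)
    have "alternating_on {..q} s (\<lambda>i. idx (singular_face (Suc q) k \<sigma> (e i))) (\<lambda>i. sg (singular_face (Suc q) k \<sigma> (e i)))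
       = alternating_on {..q} s ((\<lambda>i. idx (\<sigma> (e i))) \<circ> sk) ((\<lambda>i. sg (\<sigma> (e i))) \<circ> sk)"
      using f by (intro alternating_on_cong) (simp_all add: comp_def)
    then show ?thesis unfolding alt_def alternating_on_reindex[OF inj] im by simp
  qed
  \<comment> \<open>Evaluate the alternating cochain on the boundary of \<open>?c\<close> in two
    ways. As a coboundary it gives \<open>A (Suc q)\<close> modulo 2 by the parity lemma. By the
    boundary relation it gives \<open>A q\<close>, since the antipodal image exchanges the two
    starting signs and coefficients 1 and -1 agree modulo 2.\<close>
  have step: "even (A (Suc q) - A q)" if q: "Suc q \<le> d" for q
  proof -
    let ?c = "H m (Suc q)"
    let ?sum = "\<lambda>\<sigma>. \<Sum>k\<le>Suc q. (-1)^k * alt q True (singular_face (Suc q) k \<sigma>)"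
    have bd: "chain_eval (alt q True) (chain_boundary (Suc q) ?c) = chain_eval ?sum ?c"
      by (rule chain_eval_boundary)
    have "even (chain_eval (\<lambda>\<sigma>. ?sum \<sigma> + (alt (Suc q) True \<sigma> + alt (Suc q) False \<sigma>)) ?c)"
    proof (rule chain_eval_even)
      fix \<sigma> assume \<sigma>: "\<sigma> \<in> Poly_Mapping.keys ?c"
      obtain V where V: "V \<in> \<C>" "\<sigma> \<in> standard_simplex (Suc q) \<rightarrow> V" using m[OF q \<sigma>] by blast
      let ?n = "\<lambda>i. idx (\<sigma> (e i))" and ?t = "\<lambda>i. sg (\<sigma> (e i))"
      have compl: "?t i = ?t j" if "i \<in> {..Suc q}" "j \<in> {..Suc q}" "?n i = ?n j" for i j
      proof (rule no_compl[OF V(1)])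
        show "\<sigma> (e i) \<in> V" "\<sigma> (e j) \<in> V" using V(2) e_in that(1,2) by blast+
        show "\<sigma> (e i) \<in> support_space d" "\<sigma> (e j) \<in> support_space d"
          using vert[OF q \<sigma>] that(1,2) by blast+
      qed (rule that(3))
      have par: "even (S + b + c) \<Longrightarrow> even (x - S) \<Longrightarrow> even (x + (b + c))" for S b c x :: int
        by presburger
      let ?S = "\<Sum>k\<in>{..Suc q}. of_bool (alternating_on ({..Suc q} - {k}) True ?n ?t) :: int"
      have "even (?S + of_bool (alternating_on {..Suc q} True ?n ?t) + of_bool (alternating_on {..Suc q} (\<not> True) ?n ?t))"
        by (rule alternating_on_parity[OF finite_atMost]) (rule compl)
      moreover have "even (?sum \<sigma> - ?S)"
        unfolding sum_subtractf[symmetric]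
      proof (rule dvd_sum)
        fix k assume "k \<in> {..Suc q}"
        then show "even ((- 1) ^ k * alt q True (singular_face (Suc q) k \<sigma>) -
              of_bool (alternating_on ({..Suc q} - {k}) True ?n ?t) :: int)"
          using face[of k q True \<sigma>] by (cases "even k") auto
      qed
      ultimately show "even (?sum \<sigma> + (alt (Suc q) True \<sigma> + alt (Suc q) False \<sigma>))"
        unfolding alt_def[of "Suc q" True \<sigma>] alt_def[of "Suc q" False \<sigma>] not_True_eq_False by (rule par)
    qed
    then have "even (chain_eval ?sum ?c + A (Suc q))"
      by (simp only: chain_eval_plus A_def)
    moreover have "even (chain_eval ?sum ?c - A q)"
    proof -
      have "alt q True (simplex_map q antipode \<sigma>) = alt q False \<sigma>" if "\<sigma> \<in> Poly_Mapping.keys (H m q)" for \<sigma>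
      proof -
        have v: "simplex_map q antipode \<sigma> (e i) = antipode (\<sigma> (e i))" if "i \<le> q" for i
          using e_in[OF that] by (simp add: simplex_map_def)
        have al: "alternating True (map (\<lambda>j. P j) l) = alternating False (map (\<lambda>j. Q j) l)"
          if "\<And>j. j \<in> set l \<Longrightarrow> P j = (\<not> Q j)" for P Q and l :: "nat list"
        proof -
          have "alternating s (map (\<lambda>j. P j) l) = alternating (\<not> s) (map (\<lambda>j. Q j) l)" for s
            using that by (induction l arbitrary: s) auto
          from this[of True] show ?thesis by simp
        qed
        let ?n = "\<lambda>i. idx (\<sigma> (e i))" and ?t = "\<lambda>i. sg (\<sigma> (e i))"
        let ?n' = "\<lambda>i. idx (simplex_map q antipode \<sigma> (e i))" and ?t' = "\<lambda>i. sg (simplex_map q antipode \<sigma> (e i))"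
        have nn: "?n' i = ?n i" "?t' i = (\<not> ?t i)" if "i \<in> {..q}" for i
          using v vert[of q \<sigma> i] that \<open>\<sigma> \<in> _\<close> q anti by auto
        have 1: "inj_on ?n' {..q} = inj_on ?n {..q}" using nn by (intro inj_on_cong) auto
        have 2: "?n' ` {..q} = ?n ` {..q}" using nn by (intro image_cong) auto
        have "alternating True (map (\<lambda>j. \<exists>i\<in>{..q}. ?n' i = j \<and> ?t' i) (sorted_list_of_set (?n ` {..q})))
           = alternating False (map (\<lambda>j. \<exists>i\<in>{..q}. ?n i = j \<and> ?t i) (sorted_list_of_set (?n ` {..q})))"
          if inj: "inj_on ?n {..q}"
        proof (rule al)
          fix j assume "j \<in> set (sorted_list_of_set (?n ` {..q}))"
          then obtain i0 where i0: "i0 \<in> {..q}" "j = ?n i0" by auto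
          have "i = i0" if "i \<in> {..q}" "?n i = j" for i using inj_onD[OF inj _ that(1) i0(1)] that i0 by simp
          then have "(\<exists>i\<in>{..q}. ?n i = j \<and> ?t i) = ?t i0" using i0 by blast
          moreover have "(\<exists>i\<in>{..q}. ?n' i = j \<and> ?t' i) = (\<exists>i\<in>{..q}. ?n i = j \<and> \<not> ?t i)"
            using nn by (intro bex_cong) auto
          moreover have "(\<exists>i\<in>{..q}. ?n i = j \<and> \<not> ?t i) = (\<not> ?t i0)"
            using i0 \<open>\<And>i. i \<in> {..q} \<Longrightarrow> ?n i = j \<Longrightarrow> i = i0\<close> by blast
          ultimately show "(\<exists>i\<in>{..q}. ?n' i = j \<and> ?t' i) = (\<not> (\<exists>i\<in>{..q}. ?n i = j \<and> ?t i))"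
            by blast
        qed
        then show ?thesis unfolding alt_def alternating_on_def 1 2 by auto
      qed
      then have "chain_eval (alt q True) (chain_map q antipode (H m q)) = chain_eval (alt q False) (H m q)"
        unfolding chain_eval_chain_map by (simp add: chain_eval_def)
      then have "chain_eval ?sum ?c = chain_eval (alt q True) (H m q) + (-1)^Suc q * chain_eval (alt q False) (H m q)"
        unfolding bd[symmetric] subdivided_hemisphere(2)[of q m, folded H_def] chain_eval_add chain_eval_cmul by simp
      moreover have "even (a + (-1)^Suc q * b - (a + b))" for a b :: int by (cases "even q") auto
      ultimately show ?thesis unfolding A_def by metis
    qed
    moreover have "even (x + b) \<Longrightarrow> even (x - a) \<Longrightarrow> even (b - a)" for a b x :: int by presburger
    ultimately show ?thesis by blast
  qed
  have "q \<le> d \<Longrightarrow> odd (A q)" for q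
  proof (induction q)
    case 0
    let ?x = "oriented_simplex 0 (\<lambda>_ i. if i = 0 then 1 else 0) :: (nat \<Rightarrow> real) \<Rightarrow> nat \<Rightarrow> real"
    have "H m 0 = frag_of ?x" using subdivided_hemisphere(3)[of m] by (simp add: H_def)
    then show ?case unfolding A_def by (simp add: alt_def alternating_on_def)
  next
    case (Suc q)
    then show ?case using step[of q] by simp
  qed
  then have "odd (A d)" by simp
  moreover have "A d = 0"
  proof -
    have "alt d s \<sigma> = 0" if \<sigma>: "\<sigma> \<in> Poly_Mapping.keys (H m d)" for \<sigma> s
    proof -
      have "(\<lambda>i. idx (\<sigma> (e i))) ` {..d} \<subseteq> {..<d}"
        using idx vert[OF order_refl \<sigma>] by auto
      then have "\<not> inj_on (\<lambda>i. idx (\<sigma> (e i))) {..d}"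
        using card_inj_on_le[of _ "{..d}" "{..<d}"] by fastforce
      then show ?thesis by (simp add: alt_def alternating_on_def)
    qed
    then show ?thesis by (simp add: A_def chain_eval_def)
  qed
  ultimately show False by simp
qed

text \<open>Without a common zero, label a point by the first index at which the modulus of
  \<open>g i\<close> is largest, and by the sign there. Antipodes get the same index and opposite
  signs; and where all \<open>g i\<close> stay within half of the maximum at a centre, no index
  occurs with both signs. \<open>borsuk_ulam_labels\<close> excludes such a labelling.\<close>

theorem borsuk_ulam:
  fixes g :: "nat \<Rightarrow> (nat \<Rightarrow> real) \<Rightarrow> real"
  assumes cont: "\<And>i. i < d \<Longrightarrow> continuous_on UNIV (g i)"
    and odd: "\<And>i x. i < d \<Longrightarrow> g i (antipode x) = - g i x"
  obtains x where "x \<in> support_space d" "\<And>i. i < d \<Longrightarrow> g i x = 0"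
proof -
  have False if nz: "\<And>x. x \<in> support_space d \<Longrightarrow> \<exists>i<d. g i x \<noteq> 0"
  proof -
    define maximal where "maximal x i \<longleftrightarrow> i < d \<and> (\<forall>j<d. \<bar>g j x\<bar> \<le> \<bar>g i x\<bar>)" for x i
    define idx where "idx x = (LEAST i. maximal x i)" for x
    define sg where "sg x \<longleftrightarrow> 0 < g (idx x) x" for x
    have ex: "\<exists>i. maximal x i" if "x \<in> support_space d" for x
    proof -
      have "{..<d} \<noteq> {}" using nz[OF that] by auto
      then have "Max ((\<lambda>i. \<bar>g i x\<bar>) ` {..<d}) \<in> (\<lambda>i. \<bar>g i x\<bar>) ` {..<d}"
        by (intro Max_in) auto
      then obtain i where i: "i < d" "Max ((\<lambda>i. \<bar>g i x\<bar>) ` {..<d}) = \<bar>g i x\<bar>" by auto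
      have "\<bar>g j x\<bar> \<le> \<bar>g i x\<bar>" if "j < d" for j
        unfolding i(2)[symmetric] using that by (intro Max_ge) auto
      then have "maximal x i" using i(1) by (simp add: maximal_def)
      then show ?thesis ..
    qed
    have mx: "maximal x (idx x)" if "x \<in> support_space d" for x
      using ex[OF that] unfolding idx_def by (rule LeastI_ex)
    have pos: "0 < \<bar>g (idx x) x\<bar>" if "x \<in> support_space d" for x
      using mx[OF that] nz[OF that] unfolding maximal_def by force
    have idx_anti: "idx (antipode x) = idx x" for x
    proof -
      have "maximal (antipode x) = maximal x"
        by (rule ext) (use odd in \<open>auto simp: maximal_def\<close>)
      then show ?thesis by (simp add: idx_def)
    qed
    define V where "V x = support_space d \<inter>
      (\<Inter>j\<in>{..<d}. {y. \<bar>g j y - g j x\<bar> < \<bar>g (idx x) x\<bar> / 2})" for x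
    show False
    proof (rule borsuk_ulam_labels[of d idx sg "V ` support_space d"])
      show "idx x < d" if "x \<in> support_space d" for x
        using mx[OF that] by (simp add: maximal_def)
      show "idx (antipode x) = idx x" for x by (rule idx_anti)
      show "sg (antipode x) \<longleftrightarrow> \<not> sg x" if "x \<in> support_space d" for x
        unfolding sg_def idx_anti using odd[of "idx x" x] mx[OF that] pos[OF that]
        by (auto simp: maximal_def)
      show "openin (space_top d) W" if "W \<in> V ` support_space d" for W
      proof -
        have "open (\<Inter>j\<in>{..<d}. {y. \<bar>g j y - g j x\<bar> < \<bar>g (idx x) x\<bar> / 2})" for x
          using cont by (intro open_INT ballI open_Collect_less continuous_intros) auto
        then show ?thesis using that unfolding V_def
          by (auto simp: openin_subtopology euclidean_product_topology Int_commute)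
      qed
      show "support_space d \<subseteq> \<Union>(V ` support_space d)"
        using pos by (auto simp: V_def)
      show "sg x = sg y" if W: "W \<in> V ` support_space d" "x \<in> W" "y \<in> W"
        and xy: "x \<in> support_space d" "y \<in> support_space d" "idx x = idx y" for W x y
      proof -
        obtain z where z: "z \<in> support_space d" "W = V z" using W(1) by auto
        have near: "\<bar>g j x - g j z\<bar> < \<bar>g (idx z) z\<bar> / 2" "\<bar>g j y - g j z\<bar> < \<bar>g (idx z) z\<bar> / 2" if "j < d" for j
          using W z that by (auto simp: V_def)
        have "idx z < d" "idx x < d" using mx z xy by (auto simp: maximal_def)
        have "\<bar>g (idx z) z\<bar> / 2 < \<bar>g (idx x) x\<bar>"
        proof -
          have "\<bar>g (idx z) x\<bar> \<le> \<bar>g (idx x) x\<bar>"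
            using mx[OF xy(1)] \<open>idx z < d\<close> by (auto simp: maximal_def)
          then show ?thesis using near(1)[OF \<open>idx z < d\<close>] by linarith
        qed
        moreover have "\<bar>g (idx z) z\<bar> / 2 < \<bar>g (idx x) y\<bar>"
        proof -
          have "\<bar>g (idx z) y\<bar> \<le> \<bar>g (idx x) y\<bar>"
            using mx[OF xy(2)] \<open>idx z < d\<close> xy(3) by (auto simp: maximal_def)
          then show ?thesis using near(2)[OF \<open>idx z < d\<close>] by linarith
        qed
        ultimately show ?thesis
          using near[OF \<open>idx x < d\<close>] unfolding sg_def xy(3)[symmetric] by linarith
      qed
    qed
  qed
  then show thesis using that by blast
qed

text \<open>The sum \<open>P i v\<close> of products in the proof is positive iff the combination \<open>v\<close> is positive on more than half
  of \<open>S i\<close>, and it depends continuously on \<open>v\<close>; this avoids approximating the counting measure.\<close>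

lemma bisecting_combination:
  fixes S :: "nat \<Rightarrow> 'a set" and b :: "nat \<Rightarrow> 'a \<Rightarrow> real"
  assumes fin: "\<And>i. i < d \<Longrightarrow> finite (S i)"
  obtains v where "\<exists>j\<le>d. v j \<noteq> 0"
    "\<And>i. i < d \<Longrightarrow> 2 * card {x \<in> S i. 0 < (\<Sum>j\<le>d. v j * b j x)} \<le> card (S i)"
    "\<And>i. i < d \<Longrightarrow> 2 * card {x \<in> S i. (\<Sum>j\<le>d. v j * b j x) < 0} \<le> card (S i)"
proof -
  define f where "f v x = (\<Sum>j\<le>d. v j * b j x)" for v x
  define \<T> where "\<T> i = {T. T \<subseteq> S i \<and> card (S i) < 2 * card T}" for i
  define P where "P i v = (\<Sum>T\<in>\<T> i. \<Prod>x\<in>T. max 0 (f v x))" for i v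
  have f_anti: "f (antipode v) x = - f v x" for v x
    by (simp add: f_def antipode_def sum_negf)
  have finT: "finite (\<T> i)" if "i < d" for i
    using fin[OF that] unfolding \<T>_def by (auto intro: finite_subset[of _ "Pow (S i)"])
  have P_nonneg: "0 \<le> P i v" for i v
    unfolding P_def by (intro sum_nonneg prod_nonneg) auto
  have P_pos: "0 < P i v \<longleftrightarrow> card (S i) < 2 * card {x \<in> S i. 0 < f v x}" if i: "i < d" for i v
  proof
    assume "0 < P i v"
    then obtain T where T: "T \<in> \<T> i" "(\<Prod>x\<in>T. max 0 (f v x)) \<noteq> 0"
      unfolding P_def by (metis (mono_tags, lifting) less_irrefl sum.neutral)
    have "finite T" using T(1) fin[OF i] by (auto simp: \<T>_def intro: finite_subset)
    then have "0 < f v x" if "x \<in> T" for x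
      using T(2) that by (auto simp: prod_zero_iff max_def not_le split: if_splits)
    then have "T \<subseteq> {x \<in> S i. 0 < f v x}" using T(1) by (auto simp: \<T>_def)
    then have "card T \<le> card {x \<in> S i. 0 < f v x}" using fin[OF i] by (intro card_mono) auto
    then show "card (S i) < 2 * card {x \<in> S i. 0 < f v x}" using T(1) by (simp add: \<T>_def)
  next
    let ?T = "{x \<in> S i. 0 < f v x}"
    assume "card (S i) < 2 * card ?T"
    then have "?T \<in> \<T> i" by (simp add: \<T>_def)
    moreover have "0 < (\<Prod>x\<in>?T. max 0 (f v x))" by (intro prod_pos) auto
    ultimately show "0 < P i v"
      unfolding P_def using finT[OF i] by (intro sum_pos2[of _ ?T] prod_nonneg) auto
  qed
  have contP: "continuous_on UNIV (P i)" for i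
    unfolding P_def f_def by (intro continuous_intros continuous_on_product_coordinates)
  have "continuous_on UNIV antipode"
    unfolding antipode_def
    by (intro continuous_on_coordinatewise_then_product continuous_intros continuous_on_product_coordinates)
  then have "continuous_on UNIV (\<lambda>v. P i (antipode v))" for i
    using continuous_on_compose2[OF contP, of UNIV antipode i] by auto
  then have "continuous_on UNIV (\<lambda>v. P i v - P i (antipode v))" for i
    by (intro continuous_intros contP)
  then obtain v where v: "v \<in> support_space d" "\<And>i. i < d \<Longrightarrow> P i v - P i (antipode v) = 0"
    by (rule borsuk_ulam[of d "\<lambda>i v. P i v - P i (antipode v)"]) auto
  show thesis
  proof
    show "\<exists>j\<le>d. v j \<noteq> 0"
    proof (rule ccontr)
      assume "\<not> (\<exists>j\<le>d. v j \<noteq> 0)"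
      then have "v = (\<lambda>_. 0)" using v(1) by (auto simp: support_space_def fun_eq_iff) (metis not_le)
      then show False using v(1) by (simp add: support_space_def)
    qed
    fix i assume i: "i < d"
    have neg: "{x \<in> S i. 0 < f (antipode v) x} = {x \<in> S i. f v x < 0}" by (simp add: f_anti)
    have "card {x \<in> S i. 0 < f v x} + card {x \<in> S i. f v x < 0} \<le> card (S i)"
    proof -
      have "card ({x \<in> S i. 0 < f v x} \<union> {x \<in> S i. f v x < 0}) \<le> card (S i)"
        using fin[OF i] by (intro card_mono) auto
      moreover have "card ({x \<in> S i. 0 < f v x} \<union> {x \<in> S i. f v x < 0})
          = card {x \<in> S i. 0 < f v x} + card {x \<in> S i. f v x < 0}"
      proof (rule card_Un_disjoint)
        show "finite {x \<in> S i. 0 < f v x}" "finite {x \<in> S i. f v x < 0}"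
          by (rule finite_subset[OF _ fin[OF i]], blast)+
        show "{x \<in> S i. 0 < f v x} \<inter> {x \<in> S i. f v x < 0} = {}"
          using less_asym by blast
      qed
      ultimately show ?thesis by linarith
    qed
    \<comment> \<open>More than half of \<open>S i\<close> cannot lie on each of the two sides, so
      if both sides exceed half or neither does, then neither does.\<close>
    moreover have "0 < P i v \<longleftrightarrow> 0 < P i (antipode v)" using v(2)[OF i] by simp
    ultimately show "2 * card {x \<in> S i. 0 < (\<Sum>j\<le>d. v j * b j x)} \<le> card (S i)"
      "2 * card {x \<in> S i. (\<Sum>j\<le>d. v j * b j x) < 0} \<le> card (S i)"
      using P_pos[OF i, of v] P_pos[OF i, of "antipode v"] unfolding neg unfolding f_def by linarith+
  qed
qed

section \<open>Polynomial functions\<close>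

text \<open>Polynomials are treated as functions, with \<open>d\<close> an upper bound for the total
  degree: products, restrictions to lines and derivatives are obtained by induction over these
  rules.\<close>

inductive poly_fun :: "nat \<Rightarrow> (real^'n \<Rightarrow> real) \<Rightarrow> bool" where
  poly_fun_const: "poly_fun d (\<lambda>_. c)"
| poly_fun_coord: "poly_fun d f \<Longrightarrow> poly_fun (Suc d) (\<lambda>x. x $ i * f x)"
| poly_fun_add: "poly_fun d f \<Longrightarrow> poly_fun d g \<Longrightarrow> poly_fun d (\<lambda>x. f x + g x)"

lemma poly_fun_mono: "poly_fun d f \<Longrightarrow> d \<le> e \<Longrightarrow> poly_fun e f"
proof (induction arbitrary: e rule: poly_fun.induct)
  case (poly_fun_coord d f i)
  then obtain e' where "e = Suc e'" "d \<le> e'" by (metis Suc_le_D Suc_le_mono)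
  then show ?case using poly_fun_coord.IH poly_fun.poly_fun_coord by blast
qed (auto intro: poly_fun.intros)

lemma poly_fun_scale: "poly_fun d f \<Longrightarrow> poly_fun d (\<lambda>x. c * f x)"
proof (induction rule: poly_fun.induct)
  case (poly_fun_coord d f i)
  then have "poly_fun (Suc d) (\<lambda>x. x $ i * (c * f x))" by (intro poly_fun.intros)
  then show ?case by (simp add: mult.left_commute)
next
  case (poly_fun_add d f g)
  then have "poly_fun d (\<lambda>x. c * f x + c * g x)" by (intro poly_fun.intros)
  then show ?case by (simp add: distrib_left)
qed (auto intro: poly_fun.intros)

lemma poly_fun_sum: "(\<And>i. i \<in> I \<Longrightarrow> poly_fun d (f i)) \<Longrightarrow> poly_fun d (\<lambda>x. \<Sum>i\<in>I. f i x)"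
  by (induction I rule: infinite_finite_induct) (auto intro: poly_fun.intros)

lemma poly_fun_mult: "poly_fun d f \<Longrightarrow> poly_fun e g \<Longrightarrow> poly_fun (d + e) (\<lambda>x. f x * g x)"
proof (induction rule: poly_fun.induct)
  case (poly_fun_const d c)
  then show ?case by (intro poly_fun_mono[OF poly_fun_scale]) auto
next
  case (poly_fun_coord d f i)
  then have "poly_fun (Suc (d + e)) (\<lambda>x. x $ i * (f x * g x))" by (intro poly_fun.intros)
  then show ?case by (simp add: mult.assoc)
next
  case (poly_fun_add d f f')
  then have "poly_fun (d + e) (\<lambda>x. f x * g x + f' x * g x)" by (intro poly_fun.intros)
  then show ?case by (simp add: distrib_right)
qed

lemma poly_fun_line:
  assumes "poly_fun d f"
  obtains P where "degree P \<le> d" "\<And>t. poly P t = f (p + t *\<^sub>R v)"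
proof -
  have "\<exists>P. degree P \<le> d \<and> (\<forall>t. poly P t = f (p + t *\<^sub>R v))"
    using assms
  proof (induction rule: poly_fun.induct)
    case (poly_fun_const d c)
    then show ?case by (intro exI[of _ "[:c:]"]) auto
  next
    case (poly_fun_coord d f i)
    then obtain P where P: "degree P \<le> d" "\<And>t. poly P t = f (p + t *\<^sub>R v)" by auto
    have "degree ([:p $ i, v $ i:] * P) \<le> Suc d"
      using degree_mult_le[of "[:p $ i, v $ i:]" P] P(1) by (auto split: if_splits)
    then show ?case using P(2) by (intro exI[of _ "[:p $ i, v $ i:] * P"]) (auto simp: algebra_simps)
  next
    case (poly_fun_add d f g)
    then obtain P Q where "degree P \<le> d" "\<And>t. poly P t = f (p + t *\<^sub>R v)"
      "degree Q \<le> d" "\<And>t. poly Q t = g (p + t *\<^sub>R v)" by auto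
    then show ?case by (intro exI[of _ "P + Q"]) (auto intro: degree_add_le)
  qed
  then show thesis using that by blast
qed

text \<open>Along \<open>p + t (q - p)\<close> both functions restrict to nonzero univariate
  polynomials, whose product is nonzero.\<close>

lemma poly_fun_mult_nonzero:
  assumes "poly_fun d f" "poly_fun e g" "f p \<noteq> 0" "g q \<noteq> 0"
  shows "\<exists>x. f x * g x \<noteq> 0"
proof -
  obtain P where P: "\<And>t. poly P t = f (p + t *\<^sub>R (q - p))" using poly_fun_line[OF assms(1)] by blast
  obtain Q where Q: "\<And>t. poly Q t = g (p + t *\<^sub>R (q - p))" using poly_fun_line[OF assms(2)] by blast
  have "P \<noteq> 0" using P[of 0] assms(3) by auto
  moreover have "Q \<noteq> 0" using Q[of 1] assms(4) by auto
  ultimately have "P * Q \<noteq> 0" by simp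
  then obtain t where "poly (P * Q) t \<noteq> 0" using poly_all_0_iff_0 by blast
  then show ?thesis using P Q by auto
qed

section \<open>Gradients and Hessians along lines\<close>

text \<open>\<open>G\<close> is the gradient and \<open>H x\<close> the Hessian as an operator. Its
  symmetry is part of the data because the inductive construction for polynomials yields it
  directly.\<close>

definition second_order :: "(real^'n \<Rightarrow> real) \<Rightarrow> (real^'n \<Rightarrow> real^'n) \<Rightarrow> (real^'n \<Rightarrow> real^'n \<Rightarrow> real^'n) \<Rightarrow> bool" where
  "second_order f G H \<longleftrightarrow> (\<forall>x. (f has_derivative (\<lambda>h. G x \<bullet> h)) (at x)) \<and>
     (\<forall>x. (G has_derivative H x) (at x)) \<and> (\<forall>x u v. H x u \<bullet> v = u \<bullet> H x v)"

text \<open>The clause for \<open>d = 0\<close> compensates for truncated subtraction: it keeps the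
  degree bound when a constant is multiplied by a coordinate, and later it shows that a nonzero
  derivative forces positive degree.\<close>

lemma poly_fun_second_order:
  fixes f :: "real^'n \<Rightarrow> real"
  assumes "poly_fun d f"
  obtains G H where "second_order f G H" "\<And>j. poly_fun (d - 1) (\<lambda>x. G x $ j)" "d = 0 \<Longrightarrow> G = (\<lambda>_. 0)"
proof -
  have "\<exists>G H. second_order f G H \<and> (\<forall>j. poly_fun (d - 1) (\<lambda>x. G x $ j)) \<and> (d = 0 \<longrightarrow> G = (\<lambda>_. 0))"
    using assms
  proof (induction rule: poly_fun.induct)
    case (poly_fun_const d c)
    show ?case
      by (intro exI[of _ "\<lambda>_. 0"] exI[of _ "\<lambda>_ _. 0"]) (auto simp: second_order_def intro: poly_fun.intros)
  next
    case (poly_fun_coord d f i)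
    then obtain G H where GH: "second_order f G H" "\<And>j. poly_fun (d - 1) (\<lambda>x. G x $ j)"
      "d = 0 \<Longrightarrow> G = (\<lambda>_. 0)" by blast
    have f [derivative_intros]: "(f has_derivative (\<lambda>h. G x \<bullet> h)) (at x)"
      and g [derivative_intros]: "(G has_derivative H x) (at x)" and sym: "H x u \<bullet> v = u \<bullet> H x v" for x u v
      using GH(1) by (auto simp: second_order_def)
    have coord [derivative_intros]: "((\<lambda>x. x $ i) has_derivative (\<lambda>h. h $ i)) (at x)" for x :: "real^'n"
      by (rule bounded_linear_imp_has_derivative) (rule bounded_linear_vec_nth)
    let ?e = "axis i 1 :: real^'n"
    let ?G = "\<lambda>x. f x *\<^sub>R ?e + x $ i *\<^sub>R G x"
    let ?H = "\<lambda>x h. (G x \<bullet> h) *\<^sub>R ?e + (h $ i *\<^sub>R G x + x $ i *\<^sub>R H x h)"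
    have "second_order (\<lambda>x. x $ i * f x) ?G ?H"
      unfolding second_order_def
    proof (intro conjI allI)
      fix x :: "real^'n"
      show "((\<lambda>x. x $ i * f x) has_derivative (\<lambda>h. ?G x \<bullet> h)) (at x)"
        by (rule derivative_eq_intros refl | simp add: inner_add_left inner_axis' algebra_simps)+
      show "(?G has_derivative ?H x) (at x)"
        by (rule derivative_eq_intros refl | simp add: algebra_simps)+
      show "?H x u \<bullet> v = u \<bullet> ?H x v" for u v
        by (simp add: inner_add_left inner_add_right inner_axis inner_axis' sym inner_commute[of "G x"] algebra_simps)
    qed
    moreover have "poly_fun d (\<lambda>x. ?G x $ j)" for j
    proof -
      have "poly_fun d (\<lambda>x. f x * ?e $ j)"
        using poly_fun_scale[OF poly_fun_coord.hyps, of "?e $ j"] by (simp add: mult.commute)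
      moreover have "poly_fun d (\<lambda>x. x $ i * G x $ j)"
      proof (cases d)
        case 0
        then show ?thesis using GH(3) by (simp add: poly_fun.intros)
      next
        case (Suc d')
        then show ?thesis using GH(2)[of j] by (auto intro: poly_fun.intros)
      qed
      ultimately show ?thesis by (auto intro: poly_fun.intros)
    qed
    ultimately show ?case by (intro exI[of _ ?G] exI[of _ ?H]) auto
  next
    case (poly_fun_add d f f')
    then obtain G H G' H' where
      GH: "second_order f G H" "\<And>j. poly_fun (d - 1) (\<lambda>x. G x $ j)" "d = 0 \<Longrightarrow> G = (\<lambda>_. 0)" and
      GH': "second_order f' G' H'" "\<And>j. poly_fun (d - 1) (\<lambda>x. G' x $ j)" "d = 0 \<Longrightarrow> G' = (\<lambda>_. 0)"
      by blast
    have "second_order (\<lambda>x. f x + f' x) (\<lambda>x. G x + G' x) (\<lambda>x h. H x h + H' x h)"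
      using GH(1) GH'(1) unfolding second_order_def
      by (auto simp: inner_add_left inner_add_right intro!: derivative_eq_intros)
    then show ?case using GH GH'
      by (intro exI[of _ "\<lambda>x. G x + G' x"] exI[of _ "\<lambda>x h. H x h + H' x h"]) (auto intro: poly_fun.intros)
  qed
  then show thesis using that by blast
qed

lemma second_order_line:
  assumes "second_order f G H"
  shows "((\<lambda>t. f (p + t *\<^sub>R u)) has_real_derivative G (p + t *\<^sub>R u) \<bullet> u) (at t)"
    and "((\<lambda>t. G (p + t *\<^sub>R u) \<bullet> w) has_real_derivative H (p + t *\<^sub>R u) u \<bullet> w) (at t)"
proof -
  have f: "(f has_derivative (\<lambda>h. G x \<bullet> h)) (at x)" and g: "(G has_derivative H x) (at x)" for x
    using assms by (auto simp: second_order_def)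
  have l: "((\<lambda>t. p + t *\<^sub>R u) has_derivative (\<lambda>t. t *\<^sub>R u)) (at t)"
    by (auto intro!: derivative_eq_intros)
  show "((\<lambda>t. f (p + t *\<^sub>R u)) has_real_derivative G (p + t *\<^sub>R u) \<bullet> u) (at t)"
    using has_derivative_compose[OF l f] by (simp add: has_field_derivative_def mult_commute_abs)
  have "((\<lambda>t. G (p + t *\<^sub>R u) \<bullet> w) has_derivative (\<lambda>t'. H (p + t *\<^sub>R u) (t' *\<^sub>R u) \<bullet> w)) (at t)"
    using has_derivative_inner_left[OF has_derivative_compose[OF l g]] .
  moreover have "H x (t' *\<^sub>R u) \<bullet> w = (H x u \<bullet> w) * t'" for x t'
    using has_derivative_linear[OF g] by (simp add: linear_scale)
  ultimately show "((\<lambda>t. G (p + t *\<^sub>R u) \<bullet> w) has_real_derivative H (p + t *\<^sub>R u) u \<bullet> w) (at t)"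
    by (simp add: has_field_derivative_def)
qed

text \<open>The second identity says that \<open>u\<close> is an asymptotic direction; three
  coplanar ones will make the second fundamental form vanish.\<close>

lemma second_order_vanishing_line:
  assumes so: "second_order f G H" and zero: "\<And>t. f (x + t *\<^sub>R u) = 0"
  shows "G x \<bullet> u = 0" "H x u \<bullet> u = 0"
proof -
  have G: "G (x + t *\<^sub>R u) \<bullet> u = 0" for t
    using DERIV_unique[OF second_order_line(1)[OF so]] zero by auto
  show "G x \<bullet> u = 0" using G[of 0] by simp
  have "H (x + 0 *\<^sub>R u) u \<bullet> u = 0"
    by (rule DERIV_unique[OF second_order_line(2)[OF so]]) (simp add: G)
  then show "H x u \<bullet> u = 0" by simp
qed

text \<open>Comparing leading coefficients shows that a nonzero \<open>R\<close> with vanishing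
  Wronskian against \<open>Q\<close> has the degree of \<open>Q\<close>. Subtracting from
  \<open>P\<close> the multiple of \<open>Q\<close> that removes the top coefficient therefore
  leaves zero.\<close>

lemma proportional_of_wronskian_eq_0:
  fixes P Q :: "real poly"
  assumes W: "P * pderiv Q = Q * pderiv P" and "Q \<noteq> 0"
  shows "\<exists>c. P = smult c Q"
proof -
  have deg: "degree R = degree Q" if "R \<noteq> 0" "R * pderiv Q = Q * pderiv R" for R
  proof (rule ccontr)
    assume ne: "degree R \<noteq> degree Q"
    have "coeff (R * pderiv Q) (degree R + degree (pderiv Q)) = lead_coeff R * lead_coeff (pderiv Q)"
      by (rule coeff_mult_degree_sum)
    have lc: "lead_coeff (pderiv S) = of_nat (degree S) * lead_coeff S" for S :: "real poly"
      by (cases "degree S") (auto simp: coeff_pderiv degree_pderiv pderiv_eq_0_iff coeff_eq_0)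
    have "lead_coeff R * lead_coeff (pderiv Q) = lead_coeff Q * lead_coeff (pderiv R)"
      using arg_cong[OF that(2), of lead_coeff] by (simp add: lead_coeff_mult)
    then have "real (degree Q) = real (degree R)"
      using that(1) \<open>Q \<noteq> 0\<close> by (simp add: lc)
    then show False using ne by simp
  qed
  show ?thesis
  proof (cases "P = 0")
    case True
    then show ?thesis by (intro exI[of _ 0]) simp
  next
    case False
    define c where "c = lead_coeff P / lead_coeff Q"
    define R where "R = P - smult c Q"
    have dP: "degree P = degree Q" by (rule deg[OF False W])
    have "R * pderiv Q = Q * pderiv R"
      using W by (simp add: R_def pderiv_diff pderiv_smult algebra_simps)
    moreover have "coeff R (degree Q) = 0"
      using \<open>Q \<noteq> 0\<close> dP by (simp add: R_def c_def)
    ultimately have "R = 0" using deg[of R] by (metis leading_coeff_0_iff)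
    then show ?thesis unfolding R_def by (intro exI[of _ c]) simp
  qed
qed

section \<open>Polynomial partitioning\<close>

text \<open>Induct on the variables: for fixed values of the others the sum is a polynomial in the
  new one, so its coefficients vanish. Bounding each exponent instead of the total degree makes the
  count \<open>n ^ card A\<close> immediate.\<close>

lemma monomials_independent:
  fixes c :: "('i \<Rightarrow> nat) \<Rightarrow> real"
  assumes "finite A" "\<And>y. (\<Sum>a\<in>PiE A (\<lambda>_. {..<n}). c a * (\<Prod>i\<in>A. y i ^ a i)) = 0"
    "a \<in> PiE A (\<lambda>_. {..<n})"
  shows "c a = 0"
  using assms
proof (induction A arbitrary: c a rule: finite_induct)
  case empty
  then show ?case by simp
next
  case (insert i A)
  let ?E = "PiE A (\<lambda>_. {..<n})"
  define C where "C y k = (\<Sum>a\<in>?E. c (a(i := k)) * (\<Prod>j\<in>A. y j ^ a j))" for y k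
  have sum: "(\<Sum>k<n. C y k * t ^ k) = 0" for y t
  proof -
    have "0 = (\<Sum>a\<in>(\<lambda>(k, g). g(i := k)) ` ({..<n} \<times> ?E). c a * (\<Prod>j\<in>insert i A. (y(i := t)) j ^ a j))"
      using insert.prems(1)[of "y(i := t)"] by (simp only: PiE_insert_eq)
    also have "\<dots> = (\<Sum>(k, g)\<in>{..<n} \<times> ?E. c (g(i := k)) * (\<Prod>j\<in>insert i A. (y(i := t)) j ^ (g(i := k)) j))"
      using insert.hyps by (subst sum.reindex) (auto intro!: inj_combinator sum.cong)
    also have "\<dots> = (\<Sum>(k, g)\<in>{..<n} \<times> ?E. (c (g(i := k)) * (\<Prod>j\<in>A. y j ^ g j)) * t ^ k)"
    proof (intro sum.cong refl, clarify)
      fix k g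
      have "(\<Prod>j\<in>A. (y(i := t)) j ^ (g(i := k)) j) = (\<Prod>j\<in>A. y j ^ g j)"
        using insert.hyps by (intro prod.cong) auto
      then show "c (g(i := k)) * (\<Prod>j\<in>insert i A. (y(i := t)) j ^ (g(i := k)) j) =
          (c (g(i := k)) * (\<Prod>j\<in>A. y j ^ g j)) * t ^ k"
        using insert.hyps by simp
    qed
    also have "\<dots> = (\<Sum>k<n. C y k * t ^ k)"
      by (simp add: C_def sum.cartesian_product sum_distrib_right)
    finally show ?thesis by simp
  qed
  have C: "C y k = 0" if "k < n" for y k
  proof -
    have "{..<n} = {..n - 1}" using that by auto
    then have "\<forall>t. (\<Sum>k\<le>n - 1. C y k * t ^ k) = 0" using sum[of y] by simp
    then show ?thesis using that by (simp add: polyfun_eq_0)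
  qed
  have a: "a i < n" "restrict a A \<in> ?E" "(restrict a A)(i := a i) = a"
    using insert.prems(2) insert.hyps(2) by (auto simp: PiE_iff fun_eq_iff extensional_def)
  have "c ((restrict a A)(i := a i)) = 0"
    by (rule insert.IH[of "\<lambda>g. c (g(i := a i))", OF _ a(2)]) (use C[OF a(1)] in \<open>simp add: C_def\<close>)
  then show ?case unfolding a(3) .
qed

lemma poly_fun_coord_power: "poly_fun k (\<lambda>x. x $ i ^ k)"
  by (induction k) (auto intro: poly_fun.intros)

lemma poly_fun_prod:
  "finite I \<Longrightarrow> (\<And>i. i \<in> I \<Longrightarrow> poly_fun (d i) (f i)) \<Longrightarrow> poly_fun (\<Sum>i\<in>I. d i) (\<lambda>x. \<Prod>i\<in>I. f i x)"
  by (induction I rule: finite_induct) (auto intro: poly_fun_const poly_fun_mult)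

lemma poly_fun_same_sign:
  assumes h: "poly_fun d h" and nz: "\<And>z. z \<in> closed_segment x y \<Longrightarrow> h z \<noteq> 0"
  shows "0 < h x \<longleftrightarrow> 0 < h y"
proof -
  obtain P where P: "\<And>t. poly P t = h (x + t *\<^sub>R (y - x))" using poly_fun_line[OF h] by blast
  have "poly P t \<noteq> 0" if "0 \<le> t" "t \<le> 1" for t
  proof -
    have "x + t *\<^sub>R (y - x) \<in> closed_segment x y"
      using that by (auto simp: in_segment algebra_simps intro!: exI[of _ t])
    then show ?thesis using nz P by simp
  qed
  moreover have "\<exists>t>0. t < 1 \<and> poly P t = 0" if differ: "\<not> ?thesis"
  proof -
    have "h x \<noteq> 0" "h y \<noteq> 0" using nz by auto
    moreover have "poly P 0 = h x" "poly P 1 = h y" using P by auto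
    ultimately consider "poly P 0 < 0" "0 < poly P 1" | "0 < poly P 0" "poly P 1 < 0"
      using differ by linarith
    then show ?thesis using poly_IVT_pos[of 0 1 P] poly_IVT_neg[of 0 1 P] by cases auto
  qed
  ultimately show ?thesis by force
qed

text \<open>A polynomial in the coordinates \<open>A\<close> stays a function on the whole space, so
  that lines in a plane and lines in space share one argument.\<close>

definition depends_on :: "'n set \<Rightarrow> (real^'n \<Rightarrow> real) \<Rightarrow> bool" where
  "depends_on A f \<longleftrightarrow> (\<forall>x y. (\<forall>i\<in>A. x $ i = y $ i) \<longrightarrow> f x = f y)"

text \<open>The index \<open>\<kappa>\<close> replaces connected components: a cell may be
  disconnected, and constancy along segments off the zero set is all that counting the cells on a
  line requires.\<close>

definition cell_decomposition ::
    "'n set \<Rightarrow> (real^'n) set \<Rightarrow> nat \<Rightarrow> nat \<Rightarrow> (real^'n \<Rightarrow> real) \<Rightarrow> (real^'n \<Rightarrow> nat) \<Rightarrow> bool" where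
  "cell_decomposition A S D j f \<kappa> \<longleftrightarrow> poly_fun D f \<and> depends_on A f \<and> (\<exists>x. f x \<noteq> 0) \<and>
     (\<forall>x. \<kappa> x < 2 ^ j) \<and> (\<forall>c. 2 ^ j * card {x \<in> S. f x \<noteq> 0 \<and> \<kappa> x = c} \<le> card S) \<and>
     (\<forall>x y. (\<forall>z\<in>closed_segment x y. f z \<noteq> 0) \<longrightarrow> \<kappa> x = \<kappa> y)"

text \<open>One polynomial bisects all \<open>2 ^ j\<close> cells. This takes
  \<open>2 ^ j + 1\<close> independent functions, supplied by the monomials with exponents below
  \<open>n\<close>; the sign of the new factor becomes the next binary digit of the cell
  index.\<close>

lemma cell_decomposition_step:
  fixes S :: "(real^'n) set" and A :: "'n set"
  assumes S: "finite S" and dec: "cell_decomposition A S D j f \<kappa>" and j: "2 ^ j < n ^ card A"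
  shows "\<exists>f' \<kappa>'. cell_decomposition A S (D + card A * n) (Suc j) f' \<kappa>'"
proof -
  define d :: nat where "d = 2 ^ j"
  define E where "E = PiE A (\<lambda>_. {..<n})"
  have finA: "finite A" by simp
  have finE: "finite E" by (simp add: E_def finite_PiE)
  have "card {..d} \<le> card E" using j finA by (simp add: E_def card_PiE d_def)
  then obtain e where e: "e ` {..d} \<subseteq> E" "inj_on e {..d}"
    using card_le_inj[of "{..d}" E] finE by auto
  define mono where "mono a x = (\<Prod>i\<in>A. x $ i ^ a i)" for a :: "'n \<Rightarrow> nat" and x :: "real^'n"
  define T where "T c = {x \<in> S. f x \<noteq> 0 \<and> \<kappa> x = c}" for c
  obtain v where v: "\<exists>i\<le>d. v i \<noteq> 0"
    "\<And>c. c < d \<Longrightarrow> 2 * card {x \<in> T c. 0 < (\<Sum>i\<le>d. v i * mono (e i) x)} \<le> card (T c)"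
    "\<And>c. c < d \<Longrightarrow> 2 * card {x \<in> T c. (\<Sum>i\<le>d. v i * mono (e i) x) < 0} \<le> card (T c)"
    using bisecting_combination[of d T "\<lambda>i. mono (e i)"] S unfolding T_def by auto
  define h where "h x = (\<Sum>i\<le>d. v i * mono (e i) x)" for x
  have "poly_fun (card A * n) (mono a)" if "a \<in> E" for a
  proof -
    have "poly_fun (\<Sum>i\<in>A. a i) (mono a)"
      unfolding mono_def by (intro poly_fun_prod poly_fun_coord_power finA)
    moreover have "(\<Sum>i\<in>A. a i) \<le> card A * n"
      using sum_bounded_above[of A a n] that by (force simp: E_def PiE_iff)
    ultimately show ?thesis by (rule poly_fun_mono)
  qed
  then have h_poly: "poly_fun (card A * n) h"
    unfolding h_def using e(1) by (intro poly_fun_sum poly_fun_scale) auto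
  have h_nz: "\<exists>x. h x \<noteq> 0"
  proof (rule ccontr)
    assume "\<not> ?thesis"
    then have h0: "h x = 0" for x by simp
    define c where "c a = (if a \<in> e ` {..d} then v (inv_into {..d} e a) else 0)" for a
    have ce: "c (e i) = v i" if "i \<le> d" for i using that e(2) by (simp add: c_def)
    have "(\<Sum>a\<in>E. c a * (\<Prod>i\<in>A. y i ^ a i)) = 0" for y
    proof -
      have "(\<Sum>a\<in>E. c a * (\<Prod>i\<in>A. y i ^ a i)) = (\<Sum>a\<in>e ` {..d}. c a * mono a (vec_lambda y))"
        using e(1) finE by (intro sum.mono_neutral_cong_right) (auto simp: c_def mono_def)
      also have "\<dots> = (\<Sum>i\<le>d. v i * mono (e i) (vec_lambda y))"
        using e(2) ce by (simp add: sum.reindex)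
      also have "\<dots> = 0" using h0[of "vec_lambda y"] by (simp add: h_def)
      finally show ?thesis .
    qed
    then have "c a = 0" if "a \<in> E" for a
      using monomials_independent[OF finA, where n = n and c = c and a = a] that unfolding E_def by blast
    then have "v i = 0" if "i \<le> d" for i
      using that e(1) ce[OF that] by (metis atMost_iff image_subset_iff)
    then show False using v(1) by blast
  qed
  have h_dep: "depends_on A h"
    by (auto simp: depends_on_def h_def mono_def intro!: sum.cong prod.cong)
  define f' where "f' x = f x * h x" for x
  define \<kappa>' where "\<kappa>' x = \<kappa> x + (if 0 < h x then d else 0)" for x
  have f: "poly_fun D f" "depends_on A f" "\<exists>x. f x \<noteq> 0" "\<And>x. \<kappa> x < d" "\<And>c. d * card (T c) \<le> card S"
    "\<And>x y. (\<forall>z\<in>closed_segment x y. f z \<noteq> 0) \<Longrightarrow> \<kappa> x = \<kappa> y"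
    using dec unfolding cell_decomposition_def T_def d_def by auto
  have "cell_decomposition A S (D + card A * n) (Suc j) f' \<kappa>'"
    unfolding cell_decomposition_def
  proof (intro conjI allI impI)
    show "poly_fun (D + card A * n) f'"
      unfolding f'_def using f(1) h_poly by (rule poly_fun_mult)
    show "depends_on A f'" using f(2) h_dep unfolding depends_on_def f'_def by metis
    show "\<exists>x. f' x \<noteq> 0"
      unfolding f'_def using poly_fun_mult_nonzero[OF f(1) h_poly] f(3) h_nz by blast
    show "\<kappa>' x < 2 ^ Suc j" for x
      using f(4)[of x] by (simp add: \<kappa>'_def d_def)
    show "2 ^ Suc j * card {x \<in> S. f' x \<noteq> 0 \<and> \<kappa>' x = c} \<le> card S" for c
    proof -
      have "\<exists>c'. 2 * card {x \<in> S. f' x \<noteq> 0 \<and> \<kappa>' x = c} \<le> card (T c')"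
      proof (cases "c < d")
        case True
        have "{x \<in> S. f' x \<noteq> 0 \<and> \<kappa>' x = c} \<subseteq> {x \<in> T c. h x < 0}"
          using True by (auto simp: T_def f'_def \<kappa>'_def split: if_splits)
        then have "card {x \<in> S. f' x \<noteq> 0 \<and> \<kappa>' x = c} \<le> card {x \<in> T c. h x < 0}"
          using S by (intro card_mono) (auto simp: T_def)
        then show ?thesis using v(3)[OF True] unfolding h_def by (intro exI[of _ c]) linarith
      next
        case False
        show ?thesis
        proof (cases "c < 2 * d")
          case True
          have "{x \<in> S. f' x \<noteq> 0 \<and> \<kappa>' x = c} \<subseteq> {x \<in> T (c - d). 0 < h x}"
            using False f(4) by (auto simp: T_def f'_def \<kappa>'_def split: if_splits)
          then have "card {x \<in> S. f' x \<noteq> 0 \<and> \<kappa>' x = c} \<le> card {x \<in> T (c - d). 0 < h x}"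
            using S by (intro card_mono) (auto simp: T_def)
          moreover have "c - d < d" using True False by linarith
          ultimately show ?thesis using v(2)[of "c - d"] unfolding h_def by (intro exI[of _ "c - d"]) linarith
        next
          case large: False
          have "\<kappa>' x \<noteq> c" for x using f(4)[of x] large by (auto simp: \<kappa>'_def)
          then show ?thesis by simp
        qed
      qed
      then obtain c' where "2 * card {x \<in> S. f' x \<noteq> 0 \<and> \<kappa>' x = c} \<le> card (T c')" ..
      then have "d * (2 * card {x \<in> S. f' x \<noteq> 0 \<and> \<kappa>' x = c}) \<le> d * card (T c')" by simp
      also have "\<dots> \<le> card S" by (rule f(5))
      finally show ?thesis by (simp add: d_def mult_ac)
    qed
    show "\<kappa>' x = \<kappa>' y" if "\<forall>z\<in>closed_segment x y. f' z \<noteq> 0" for x y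
    proof -
      have "\<kappa> x = \<kappa> y" using that by (intro f(6)) (auto simp: f'_def)
      moreover have "0 < h x \<longleftrightarrow> 0 < h y"
        using that by (intro poly_fun_same_sign[OF h_poly]) (auto simp: f'_def)
      ultimately show ?thesis by (simp add: \<kappa>'_def)
    qed
  qed
  then show ?thesis by blast
qed

text \<open>Passing from \<open>q\<close> to \<open>q + 1\<close> takes \<open>card A\<close>
  bisections with \<open>n = 2 ^ Suc q\<close>, each adding \<open>card A * 2 ^ Suc q\<close> to the
  degree. In total this adds \<open>2 * (card A)^2 * 2 ^ q\<close>, exactly what doubles the
  bound.\<close>

lemma cell_decomposition_exists:
  fixes S :: "(real^'n) set" and A :: "'n set"
  assumes S: "finite S" and A: "A \<noteq> {}"
  shows "\<exists>f \<kappa>. cell_decomposition A S (2 * (card A)\<^sup>2 * 2 ^ q) (card A * q) f \<kappa>"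
proof (induction q)
  case 0
  have "poly_fun (2 * (card A)\<^sup>2 * 2 ^ 0) (\<lambda>x :: real^'n. 1)" by (rule poly_fun_const)
  then have "cell_decomposition A S (2 * (card A)\<^sup>2 * 2 ^ 0) (card A * 0) (\<lambda>_. 1) (\<lambda>_. 0)"
    using S by (auto simp: cell_decomposition_def depends_on_def intro!: card_mono)
  then show ?case by blast
next
  case (Suc q)
  let ?m = "card A"
  have "i \<le> ?m \<Longrightarrow> \<exists>f \<kappa>. cell_decomposition A S (2 * ?m\<^sup>2 * 2 ^ q + i * (?m * 2 ^ Suc q)) (?m * q + i) f \<kappa>" for i
  proof (induction i)
    case 0
    then show ?case using Suc.IH by simp
  next
    case (Suc i)
    then obtain f \<kappa> where dec: "cell_decomposition A S (2 * ?m\<^sup>2 * 2 ^ q + i * (?m * 2 ^ Suc q)) (?m * q + i) f \<kappa>" by auto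
    have "(2::nat) ^ (?m * q + i) < 2 ^ (Suc q * ?m)"
      using Suc.prems by (intro power_strict_increasing) auto
    then have "(2::nat) ^ (?m * q + i) < (2 ^ Suc q) ^ ?m" by (simp only: power_mult)
    from cell_decomposition_step[OF S dec this] show ?case by (simp add: algebra_simps)
  qed
  from this[of ?m] show ?case by (simp add: algebra_simps power2_eq_square)
qed

section \<open>Incidences off and on the zero set\<close>

lemma is_line_param:
  assumes "is_line l" "x \<in> l"
  obtains u where "u \<noteq> 0" "l = range (\<lambda>t. x + t *\<^sub>R u)" "direction l = range (\<lambda>t. t *\<^sub>R u)"
proof -
  have "l \<noteq> {x}" using assms(1) by (auto simp: is_line_def)
  then obtain y where y: "y \<in> l" "y \<noteq> x" using assms(2) by blast
  have "affine hull {x, y} = l"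
  proof (rule affine_dim_equal)
    show "affine hull {x, y} \<subseteq> l"
      using assms y by (simp add: is_line_def hull_minimal)
    show "aff_dim (affine hull {x, y}) = aff_dim l"
      using assms(1) y by (simp add: is_line_def)
  qed (use assms in \<open>auto simp: is_line_def\<close>)
  then have l: "l = range (\<lambda>t. x + t *\<^sub>R (y - x))"
    by (simp add: affine_hull_2_alt)
  have "direction l = range (\<lambda>t. t *\<^sub>R (y - x))"
  proof
    show "direction l \<subseteq> range (\<lambda>t. t *\<^sub>R (y - x))"
      unfolding direction_def l by (auto simp: image_iff intro!: exI[of _ "_ - _"] simp flip: scaleR_diff_left)
    show "range (\<lambda>t. t *\<^sub>R (y - x)) \<subseteq> direction l"
    proof
      fix w assume "w \<in> range (\<lambda>t. t *\<^sub>R (y - x))"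
      then obtain t where "w = (x + t *\<^sub>R (y - x)) - x" by auto
      then show "w \<in> direction l" unfolding direction_def using assms(2) l by blast
    qed
  qed
  then show thesis using that[of "y - x"] y l by auto
qed

text \<open>The count \<open>N t\<close> of roots below \<open>t\<close> numbers the gaps between
  the roots: two points off the zero set with equal count are joined by a segment without zeros, and
  there are at most \<open>D + 1\<close> counts.\<close>

lemma card_cells_on_line:
  fixes f :: "real^3 \<Rightarrow> real" and \<kappa> :: "real^3 \<Rightarrow> nat"
  assumes f: "poly_fun D f" and l: "is_line l"
    and \<kappa>: "\<And>x y. (\<forall>z\<in>closed_segment x y. f z \<noteq> 0) \<Longrightarrow> \<kappa> x = \<kappa> y"
  shows "finite (\<kappa> ` {x \<in> l. f x \<noteq> 0})" "card (\<kappa> ` {x \<in> l. f x \<noteq> 0}) \<le> D + 1"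
proof -
  have "l \<noteq> {}" using l by (auto simp: is_line_def)
  then obtain p where "p \<in> l" by blast
  from is_line_param[OF l this] obtain u where u: "u \<noteq> 0" "l = range (\<lambda>t. p + t *\<^sub>R u)"
    by metis
  obtain P where P: "degree P \<le> D" "\<And>t. poly P t = f (p + t *\<^sub>R u)"
    using poly_fun_line[OF f] by blast
  have im: "\<kappa> ` {x \<in> l. f x \<noteq> 0} = (\<lambda>t. \<kappa> (p + t *\<^sub>R u)) ` {t. poly P t \<noteq> 0}"
    unfolding u(2) P(2) by auto
  have "\<exists>g. (\<lambda>t. \<kappa> (p + t *\<^sub>R u)) ` {t. poly P t \<noteq> 0} \<subseteq> g ` {..D}"
  proof (cases "P = 0")
    case False
    define N where "N t = card {z. poly P z = 0 \<and> z < t}" for t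
    have fin: "finite {z. poly P z = 0}" using False by (rule poly_roots_finite)
    have N_le: "N t \<le> D" for t
    proof -
      have "N t \<le> card {z. poly P z = 0}" unfolding N_def using fin by (intro card_mono) auto
      also have "\<dots> \<le> D" using card_poly_roots_bound[OF False] P(1) by simp
      finally show ?thesis .
    qed
    have same: "\<kappa> (p + t *\<^sub>R u) = \<kappa> (p + t' *\<^sub>R u)"
      if t: "poly P t \<noteq> 0" "poly P t' \<noteq> 0" "N t = N t'" "t \<le> t'" for t t'
    proof (rule \<kappa>, rule ballI)
      fix z assume "z \<in> closed_segment (p + t *\<^sub>R u) (p + t' *\<^sub>R u)"
      then obtain a where a: "0 \<le> a" "a \<le> 1" "z = (1 - a) *\<^sub>R (p + t *\<^sub>R u) + a *\<^sub>R (p + t' *\<^sub>R u)"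
        by (auto simp: in_segment)
      define r where "r = t + a * (t' - t)"
      have z: "z = p + r *\<^sub>R u" unfolding a(3) r_def by (simp add: algebra_simps)
      have r: "t \<le> r" "r \<le> t'"
        using a(1,2) t(4) mult_left_le_one_le[of "t' - t" a] by (auto simp: r_def)
      show "f z \<noteq> 0"
      proof
        assume "f z = 0"
        then have "poly P r = 0" using P(2) z by simp
        then have "r \<noteq> t'" "r \<in> {z. poly P z = 0 \<and> z < t'}" using t r by (auto simp: le_less)
        moreover have "r \<notin> {z. poly P z = 0 \<and> z < t}" using r by auto
        moreover have "{z. poly P z = 0 \<and> z < t} \<subseteq> {z. poly P z = 0 \<and> z < t'}" using t(4) by auto
        ultimately have "{z. poly P z = 0 \<and> z < t} \<subset> {z. poly P z = 0 \<and> z < t'}" by blast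
        then have "N t < N t'" unfolding N_def using fin by (intro psubset_card_mono) auto
        then show False using t(3) by simp
      qed
    qed
    have same': "\<kappa> (p + t *\<^sub>R u) = \<kappa> (p + t' *\<^sub>R u)"
      if "poly P t \<noteq> 0" "poly P t' \<noteq> 0" "N t = N t'" for t t'
    proof (cases "t \<le> t'")
      case True
      with that show ?thesis by (intro same)
    next
      case False
      with that have "\<kappa> (p + t' *\<^sub>R u) = \<kappa> (p + t *\<^sub>R u)" by (intro same) auto
      then show ?thesis ..
    qed
    define g where "g n = \<kappa> (p + (SOME t. poly P t \<noteq> 0 \<and> N t = n) *\<^sub>R u)" for n
    have "\<kappa> (p + t *\<^sub>R u) = g (N t)" if "poly P t \<noteq> 0" for t
      unfolding g_def using someI[of "\<lambda>t'. poly P t' \<noteq> 0 \<and> N t' = N t" t] that by (intro same') auto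
    then show ?thesis using N_le by (intro exI[of _ g]) auto
  qed simp
  then obtain g where g: "\<kappa> ` {x \<in> l. f x \<noteq> 0} \<subseteq> g ` {..D}" unfolding im by blast
  then show "finite (\<kappa> ` {x \<in> l. f x \<noteq> 0})" by (rule finite_subset) simp
  have "card (\<kappa> ` {x \<in> l. f x \<noteq> 0}) \<le> card (g ` {..D})" using g by (intro card_mono) auto
  also have "\<dots> \<le> card {..D}" by (intro card_image_le) simp
  finally show "card (\<kappa> ` {x \<in> l. f x \<noteq> 0}) \<le> D + 1" by simp
qed

lemma sum_card_filter_swap:
  assumes "finite A" "finite B"
  shows "(\<Sum>a\<in>A. card {b \<in> B. R a b}) = (\<Sum>b\<in>B. card {a \<in> A. R a b})"
proof -
  have "(\<Sum>a\<in>A. card {b \<in> B. R a b}) = (\<Sum>a\<in>A. \<Sum>b\<in>B. if R a b then 1 else 0)"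
    using assms by (simp add: sum.If_cases Int_def)
  also have "\<dots> = (\<Sum>b\<in>B. \<Sum>a\<in>A. if R a b then 1 else 0)" by (rule sum.swap)
  finally show ?thesis using assms by (simp add: sum.If_cases Int_def)
qed

text \<open>A line meeting \<open>C\<close> in \<open>i\<close> points carries at least \<open>i - 1\<close> ordered pairs of points of \<open>C\<close>,
  and a pair of points lies on at most one line.\<close>

lemma incidences_le:
  assumes L: "finite L" "\<And>l. l \<in> L \<Longrightarrow> is_line l" and C: "finite C"
  shows "(\<Sum>l\<in>L. card {x \<in> C. x \<in> l}) \<le> card {l \<in> L. \<exists>x\<in>C. x \<in> l} + (card C)\<^sup>2"
proof -
  define Pr where "Pr l = {(x, y). x \<in> C \<and> y \<in> C \<and> x \<in> l \<and> y \<in> l \<and> x \<noteq> y}" for l :: "(real^3) set"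
  have finPr: "finite (Pr l)" for l
    by (rule finite_subset[of _ "C \<times> C"]) (use C in \<open>auto simp: Pr_def\<close>)
  have one: "card {x \<in> C. x \<in> l} \<le> (if \<exists>x\<in>C. x \<in> l then 1 else 0) + card (Pr l)" for l
  proof (cases "\<exists>x\<in>C. x \<in> l")
    case True
    then obtain x where x: "x \<in> C" "x \<in> l" by blast
    have "card ({y \<in> C. y \<in> l} - {x}) \<le> card (Pr l)"
      using x by (intro card_inj_on_le[of "\<lambda>y. (x, y)"] finPr) (auto simp: inj_on_def Pr_def)
    then show ?thesis using True C x by (simp add: card_Diff_singleton)
  next
    case False
    then have "card {x \<in> C. x \<in> l} = 0" by (metis (no_types, lifting) Collect_empty_eq card.empty)
    then show ?thesis by linarith
  qed
  have "(\<Sum>l\<in>L. card (Pr l)) = card (\<Union>l\<in>L. Pr l)"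
  proof (rule card_UN_disjoint[symmetric])
    show "\<forall>i\<in>L. \<forall>j\<in>L. i \<noteq> j \<longrightarrow> Pr i \<inter> Pr j = {}"
      using L(2) line_eqI by (fastforce simp: Pr_def)
  qed (use L finPr in auto)
  also have "\<dots> \<le> card (C \<times> C)"
    by (intro card_mono) (use C in \<open>auto simp: Pr_def\<close>)
  finally have pairs: "(\<Sum>l\<in>L. card (Pr l)) \<le> (card C)\<^sup>2"
    by (simp add: card_cartesian_product power2_eq_square)
  have "(\<Sum>l\<in>L. card {x \<in> C. x \<in> l}) \<le> (\<Sum>l\<in>L. (if \<exists>x\<in>C. x \<in> l then 1 else 0) + card (Pr l))"
    by (rule sum_mono) (rule one)
  also have "\<dots> = card {l \<in> L. \<exists>x\<in>C. x \<in> l} + (\<Sum>l\<in>L. card (Pr l))"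
    using L(1) by (simp add: sum.distrib sum.If_cases Int_def)
  finally show ?thesis using pairs by simp
qed

text \<open>The trivial bound is summed over the cells. Its linear terms count pairs of a line and a
  cell that it enters; its quadratic terms are at most the largest cell times the number of
  points.\<close>

lemma incidences_off_surface:
  assumes L: "finite L" "\<And>l. l \<in> L \<Longrightarrow> is_line l" and S: "finite S"
    and dec: "cell_decomposition A S D j f \<kappa>"
  shows "2 ^ j * (\<Sum>l\<in>L. card {x \<in> S. f x \<noteq> 0 \<and> x \<in> l}) \<le> 2 ^ j * ((D + 1) * card L) + (card S)\<^sup>2"
proof -
  have f: "poly_fun D f" "\<And>c. 2 ^ j * card {x \<in> S. f x \<noteq> 0 \<and> \<kappa> x = c} \<le> card S"
    "\<And>x y. (\<forall>z\<in>closed_segment x y. f z \<noteq> 0) \<Longrightarrow> \<kappa> x = \<kappa> y"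
    using dec unfolding cell_decomposition_def by auto
  define S0 where "S0 = {x \<in> S. f x \<noteq> 0}"
  define K where "K = \<kappa> ` S0"
  define C where "C c = {x \<in> S0. \<kappa> x = c}" for c
  have fin: "finite S0" "finite K" "finite (C c)" for c using S by (auto simp: S0_def K_def C_def)
  have split: "card {x \<in> S0. R x} = (\<Sum>c\<in>K. card {x \<in> C c. R x})" for R
  proof -
    have "{x \<in> S0. R x} = (\<Union>c\<in>K. {x \<in> C c. R x})" by (auto simp: K_def C_def)
    moreover have "card (\<Union>c\<in>K. {x \<in> C c. R x}) = (\<Sum>c\<in>K. card {x \<in> C c. R x})"
      using fin by (intro card_UN_disjoint) (auto simp: C_def)
    ultimately show ?thesis by simp
  qed
  have cells: "card {c \<in> K. \<exists>x\<in>C c. x \<in> l} \<le> D + 1" if "l \<in> L" for l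
  proof -
    have "card {c \<in> K. \<exists>x\<in>C c. x \<in> l} \<le> card (\<kappa> ` {x \<in> l. f x \<noteq> 0})"
      using card_cells_on_line(1)[OF f(1) L(2)[OF that] f(3)]
      by (intro card_mono) (auto simp: C_def S0_def)
    also have "\<dots> \<le> D + 1" by (rule card_cells_on_line(2)[OF f(1) L(2)[OF that] f(3)])
    finally show ?thesis .
  qed
  have "(\<Sum>l\<in>L. card {x \<in> S0. x \<in> l}) = (\<Sum>l\<in>L. \<Sum>c\<in>K. card {x \<in> C c. x \<in> l})"
    by (simp only: split)
  also have "\<dots> = (\<Sum>c\<in>K. \<Sum>l\<in>L. card {x \<in> C c. x \<in> l})" by (rule sum.swap)
  also have "\<dots> \<le> (\<Sum>c\<in>K. card {l \<in> L. \<exists>x\<in>C c. x \<in> l} + (card (C c))\<^sup>2)"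
    by (rule sum_mono, rule incidences_le[OF L fin(3)])
  also have "\<dots> = (\<Sum>l\<in>L. card {c \<in> K. \<exists>x\<in>C c. x \<in> l}) + (\<Sum>c\<in>K. (card (C c))\<^sup>2)"
    using sum_card_filter_swap[OF fin(2) L(1), of "\<lambda>c l. \<exists>x\<in>C c. x \<in> l"] by (simp add: sum.distrib)
  also have "(\<Sum>l\<in>L. card {c \<in> K. \<exists>x\<in>C c. x \<in> l}) \<le> (D + 1) * card L"
    using sum_mono[of L _ "\<lambda>_. D + 1", OF cells] by (simp add: mult.commute)
  finally have 1: "(\<Sum>l\<in>L. card {x \<in> S0. x \<in> l}) \<le> (D + 1) * card L + (\<Sum>c\<in>K. (card (C c))\<^sup>2)" by simp
  have "2 ^ j * (\<Sum>c\<in>K. (card (C c))\<^sup>2) = (\<Sum>c\<in>K. (2 ^ j * card (C c)) * card (C c))"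
    by (simp add: sum_distrib_left power2_eq_square mult.assoc)
  also have "\<dots> \<le> (\<Sum>c\<in>K. card S * card (C c))"
  proof (intro sum_mono mult_right_mono)
    fix c
    have "C c = {x \<in> S. f x \<noteq> 0 \<and> \<kappa> x = c}" by (auto simp: C_def S0_def)
    then show "2 ^ j * card (C c) \<le> card S" using f(2) by simp
  qed simp
  also have "\<dots> = card S * card S0"
    using split[of "\<lambda>_. True"] by (simp add: sum_distrib_left)
  also have "\<dots> \<le> (card S)\<^sup>2"
    unfolding power2_eq_square using S by (intro mult_left_mono card_mono) (auto simp: S0_def)
  finally have 2: "2 ^ j * (\<Sum>c\<in>K. (card (C c))\<^sup>2) \<le> (card S)\<^sup>2" .
  have "{x \<in> S. f x \<noteq> 0 \<and> x \<in> l} = {x \<in> S0. x \<in> l}" for l by (auto simp: S0_def)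
  then have "2 ^ j * (\<Sum>l\<in>L. card {x \<in> S. f x \<noteq> 0 \<and> x \<in> l})
      \<le> 2 ^ j * ((D + 1) * card L + (\<Sum>c\<in>K. (card (C c))\<^sup>2))"
    using 1 by simp
  then show ?thesis using 2 by (simp add: distrib_left)
qed

section \<open>Polynomials vanishing on lines with many joints\<close>

text \<open>Otherwise \<open>n\<close>, \<open>w\<close>, \<open>u\<close>, \<open>v\<close> would
  be four independent vectors in space.\<close>

lemma perp_combination:
  fixes n v u w :: "real^3"
  assumes "n \<noteq> 0" "n \<bullet> v = 0" "n \<bullet> u = 0" "n \<bullet> w = 0" "v \<noteq> 0" "\<And>c. u \<noteq> c *\<^sub>R v"
  obtains \<alpha> \<beta> where "w = \<alpha> *\<^sub>R v + \<beta> *\<^sub>R u"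
proof -
  have uv: "u \<notin> span {v}" using assms(6) by (auto simp: span_singleton)
  have ind: "independent {u, v}" using assms(5) uv by (intro independent_insertI independent_empty) auto
  have "w \<in> span {u, v}"
  proof (rule ccontr)
    assume w: "w \<notin> span {u, v}"
    then have ind3: "independent {w, u, v}" using ind by (rule independent_insertI)
    have "n \<notin> span {w, u, v}"
    proof
      assume "n \<in> span {w, u, v}"
      moreover have "orthogonal n y" if "y \<in> {w, u, v}" for y
        using that assms by (auto simp: orthogonal_def)
      ultimately have "orthogonal n n" using orthogonal_to_span by blast
      then show False using assms(1) by (simp add: orthogonal_def)
    qed
    then have ind4: "independent {n, w, u, v}" using ind3 by (rule independent_insertI)
    have "card {n, w, u, v} = 4"
    proof -
      have "v \<noteq> u" using uv by (auto simp: span_base)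
      moreover have "w \<notin> {u, v}" using w span_base[of w "{u, v}"] by auto
      moreover have "n \<notin> {w, u, v}" using \<open>n \<notin> span {w, u, v}\<close> span_base[of n "{w, u, v}"] by auto
      ultimately show ?thesis by auto
    qed
    then show False using independent_bound[OF ind4] by simp
  qed
  then obtain \<beta> \<alpha> where "w - \<beta> *\<^sub>R u = \<alpha> *\<^sub>R v"
    by (auto simp: span_breakdown_eq span_singleton)
  then have "w = \<alpha> *\<^sub>R v + \<beta> *\<^sub>R u" by (simp add: algebra_simps)
  then show thesis by (rule that)
qed

text \<open>The part of \<open>c\<close> orthogonal to \<open>a\<close> is a combination of
  \<open>v\<close> and \<open>u\<close> and orthogonal to both, hence zero.\<close>

lemma perp_parallel:
  fixes a c v u :: "real^3"
  assumes "a \<noteq> 0" "a \<bullet> v = 0" "a \<bullet> u = 0" "c \<bullet> v = 0" "c \<bullet> u = 0" "v \<noteq> 0" "\<And>r. u \<noteq> r *\<^sub>R v"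
  obtains r where "c = r *\<^sub>R a"
proof -
  define r where "r = (c \<bullet> a) / (a \<bullet> a)"
  define w where "w = c - r *\<^sub>R a"
  have "a \<bullet> w = 0" using assms(1) by (simp add: w_def r_def inner_diff_right inner_commute)
  then obtain \<alpha> \<beta> where ab: "w = \<alpha> *\<^sub>R v + \<beta> *\<^sub>R u" using perp_combination[of a v u w] assms by blast
  have "w \<bullet> v = 0" "w \<bullet> u = 0" using assms by (auto simp: w_def inner_diff_left)
  then have "w \<bullet> w = 0" by (subst (2) ab) (simp add: inner_add_right)
  then show thesis using that[of r] by (simp add: w_def)
qed

definition plane :: "(real^3) set \<Rightarrow> bool" where
  "plane P \<longleftrightarrow> (\<exists>n b. n \<noteq> 0 \<and> P = {y. n \<bullet> y = b})"

text \<open>In space \<open>e = 0\<close>. For lines in a plane, \<open>e\<close> is a coordinate vector transversal to the plane and the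
  polynomials do not depend on that coordinate, so that two lines of the plane suffice to span.\<close>

lemma algebraic_core:
  fixes e :: "real^3" and E :: "real^3 \<Rightarrow> (real^3) set set" and \<pi> :: "real^3 \<Rightarrow> (real^3) set"
    and f\<^sub>0 :: "real^3 \<Rightarrow> real" and T \<tau> :: real
  assumes f\<^sub>0: "poly_fun d f\<^sub>0" "\<exists>x. f\<^sub>0 x \<noteq> 0" "\<And>x t. f\<^sub>0 (x + t *\<^sub>R e) = f\<^sub>0 x" "\<And>x. x \<in> S \<Longrightarrow> f\<^sub>0 x = 0"
    and S: "finite S" and R: "R \<noteq> {}" "\<And>l. l \<in> R \<Longrightarrow> is_line l"
    and inc: "\<And>x l. x \<in> S \<Longrightarrow> l \<in> E x \<Longrightarrow> x \<in> l"
    and rich: "\<And>l. l \<in> R \<Longrightarrow> T \<le> card {x \<in> S. l \<in> E x}"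
    and pts: "\<And>x. x \<in> S \<Longrightarrow> span (insert e (\<Union>l\<in>E x \<inter> R. direction l)) = UNIV \<or>
        planar x \<and> plane (\<pi> x) \<and> (\<forall>l\<in>E x. l \<subseteq> \<pi> x) \<and> 3 \<le> card (E x \<inter> R)"
    and pop: "\<And>l P. l \<in> R \<Longrightarrow> card {x \<in> S. planar x \<and> l \<in> E x \<and> \<pi> x = P} \<le> \<tau>"
    and T: "\<tau> + 2 * d < T"
  shows False
proof -
  \<comment> \<open>The class in which the degree is minimised. Invariance under translation by
    \<open>e\<close> belongs to it, and derivatives inherit it.\<close>
  define V where "V d f \<longleftrightarrow> poly_fun d f \<and> (\<exists>x. f x \<noteq> 0) \<and> (\<forall>x t. f (x + t *\<^sub>R e) = f x) \<and>
    (\<forall>l\<in>R. \<forall>x\<in>l. f x = 0)" for d and f :: "real^3 \<Rightarrow> real"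
  obtain l\<^sub>0 where "l\<^sub>0 \<in> R" using R(1) by blast
  from pop[OF this, of undefined] have \<tau>: "0 \<le> \<tau>" by linarith
  have TT: "card {t. p + t *\<^sub>R v \<in> S \<and> l \<in> E (p + t *\<^sub>R v) \<and> Q (p + t *\<^sub>R v)} = card {x \<in> S. l \<in> E x \<and> Q x}"
    and finTT: "finite {t. p + t *\<^sub>R v \<in> S}"
    if v: "v \<noteq> 0" "l = range (\<lambda>t. p + t *\<^sub>R v)" for l p v Q
  proof -
    have inj: "inj_on (\<lambda>t. p + t *\<^sub>R v) A" for A using v(1) by (auto simp: inj_on_def)
    have "(\<lambda>t. p + t *\<^sub>R v) ` {t. p + t *\<^sub>R v \<in> S \<and> l \<in> E (p + t *\<^sub>R v) \<and> Q (p + t *\<^sub>R v)} = {x \<in> S. l \<in> E x \<and> Q x}"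
    proof
      show "{x \<in> S. l \<in> E x \<and> Q x} \<subseteq> (\<lambda>t. p + t *\<^sub>R v) ` {t. p + t *\<^sub>R v \<in> S \<and> l \<in> E (p + t *\<^sub>R v) \<and> Q (p + t *\<^sub>R v)}"
      proof
        fix x assume x: "x \<in> {x \<in> S. l \<in> E x \<and> Q x}"
        then obtain t where "x = p + t *\<^sub>R v" using inc[of x l] v(2) by auto
        then show "x \<in> (\<lambda>t. p + t *\<^sub>R v) ` {t. p + t *\<^sub>R v \<in> S \<and> l \<in> E (p + t *\<^sub>R v) \<and> Q (p + t *\<^sub>R v)}"
          using x by blast
      qed
    qed auto
    from arg_cong[OF this, of card]
    show "card {t. p + t *\<^sub>R v \<in> S \<and> l \<in> E (p + t *\<^sub>R v) \<and> Q (p + t *\<^sub>R v)} = card {x \<in> S. l \<in> E x \<and> Q x}"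
      by (simp only: card_image[OF inj])
    show "finite {t. p + t *\<^sub>R v \<in> S}"
      using finite_vimageI[OF S inj[of UNIV]] by (simp add: vimage_def)
  qed
  have line0: "\<And>l. l \<in> R \<Longrightarrow> \<exists>p v. v \<noteq> 0 \<and> l = range (\<lambda>t. p + t *\<^sub>R v)"
  proof -
    fix l assume "l \<in> R"
    then have l: "is_line l" by (rule R(2))
    then have "l \<noteq> {}" by (auto simp: is_line_def)
    then obtain p where "p \<in> l" by blast
    with is_line_param[OF l] show "\<exists>p v. v \<noteq> 0 \<and> l = range (\<lambda>t. p + t *\<^sub>R v)" by metis
  qed
  \<comment> \<open>A rich line contains more than \<open>d\<close> zeros of
    \<open>f\<^sub>0\<close>, hence lies in the zero set.\<close>
  have "V d f\<^sub>0"
    unfolding V_def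
  proof (intro conjI ballI)
    fix l x assume l: "l \<in> R" and x: "x \<in> l"
    obtain p v where v: "v \<noteq> 0" "l = range (\<lambda>t. p + t *\<^sub>R v)" using line0[OF l] by blast
    obtain P where P: "degree P \<le> d" "\<And>t. poly P t = f\<^sub>0 (p + t *\<^sub>R v)"
      using poly_fun_line[OF f\<^sub>0(1)] by blast
    have "P = 0"
    proof (rule ccontr)
      assume "P \<noteq> 0"
      have "card {x \<in> S. l \<in> E x} = card {t. p + t *\<^sub>R v \<in> S \<and> l \<in> E (p + t *\<^sub>R v)}"
        using TT[OF v, of "\<lambda>_. True"] by simp
      also have "\<dots> \<le> card {t. poly P t = 0}"
        using f\<^sub>0(4) P(2) by (intro card_mono poly_roots_finite \<open>P \<noteq> 0\<close>) auto
      also have "\<dots> \<le> d" using card_poly_roots_bound[OF \<open>P \<noteq> 0\<close>] P(1) by simp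
      finally show False using rich[OF l] T \<tau> by simp
    qed
    then show "f\<^sub>0 x = 0" using x P(2) unfolding v(2) by auto
  qed (use f\<^sub>0 in auto)
  define d' where "d' = (LEAST d. \<exists>f. V d f)"
  have "\<exists>f. V d' f" unfolding d'_def by (rule LeastI_ex) (use \<open>V d f\<^sub>0\<close> in blast)
  then obtain f where Vf: "V d' f" ..
  have d'_le: "d' \<le> d" unfolding d'_def by (rule Least_le) (use \<open>V d f\<^sub>0\<close> in blast)
  have d'_min: "\<not> V d'' g" if "d'' < d'" for d'' g
    using not_less_Least[of d'' "\<lambda>d. \<exists>f. V d f"] that unfolding d'_def by blast
  have f: "poly_fun d' f" "\<exists>x. f x \<noteq> 0" "\<And>x t. f (x + t *\<^sub>R e) = f x" "\<And>l x. l \<in> R \<Longrightarrow> x \<in> l \<Longrightarrow> f x = 0"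
    using Vf unfolding V_def by auto
  obtain G H where so: "second_order f G H" and Gp: "\<And>j. poly_fun (d' - 1) (\<lambda>x. G x $ j)"
    and G0: "d' = 0 \<Longrightarrow> G = (\<lambda>_. 0)"
    using poly_fun_second_order[OF f(1)] by blast
  have df: "(f has_derivative (\<lambda>h. G x \<bullet> h)) (at x)"
    and linH: "linear (H x)" and sym: "H x u \<bullet> w = u \<bullet> H x w" for x u w
    using so has_derivative_linear[of G "H x" "at x"] by (auto simp: second_order_def)
  have G_e: "G x \<bullet> e = 0" for x
  proof -
    have "((\<lambda>t. f (x + t *\<^sub>R e)) has_real_derivative G (x + 0 *\<^sub>R e) \<bullet> e) (at 0)"
      by (rule second_order_line(1)[OF so])
    then show ?thesis using DERIV_unique[OF _ DERIV_const] unfolding f(3) by fastforce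
  qed
  have van: "f (x + t *\<^sub>R u) = 0" if "m \<in> R" "m = range (\<lambda>t. x + t *\<^sub>R u)" for m x u t
    using f(4)[OF that(1)] that(2) by auto
  \<comment> \<open>If the gradient is not identically zero on \<open>l\<close>, its direction along
    \<open>l\<close> turns out to be constant, so all but few joints on \<open>l\<close> have the
    same plane, contrary to \<open>pop\<close>.\<close>
  have crit: "G x = 0" if l: "l \<in> R" and x: "x \<in> l" for l x
  proof (rule ccontr)
    assume "G x \<noteq> 0"
    obtain p v where v: "v \<noteq> 0" "l = range (\<lambda>t. p + t *\<^sub>R v)" using line0[OF l] by blast
    obtain P where P: "\<And>j. degree (P j) \<le> d' - 1" "\<And>j t. poly (P j) t = G (p + t *\<^sub>R v) $ j"
    proof -
      have "\<exists>P. degree P \<le> d' - 1 \<and> (\<forall>t. poly P t = G (p + t *\<^sub>R v) $ j)" for j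
        using poly_fun_line[OF Gp[of j], of p v] by metis
      then show thesis using that by metis
    qed
    have P': "poly (pderiv (P j)) t = H (p + t *\<^sub>R v) v $ j" for j t
    proof -
      have "((\<lambda>t. G (p + t *\<^sub>R v) \<bullet> axis j 1) has_real_derivative H (p + t *\<^sub>R v) v \<bullet> axis j 1) (at t)"
        by (rule second_order_line(2)[OF so])
      then have "(poly (P j) has_real_derivative H (p + t *\<^sub>R v) v $ j) (at t)"
        by (simp add: inner_axis P(2)[symmetric])
      then show ?thesis using DERIV_unique[OF poly_DERIV] by blast
    qed
    obtain t\<^sub>0 i where ti: "poly (P i) t\<^sub>0 \<noteq> 0"
      using \<open>G x \<noteq> 0\<close> x P(2) unfolding v(2) by (auto simp: vec_eq_iff)
    define TS where "TS = {t. p + t *\<^sub>R v \<in> S \<and> l \<in> E (p + t *\<^sub>R v)}"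
    have finTS: "finite TS" unfolding TS_def using finTT[OF v] by (rule rev_finite_subset) auto
    have cardTS: "T \<le> card TS" using rich[OF l] TT[OF v, of "\<lambda>_. True"] by (simp add: TS_def)
    \<comment> \<open>A nonzero gradient is orthogonal to \<open>e\<close> and to all lines of
      \<open>R\<close> at the joint, which rules out spanning and leaves the planar alternative;
      besides \<open>l\<close> there are then two more lines of \<open>R\<close> in the
      plane.\<close>
    have planar_pt: "\<exists>u. (\<forall>r. u \<noteq> r *\<^sub>R v) \<and> G y \<bullet> v = 0 \<and> G y \<bullet> u = 0 \<and> H y v \<bullet> v = 0 \<and> H y v \<bullet> u = 0 \<and>
        (\<exists>n b. n \<noteq> 0 \<and> n \<bullet> v = 0 \<and> n \<bullet> u = 0 \<and> \<pi> y = {z. n \<bullet> z = b} \<and> n \<bullet> y = b) \<and> planar y"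
      if t: "t \<in> TS" and y: "y = p + t *\<^sub>R v" and nz: "G y \<noteq> 0" for t y
    proof -
      have yS: "y \<in> S" "l \<in> E y" using t y by (auto simp: TS_def)
      have dir: "G y \<bullet> w = 0" if m: "m \<in> E y" "m \<in> R" "w \<in> direction m" for m w
      proof -
        obtain u where u: "m = range (\<lambda>t. y + t *\<^sub>R u)" "direction m = range (\<lambda>t. t *\<^sub>R u)"
          using is_line_param[OF R(2)[OF m(2)] inc[OF yS(1) m(1)]] by metis
        show ?thesis using second_order_vanishing_line(1)[OF so van[OF m(2) u(1)]] m(3) u(2) by auto
      qed
      have "span (insert e (\<Union>l\<in>E y \<inter> R. direction l)) \<noteq> UNIV"
      proof
        assume "span (insert e (\<Union>l\<in>E y \<inter> R. direction l)) = UNIV"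
        moreover have "orthogonal (G y) w" if "w \<in> insert e (\<Union>l\<in>E y \<inter> R. direction l)" for w
          using that dir G_e by (auto simp: orthogonal_def)
        ultimately have "orthogonal (G y) (G y)" using orthogonal_to_span by blast
        then show False using nz by (simp add: orthogonal_def)
      qed
      then have pl: "planar y" "plane (\<pi> y)" "\<And>m. m \<in> E y \<Longrightarrow> m \<subseteq> \<pi> y" "3 \<le> card (E y \<inter> R)"
        using pts[OF yS(1)] by auto
      have "card (E y \<inter> R - {l}) = card (E y \<inter> R) - 1"
        using yS(2) l by (intro card_Diff_singleton) simp
      then have "2 \<le> card (E y \<inter> R - {l})" using pl(4) by linarith
      then obtain M where M: "M \<subseteq> E y \<inter> R - {l}" "card M = 2" using obtain_subset_with_card_n by metis
      then obtain m\<^sub>1 m\<^sub>2 where "M = {m\<^sub>1, m\<^sub>2}" "m\<^sub>1 \<noteq> m\<^sub>2" using card_2_iff by metis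
      then have m: "m\<^sub>1 \<in> E y \<inter> R - {l}" "m\<^sub>2 \<in> E y \<inter> R - {l}" "m\<^sub>1 \<noteq> m\<^sub>2" using M(1) by auto
      have ml: "is_line m\<^sub>1" "is_line m\<^sub>2" and my: "y \<in> m\<^sub>1" "y \<in> m\<^sub>2"
        using m R(2) inc[OF yS(1)] by auto
      obtain u\<^sub>1 where u1: "u\<^sub>1 \<noteq> 0" "m\<^sub>1 = range (\<lambda>t. y + t *\<^sub>R u\<^sub>1)"
        using is_line_param[OF ml(1) my(1)] by metis
      obtain u\<^sub>2 where u2: "u\<^sub>2 \<noteq> 0" "m\<^sub>2 = range (\<lambda>t. y + t *\<^sub>R u\<^sub>2)"
        using is_line_param[OF ml(2) my(2)] by metis
      have ly: "l = range (\<lambda>s. y + s *\<^sub>R v)"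
      proof
        show "l \<subseteq> range (\<lambda>s. y + s *\<^sub>R v)" unfolding v(2) y
          by (auto simp: image_iff algebra_simps intro!: exI[of _ "_ - t"] simp flip: scaleR_add_left)
        show "range (\<lambda>s. y + s *\<^sub>R v) \<subseteq> l" unfolding v(2) y
          by (auto simp: image_iff algebra_simps intro!: exI[of _ "_ + t"] simp flip: scaleR_add_left)
      qed
      have par: "m = m'" if "is_line m" "is_line m'" "m = range (\<lambda>t. y + t *\<^sub>R a)" "m' = range (\<lambda>t. y + t *\<^sub>R b)"
        "a \<noteq> 0" "a = r *\<^sub>R b" for m m' a b r
      proof (rule line_eqI[of _ _ y "y + a"])
        show "y \<in> m" "y \<in> m'" "y + a \<in> m" "y + a \<in> m'"
          unfolding that(3,4) using that(6) by (auto simp: image_iff intro: exI[of _ 0] exI[of _ 1] exI[of _ r])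
      qed (use that in auto)
      have np1: "u\<^sub>1 \<noteq> r *\<^sub>R v" for r using par[OF R(2) R(2) u1(2) ly u1(1)] m(1) l by blast
      have np2: "u\<^sub>2 \<noteq> r *\<^sub>R v" for r using par[OF R(2) R(2) u2(2) ly u2(1)] m(2) l by blast
      have np3: "u\<^sub>2 \<noteq> r *\<^sub>R u\<^sub>1" for r using par[OF R(2) R(2) u2(2) u1(2) u2(1)] m by blast
      obtain n b where nb: "n \<noteq> 0" "\<pi> y = {z. n \<bullet> z = b}" using pl(2) by (auto simp: plane_def)
      have yb: "n \<bullet> y = b" using pl(3)[OF yS(2)] inc[OF yS] nb(2) by auto
      have nperp: "n \<bullet> u = 0" if "m \<in> E y" "m = range (\<lambda>t. y + t *\<^sub>R u)" for m u
      proof -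
        have "y + 1 *\<^sub>R u \<in> \<pi> y" using pl(3)[OF that(1)] that(2) by blast
        then show ?thesis using yb nb(2) by (simp add: inner_add_right)
      qed
      have n: "n \<bullet> v = 0" "n \<bullet> u\<^sub>1 = 0" "n \<bullet> u\<^sub>2 = 0"
        using nperp[OF yS(2) ly] nperp[OF _ u1(2)] nperp[OF _ u2(2)] m by auto
      \<comment> \<open>The quadratic form of the Hessian vanishes in three pairwise independent
        directions of a plane. Expanding it at the third, a combination of the other two with
        nonzero coefficients, leaves only the mixed term, which therefore vanishes too.\<close>
      obtain \<alpha> \<beta> where ab: "u\<^sub>2 = \<alpha> *\<^sub>R v + \<beta> *\<^sub>R u\<^sub>1"
        using perp_combination[OF nb(1) n v(1) np1] by blast
      have "\<beta> \<noteq> 0" using np2[of \<alpha>] ab by auto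
      have "\<alpha> \<noteq> 0" using np3[of \<beta>] ab by auto
      note vl = second_order_vanishing_line[OF so van[OF l ly]]
      note v1 = second_order_vanishing_line[OF so van[OF _ u1(2)]]
      note v2 = second_order_vanishing_line[OF so van[OF _ u2(2)]]
      have q: "H y v \<bullet> v = 0" "H y u\<^sub>1 \<bullet> u\<^sub>1 = 0" "H y u\<^sub>2 \<bullet> u\<^sub>2 = 0" using vl(2) v1(2) v2(2) m by auto
      have "H y u\<^sub>2 = \<alpha> *\<^sub>R H y v + \<beta> *\<^sub>R H y u\<^sub>1"
        unfolding ab using linH[of y] by (simp add: linear_add linear_scale)
      then have "H y u\<^sub>2 \<bullet> u\<^sub>2 = \<alpha>\<^sup>2 * (H y v \<bullet> v) + \<beta>\<^sup>2 * (H y u\<^sub>1 \<bullet> u\<^sub>1) + \<alpha> * \<beta> * (H y v \<bullet> u\<^sub>1 + H y u\<^sub>1 \<bullet> v)"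
        unfolding ab by (simp add: inner_add_left inner_add_right algebra_simps power2_eq_square)
      moreover have "H y u\<^sub>1 \<bullet> v = H y v \<bullet> u\<^sub>1" using sym[of y u\<^sub>1 v] by (simp add: inner_commute)
      ultimately have "H y v \<bullet> u\<^sub>1 = 0" using q \<open>\<alpha> \<noteq> 0\<close> \<open>\<beta> \<noteq> 0\<close> by simp
      then show ?thesis using np1 vl v1(1) m q n nb yb pl(1) by (intro exI[of _ u\<^sub>1]) auto
    qed
    have "\<exists>c. P j = smult c (P i)" for j
    proof (rule proportional_of_wronskian_eq_0)
      show "P i \<noteq> 0" using ti by auto
      \<comment> \<open>The Wronskian of two gradient components along \<open>l\<close>. It vanishes
        at every joint on \<open>l\<close>: either the gradient is zero, or its derivative along
        \<open>l\<close> is orthogonal to the same two directions and so parallel to it. Its degree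
        is below the number of these joints.\<close>
      define W where "W = P j * pderiv (P i) - P i * pderiv (P j)"
      have "W = 0"
      proof (rule ccontr)
        assume "W \<noteq> 0"
        have "poly W t = 0" if t: "t \<in> TS" for t
        proof (cases "G (p + t *\<^sub>R v) = 0")
          case True
          then show ?thesis by (simp add: W_def P(2))
        next
          case False
          let ?y = "p + t *\<^sub>R v"
          obtain u where u: "\<And>r. u \<noteq> r *\<^sub>R v" "G ?y \<bullet> v = 0" "G ?y \<bullet> u = 0" "H ?y v \<bullet> v = 0" "H ?y v \<bullet> u = 0"
            using planar_pt[OF t refl False] by blast
          obtain r where "H ?y v = r *\<^sub>R G ?y" using perp_parallel[OF False u(2-5) v(1) u(1)] by blast
          then show ?thesis by (simp add: W_def P(2) P')
        qed
        then have "card TS \<le> card {t. poly W t = 0}"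
          by (intro card_mono poly_roots_finite \<open>W \<noteq> 0\<close>) auto
        also have "\<dots> \<le> degree W" by (rule card_poly_roots_bound[OF \<open>W \<noteq> 0\<close>])
        also have "degree W \<le> 2 * d"
        proof -
          have "degree (P j * pderiv (P i)) \<le> (d' - 1) + (d' - 1)" "degree (P i * pderiv (P j)) \<le> (d' - 1) + (d' - 1)"
            using P(1)[of i] P(1)[of j]
            by (auto intro!: order_trans[OF degree_mult_le] simp: degree_pderiv)
          then show ?thesis unfolding W_def using d'_le by (intro degree_diff_le) auto
        qed
        finally show False using cardTS T \<tau> by simp
      qed
      then show "P j * pderiv (P i) = P i * pderiv (P j)" by (simp add: W_def)
    qed
    then obtain c where c: "\<And>j. P j = smult (c j) (P i)" by metis
    define C where "C = (\<chi> j. c j)"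
    have GC: "G (p + t *\<^sub>R v) = poly (P i) t *\<^sub>R C" for t
    proof -
      have "G (p + t *\<^sub>R v) $ j = c j * poly (P i) t" for j
        unfolding P(2)[symmetric] by (subst c[of j]) simp
      then show ?thesis by (simp add: vec_eq_iff C_def mult.commute)
    qed
    have "C \<noteq> 0" using GC[of t\<^sub>0] P(2)[of i t\<^sub>0] ti by auto
    \<comment> \<open>At most \<open>d\<close> joints are zeros of the factor \<open>P i\<close> of
      the gradient. At all others the plane is the one through \<open>p\<close> with normal
      \<open>C\<close>, so \<open>pop\<close> allows at most \<open>\<tau>\<close> of them; together
      these are fewer than \<open>T\<close>.\<close>
    let ?Z = "{t \<in> TS. poly (P i) t = 0}" and ?N = "{t \<in> TS. poly (P i) t \<noteq> 0}"
    have "card ?Z \<le> card {t. poly (P i) t = 0}"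
      using ti by (intro card_mono poly_roots_finite) auto
    also have "\<dots> \<le> d" using card_poly_roots_bound[of "P i"] P(1)[of i] d'_le ti by fastforce
    finally have Z: "card ?Z \<le> d" .
    have "?N \<subseteq> {t. p + t *\<^sub>R v \<in> S \<and> l \<in> E (p + t *\<^sub>R v) \<and>
        (planar (p + t *\<^sub>R v) \<and> \<pi> (p + t *\<^sub>R v) = {z. C \<bullet> z = C \<bullet> p})}"
    proof
      fix t assume t: "t \<in> ?N"
      let ?y = "p + t *\<^sub>R v"
      have nz: "G ?y \<noteq> 0" using GC[of t] \<open>C \<noteq> 0\<close> t by simp
      obtain u n b where u: "\<And>r. u \<noteq> r *\<^sub>R v" "G ?y \<bullet> v = 0" "G ?y \<bullet> u = 0"
        and n: "n \<noteq> 0" "n \<bullet> v = 0" "n \<bullet> u = 0" "\<pi> ?y = {z. n \<bullet> z = b}" "n \<bullet> ?y = b" and "planar ?y"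
        using planar_pt[OF _ refl nz] t by blast
      obtain r where r: "n = r *\<^sub>R G ?y" using perp_parallel[OF nz u(2,3) n(2,3) v(1) u(1)] by blast
      then have nC: "n = (r * poly (P i) t) *\<^sub>R C" unfolding GC by simp
      have "C \<bullet> v = 0" using n(2) n(1) unfolding nC by auto
      then have "b = (r * poly (P i) t) * (C \<bullet> p)" using n(5) unfolding nC by (simp add: inner_add_right)
      moreover have "r * poly (P i) t \<noteq> 0" using n(1) nC by auto
      ultimately have "\<pi> ?y = {z. C \<bullet> z = C \<bullet> p}" unfolding n(4) nC by auto
      then show "t \<in> {t. p + t *\<^sub>R v \<in> S \<and> l \<in> E (p + t *\<^sub>R v) \<and>
        (planar (p + t *\<^sub>R v) \<and> \<pi> (p + t *\<^sub>R v) = {z. C \<bullet> z = C \<bullet> p})}"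
        using t \<open>planar ?y\<close> by (auto simp: TS_def)
    qed
    then have "card ?N \<le> card {t. p + t *\<^sub>R v \<in> S \<and> l \<in> E (p + t *\<^sub>R v) \<and>
        (planar (p + t *\<^sub>R v) \<and> \<pi> (p + t *\<^sub>R v) = {z. C \<bullet> z = C \<bullet> p})}"
      by (intro card_mono) (use finTT[OF v] in \<open>auto intro: rev_finite_subset\<close>)
    also have "\<dots> = card {x \<in> S. l \<in> E x \<and> (planar x \<and> \<pi> x = {z. C \<bullet> z = C \<bullet> p})}" by (rule TT[OF v])
    also have "{x \<in> S. l \<in> E x \<and> (planar x \<and> \<pi> x = {z. C \<bullet> z = C \<bullet> p})}
        = {x \<in> S. planar x \<and> l \<in> E x \<and> \<pi> x = {z. C \<bullet> z = C \<bullet> p}}" by auto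
    finally have "card ?N \<le> \<tau>" using pop[OF l, of "{z. C \<bullet> z = C \<bullet> p}"] by linarith
    moreover have "card TS = card ?Z + card ?N"
    proof -
      have "card (?Z \<union> ?N) = card ?Z + card ?N" by (rule card_Un_disjoint) (use finTS in auto)
      moreover have "?Z \<union> ?N = TS" by blast
      ultimately show ?thesis by simp
    qed
    ultimately show False using cardTS T Z by linarith
  qed
  have "G x $ j = 0" for x j
  proof (rule ccontr)
    assume nz: "G x $ j \<noteq> 0"
    then have "d' \<noteq> 0" using fun_cong[OF G0, of x] by (intro notI) simp
    \<comment> \<open>By \<open>crit\<close> a nonzero derivative would lie in the minimised class
      with smaller degree. So all derivatives vanish, and \<open>f\<close> is a constant with a
      zero.\<close>
    moreover have "V (d' - 1) (\<lambda>x. G x $ j)"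
      unfolding V_def
    proof (intro conjI allI ballI)
      fix y t
      have "((\<lambda>y. f (y + t *\<^sub>R e)) has_derivative (\<lambda>h. G (y + t *\<^sub>R e) \<bullet> h)) (at y)"
        by (rule has_derivative_compose[OF _ df]) (auto intro!: derivative_eq_intros)
      then have "(\<lambda>h. G (y + t *\<^sub>R e) \<bullet> h) = (\<lambda>h. G y \<bullet> h)"
        unfolding f(3) using has_derivative_unique df by blast
      then have "\<forall>h. h \<bullet> G (y + t *\<^sub>R e) = h \<bullet> G y" by (simp add: fun_eq_iff inner_commute)
      then have "G (y + t *\<^sub>R e) = G y" by (rule vector_eq_ldot[THEN iffD1])
      then show "G (y + t *\<^sub>R e) $ j = G y $ j" by simp
    next
      show "\<exists>x. G x $ j \<noteq> 0" using nz by blast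
    qed (use Gp crit in auto)
    ultimately show False using d'_min[of "d' - 1"] by simp
  qed
  then have "G x = 0" for x by (simp add: vec_eq_iff)
  then have "(f has_derivative (\<lambda>h. 0)) (at x)" for x using df[of x] by simp
  then obtain c where c: "\<And>x. f x = c"
    using has_derivative_zero_constant[of UNIV f] by auto
  obtain l where "l \<in> R" using R(1) by blast
  then obtain x where "x \<in> l" using line0 by blast
  then have "c = 0" using f(4)[OF \<open>l \<in> R\<close>] c by auto
  then show False using f(2) c by auto
qed

text \<open>A pair \<open>(R, S')\<close> maximising \<open>\<Phi>\<close> has both properties, since otherwise deleting one line or
  one point would increase \<open>\<Phi>\<close>.\<close>

lemma prune_incidences:
  fixes w T :: real
  assumes fin: "finite L" "finite S" and E: "\<And>x. x \<in> S \<Longrightarrow> E x \<subseteq> L"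
    and "0 \<le> T" and large: "T * card L < w * card S"
  obtains R S' where "R \<subseteq> L" "S' \<subseteq> S" "S' \<noteq> {}"
    "\<And>l. l \<in> R \<Longrightarrow> T \<le> card {x \<in> S'. l \<in> E x}" "\<And>x. x \<in> S' \<Longrightarrow> card (E x - R) \<le> w"
proof -
  \<comment> \<open>Each point earns \<open>w\<close>, less one for every line of \<open>E x\<close>
    missing from \<open>R\<close>, and each line kept costs \<open>T\<close>. At
    \<open>(L, S)\<close> the value is positive by \<open>large\<close>, while without points it is
    at most 0.\<close>
  define \<Phi> where "\<Phi> p = (\<Sum>x\<in>snd p. w - card (E x - fst p)) - T * card (fst p)" for p
  let ?X = "Pow L \<times> Pow S"
  have "finite ?X" "?X \<noteq> {}" using fin by auto
  then have "Max (\<Phi> ` ?X) \<in> \<Phi> ` ?X" by (intro Max_in) auto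
  then obtain p where p: "p \<in> ?X" "\<Phi> p = Max (\<Phi> ` ?X)" by auto
  obtain R S' where RS: "p = (R, S')" "R \<subseteq> L" "S' \<subseteq> S" using p(1) by auto
  have max: "\<Phi> (R', S'') \<le> \<Phi> (R, S')" if "R' \<subseteq> L" "S'' \<subseteq> S" for R' S''
    using p(2) that \<open>finite ?X\<close> unfolding RS(1) by (auto intro!: Max_ge)
  have finRS: "finite R" "finite S'" using RS fin finite_subset by auto
  have finE: "finite (E x)" if "x \<in> S'" for x
    using E that RS(3) fin(1) finite_subset by blast
  show thesis
  proof
    show "R \<subseteq> L" "S' \<subseteq> S" using RS by auto
    show "S' \<noteq> {}"
    proof
      assume "S' = {}"
      then have "\<Phi> (R, S') \<le> 0" using \<open>0 \<le> T\<close> by (simp add: \<Phi>_def)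
      moreover have "card (E x - L) = 0" if "x \<in> S" for x
        using E[OF that] by (metis Diff_eq_empty_iff card.empty)
      then have "\<Phi> (L, S) = w * card S - T * card L" by (simp add: \<Phi>_def mult.commute)
      ultimately show False using max[of L S] large by simp
    qed
    show "T \<le> card {x \<in> S'. l \<in> E x}" if l: "l \<in> R" for l
    proof -
      have c: "card (E x - (R - {l})) = card (E x - R) + (if l \<in> E x then 1 else 0)" if "x \<in> S'" for x
      proof (cases "l \<in> E x")
        case True
        then have "E x - (R - {l}) = insert l (E x - R)" using l by auto
        then show ?thesis using finE[OF that] l True by simp
      next
        case False
        then have "E x - (R - {l}) = E x - R" by auto
        then show ?thesis using False by simp
      qed
      have "(\<Sum>x\<in>S'. w - real (card (E x - (R - {l})))) =
          (\<Sum>x\<in>S'. (w - real (card (E x - R))) - (if l \<in> E x then 1 else 0))"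
        by (intro sum.cong refl) (simp add: c)
      also have "\<dots> = (\<Sum>x\<in>S'. w - real (card (E x - R))) - (\<Sum>x\<in>S'. if l \<in> E x then 1 else 0)"
        by (rule sum_subtractf)
      also have "(\<Sum>x\<in>S'. if l \<in> E x then 1 else 0) = real (card {x \<in> S'. l \<in> E x})"
        using finRS by (simp add: sum.If_cases Int_def)
      finally have "\<Phi> (R - {l}, S') = \<Phi> (R, S') - card {x \<in> S'. l \<in> E x} + T * (real (card R) - real (card (R - {l})))"
        by (simp add: \<Phi>_def algebra_simps)
      moreover have "real (card R) - real (card (R - {l})) = 1"
        using l finRS(1) card_Suc_Diff1[of R l] by linarith
      ultimately show ?thesis using max[of "R - {l}" S'] RS by auto
    qed
    show "card (E x - R) \<le> w" if x: "x \<in> S'" for x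
    proof -
      have "\<Phi> (R, S') = \<Phi> (R, S' - {x}) + (w - card (E x - R))"
        using x finRS by (simp add: \<Phi>_def sum.remove)
      then show ?thesis using max[of R "S' - {x}"] RS by auto
    qed
  qed
qed

section \<open>Incidence bounds at a free scale\<close>

text \<open>\<open>robust\<close> is the joint condition in a form that survives pruning. If too
  many points lie on the zero set, pruning leaves a configuration that \<open>algebraic_core\<close>
  excludes; the points off it are counted by cells. The factor 56 comes from
  \<open>T + (D + 1) = \<tau> + 3 * D + 2\<close> with \<open>D \<le> 18 * 2 ^ q\<close>.\<close>

lemma incidence_core:
  fixes S :: "(real^3) set" and \<pi> :: "real^3 \<Rightarrow> (real^3) set" and A :: "3 set" and w \<tau> :: real
  assumes L: "finite L" "\<And>l. l \<in> L \<Longrightarrow> is_line l" and S: "finite S"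
    and E: "\<And>x. x \<in> S \<Longrightarrow> E x \<subseteq> L" "\<And>x l. x \<in> S \<Longrightarrow> l \<in> E x \<Longrightarrow> x \<in> l"
      "\<And>x. x \<in> S \<Longrightarrow> w < card (E x)"
    and A: "A \<noteq> {}" "\<And>i. i \<in> A \<Longrightarrow> e $ i = 0" and w: "0 \<le> w" and \<tau>: "0 \<le> \<tau>"
    and robust: "\<And>x F. x \<in> S \<Longrightarrow> F \<subseteq> E x \<Longrightarrow> card (E x - F) \<le> w \<Longrightarrow>
        span (insert e (\<Union>l\<in>F. direction l)) = UNIV \<or>
        planar x \<and> plane (\<pi> x) \<and> (\<forall>l\<in>E x. l \<subseteq> \<pi> x) \<and> 3 \<le> card F"
    and pop: "\<And>l P. l \<in> L \<Longrightarrow> card {x \<in> S. planar x \<and> l \<in> E x \<and> \<pi> x = P} \<le> \<tau>"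
  shows "w * card S \<le> (\<tau> + 56 * 2 ^ q) * card L + (card S)\<^sup>2 / 2 ^ (card A * q)"
proof -
  define D where "D = 2 * (card A)\<^sup>2 * 2 ^ q"
  have D: "real D \<le> 18 * 2 ^ q"
  proof -
    have "card A \<le> card (UNIV :: 3 set)" by (intro card_mono) auto
    then have "(card A)\<^sup>2 \<le> 3\<^sup>2" by (intro power_mono) auto
    then have "D \<le> 2 * 3\<^sup>2 * 2 ^ q" unfolding D_def by (intro mult_right_mono mult_left_mono) auto
    then have "real D \<le> real (2 * 3\<^sup>2 * 2 ^ q)" by (simp only: of_nat_le_iff)
    then show ?thesis by simp
  qed
  obtain f \<kappa> where dec: "cell_decomposition A S D (card A * q) f \<kappa>"
    using cell_decomposition_exists[OF S A(1)] unfolding D_def by blast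
  have f: "poly_fun D f" "depends_on A f" "\<exists>x. f x \<noteq> 0"
    using dec unfolding cell_decomposition_def by auto
  let ?off = "{x \<in> S. f x \<noteq> 0}" and ?on = "{x \<in> S. f x = 0}"
  define T where "T = \<tau> + 2 * D + 1"
  have "w * card ?on \<le> T * card L"
  proof (rule ccontr)
    assume "\<not> ?thesis"
    then have large: "T * card L < w * card ?on" by simp
    obtain R S' where RS: "R \<subseteq> L" "S' \<subseteq> ?on" "S' \<noteq> {}"
      "\<And>l. l \<in> R \<Longrightarrow> T \<le> card {x \<in> S'. l \<in> E x}" "\<And>x. x \<in> S' \<Longrightarrow> card (E x - R) \<le> w"
      by (rule prune_incidences[OF L(1) _ _ _ large, of E]) (use S E \<tau> in \<open>auto simp: T_def\<close>)
    have S'S: "S' \<subseteq> S" using RS(2) by auto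
    have "R \<noteq> {}"
    proof
      assume "R = {}"
      obtain x where "x \<in> S'" using RS(3) by blast
      then show False using RS(5)[of x] E(3)[of x] S'S \<open>R = {}\<close> by auto
    qed
    show False
    proof (rule algebraic_core[of D f e S' R E T planar \<pi> \<tau>])
      show "f (x + t *\<^sub>R e) = f x" for x t
        using f(2) A(2) unfolding depends_on_def by simp
      show "span (insert e (\<Union>l\<in>E x \<inter> R. direction l)) = UNIV \<or>
        planar x \<and> plane (\<pi> x) \<and> (\<forall>l\<in>E x. l \<subseteq> \<pi> x) \<and> 3 \<le> card (E x \<inter> R)" if "x \<in> S'" for x
        using that RS(5)[OF that] S'S by (intro robust) (auto simp: Diff_Int)
      show "card {x \<in> S'. planar x \<and> l \<in> E x \<and> \<pi> x = P} \<le> \<tau>" if "l \<in> R" for l P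
      proof -
        have "card {x \<in> S'. planar x \<and> l \<in> E x \<and> \<pi> x = P} \<le> card {x \<in> S. planar x \<and> l \<in> E x \<and> \<pi> x = P}"
          using S S'S by (intro card_mono) auto
        then show ?thesis using pop[of l P] that RS(1) by fastforce
      qed
      show "finite S'" using S S'S finite_subset by blast
      show "\<And>x. x \<in> S' \<Longrightarrow> f x = 0" using RS(2) by auto
      show "\<And>l. l \<in> R \<Longrightarrow> is_line l" using RS(1) L(2) by auto
      show "\<And>x l. x \<in> S' \<Longrightarrow> l \<in> E x \<Longrightarrow> x \<in> l" using E(2) S'S by blast
      show "\<tau> + 2 * real D < T" by (simp add: T_def)
    qed (use f RS(4) \<open>R \<noteq> {}\<close> in auto)
  qed
  moreover have "w * card ?off \<le> (real D + 1) * card L + (card S)\<^sup>2 / 2 ^ (card A * q)"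
  proof -
    have "w * card ?off = (\<Sum>x\<in>?off. w)" by simp
    also have "\<dots> \<le> (\<Sum>x\<in>?off. real (card (E x)))"
      by (intro sum_mono) (use E(3) in \<open>auto intro: less_imp_le\<close>)
    also have "\<dots> = (\<Sum>x\<in>?off. real (card {l \<in> L. l \<in> E x}))"
    proof (intro sum.cong refl)
      fix x assume "x \<in> ?off"
      then have "E x = {l \<in> L. l \<in> E x}" using E(1) by auto
      then show "real (card (E x)) = real (card {l \<in> L. l \<in> E x})" by simp
    qed
    also have "\<dots> = real (\<Sum>x\<in>?off. card {l \<in> L. l \<in> E x})" by (rule of_nat_sum[symmetric])
    also have "(\<Sum>x\<in>?off. card {l \<in> L. l \<in> E x}) = (\<Sum>l\<in>L. card {x \<in> ?off. l \<in> E x})"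
      by (rule sum_card_filter_swap) (use S L(1) in auto)
    also have "\<dots> \<le> real (\<Sum>l\<in>L. card {x \<in> S. f x \<noteq> 0 \<and> x \<in> l})"
      unfolding of_nat_le_iff
      by (intro sum_mono card_mono) (use S E(2) in auto)
    finally have 1: "w * card ?off \<le> real (\<Sum>l\<in>L. card {x \<in> S. f x \<noteq> 0 \<and> x \<in> l})" .
    have "real (2 ^ (card A * q) * (\<Sum>l\<in>L. card {x \<in> S. f x \<noteq> 0 \<and> x \<in> l}))
        \<le> real (2 ^ (card A * q) * ((D + 1) * card L) + (card S)\<^sup>2)"
      unfolding of_nat_le_iff by (rule incidences_off_surface[OF L S dec])
    then have "real (\<Sum>l\<in>L. card {x \<in> S. f x \<noteq> 0 \<and> x \<in> l}) \<le> (real D + 1) * card L + (card S)\<^sup>2 / 2 ^ (card A * q)"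
      by (simp add: field_simps del: of_nat_sum)
    with 1 show ?thesis by linarith
  qed
  moreover have "card S = card ?on + card ?off"
  proof -
    have "card (?on \<union> ?off) = card ?on + card ?off" using S by (intro card_Un_disjoint) auto
    moreover have "?on \<union> ?off = S" by blast
    ultimately show ?thesis by simp
  qed
  moreover have "T * card L + (real D + 1) * card L \<le> (\<tau> + 56 * 2 ^ q) * card L"
  proof -
    have "(1::real) \<le> 2 ^ q" by simp
    then have "T + (real D + 1) \<le> \<tau> + 56 * 2 ^ q" using D unfolding T_def by linarith
    from mult_right_mono[OF this, of "real (card L)"] show ?thesis by (simp add: distrib_right)
  qed
  ultimately show ?thesis by (simp add: distrib_left)
qed

section \<open>Choice of the scale\<close>

text \<open>The least \<open>q\<close> with \<open>4 * s \<le> w * 2 ^ (m * q)\<close> makes the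
  quadratic term at most a quarter of \<open>w * s\<close>; if it is positive, its minimality bounds
  \<open>X = 2 ^ q\<close> from above. The factor 3/4 allows a caller to absorb a further term of a
  quarter of \<open>w * s\<close>.\<close>

lemma choose_scale:
  fixes w s l :: real
  assumes w: "0 < w" and s: "0 \<le> s" and m: "1 \<le> m" and l: "0 \<le> l"
    and le: "\<And>q. 3/4 * (w * s) \<le> 56 * 2 ^ q * l + s\<^sup>2 / 2 ^ (m * q)"
  shows "w * s \<le> 112 * l \<or> (\<exists>X\<ge>0. w * X ^ m \<le> 4 * 2 ^ m * s \<and> w * s \<le> 112 * X * l)"
proof -
  define ok where "ok q \<longleftrightarrow> 4 * s \<le> w * 2 ^ (m * q)" for q :: nat
  have "\<exists>q. ok q"
  proof -
    obtain q :: nat where q: "4 * s / w < 2 ^ q" using real_arch_pow[of 2 "4 * s / w"] by auto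
    also have "(2::real) ^ q \<le> 2 ^ (m * q)" using m by (intro power_increasing) auto
    finally have "4 * s / w < 2 ^ (m * q)" .
    then have "ok q" unfolding ok_def using w by (simp add: field_simps)
    then show ?thesis ..
  qed
  define q where "q = (LEAST q. ok q)"
  have q: "ok q" unfolding q_def by (rule LeastI_ex) fact
  have "s\<^sup>2 / 2 ^ (m * q) \<le> w * s / 4"
  proof -
    have "s * (4 * s) \<le> s * (w * 2 ^ (m * q))" using q s unfolding ok_def by (rule mult_left_mono)
    then show ?thesis by (simp add: field_simps power2_eq_square)
  qed
  then have ws: "w * s \<le> 112 * 2 ^ q * l" using le[of q] by linarith
  show ?thesis
  proof (cases q)
    case 0
    then show ?thesis using ws by simp
  next
    case (Suc r)
    have "\<not> ok r" using not_less_Least[of r ok] Suc unfolding q_def by simp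
    then have "w * 2 ^ (m * r) \<le> 4 * s" by (simp add: ok_def)
    moreover have "(2 ^ q) ^ m = 2 ^ m * (2::real) ^ (m * r)"
      unfolding Suc by (simp add: power_mult_distrib power_mult[symmetric] mult.commute)
    ultimately have "w * (2 ^ q) ^ m \<le> 4 * 2 ^ m * s" by (simp add: mult.assoc mult.left_commute)
    then show ?thesis using ws by (intro disjI2 exI[of _ "2 ^ q"]) auto
  qed
qed

text \<open>The scale \<open>X\<close> is eliminated: cubing \<open>w * s \<le> 112 * X * l\<close>
  brings in \<open>X ^ 3\<close>, which the other bound controls, and one factor \<open>s\<close>
  cancels.\<close>

lemma choose_scale_3:
  fixes w s l :: real
  assumes w: "0 < w" and s: "0 \<le> s" and l: "0 \<le> l"
    and le: "\<And>q. 3/4 * (w * s) \<le> 56 * 2 ^ q * l + s\<^sup>2 / 2 ^ (3 * q)"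
  shows "w * s \<le> 112 * l \<or> w ^ 4 * s\<^sup>2 \<le> 44957696 * l ^ 3"
proof -
  have "w ^ 4 * s\<^sup>2 \<le> 44957696 * l ^ 3"
    if X: "0 \<le> X" "w * X ^ 3 \<le> 4 * 2 ^ 3 * s" "w * s \<le> 112 * X * l" for X
  proof (cases "s = 0")
    case False
    have "(w * s) ^ 3 \<le> (112 * X * l) ^ 3" using X(3) w s by (intro power_mono) auto
    then have "w * (w * s) ^ 3 \<le> w * (112 * X * l) ^ 3" using w by (intro mult_left_mono) auto
    also have "\<dots> = 1404928 * l ^ 3 * (w * X ^ 3)" by (simp add: power_mult_distrib)
    also have "\<dots> \<le> 1404928 * l ^ 3 * (4 * 2 ^ 3 * s)" using X(2) l by (intro mult_left_mono) auto
    finally have "s * (w ^ 4 * s\<^sup>2) \<le> s * (44957696 * l ^ 3)"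
      by (simp add: power_mult_distrib power2_eq_square power3_eq_cube power4_eq_xxxx algebra_simps)
    then show ?thesis using False s by simp
  qed (use l in simp)
  then show ?thesis using choose_scale[OF w s _ l le] by auto
qed

lemma choose_scale_2:
  fixes w s l :: real
  assumes w: "0 < w" and s: "0 \<le> s" and l: "0 \<le> l"
    and le: "\<And>q. 3/4 * (w * s) \<le> 56 * 2 ^ q * l + s\<^sup>2 / 2 ^ (2 * q)"
  shows "w * s \<le> 112 * l \<or> w ^ 3 * s \<le> 200704 * l\<^sup>2"
proof -
  have "w ^ 3 * s \<le> 200704 * l\<^sup>2"
    if X: "0 \<le> X" "w * X ^ 2 \<le> 4 * 2 ^ 2 * s" "w * s \<le> 112 * X * l" for X
  proof (cases "s = 0")
    case False
    have "(w * s) ^ 2 \<le> (112 * X * l) ^ 2" using X(3) w s by (intro power_mono) auto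
    then have "w * (w * s) ^ 2 \<le> w * (112 * X * l) ^ 2" using w by (intro mult_left_mono) auto
    also have "\<dots> = 12544 * l ^ 2 * (w * X ^ 2)" by (simp add: power_mult_distrib)
    also have "\<dots> \<le> 12544 * l ^ 2 * (4 * 2 ^ 2 * s)" using X(2) l by (intro mult_left_mono) auto
    finally have "s * (w ^ 3 * s) \<le> s * (200704 * l\<^sup>2)"
      by (simp add: power_mult_distrib power2_eq_square power3_eq_cube algebra_simps)
    then show ?thesis using False s by simp
  qed (use l in simp)
  then show ?thesis using choose_scale[OF w s _ l le] by auto
qed

section \<open>The Szemeredi-Trotter bound in a plane\<close>

lemma span_three_eq_UNIV:
  fixes e u v n :: "real^3"
  assumes "n \<bullet> u = 0" "n \<bullet> v = 0" "n \<bullet> e \<noteq> 0" "v \<noteq> 0" "\<And>r. u \<noteq> r *\<^sub>R v"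
  shows "span {e, u, v} = UNIV"
proof -
  have uv: "u \<notin> span {v}" using assms(5) by (auto simp: span_singleton)
  have ind: "independent {u, v}" using assms(4) uv by (intro independent_insertI independent_empty) auto
  have "e \<notin> span {u, v}"
  proof
    assume "e \<in> span {u, v}"
    moreover have "orthogonal n y" if "y \<in> {u, v}" for y using that assms by (auto simp: orthogonal_def)
    ultimately have "orthogonal n e" using orthogonal_to_span by blast
    then show False using assms(3) by (simp add: orthogonal_def)
  qed
  then have ind3: "independent {e, u, v}" using ind by (rule independent_insertI)
  have "u \<noteq> v" using uv by (auto simp: span_base)
  moreover have "e \<notin> {u, v}" using \<open>e \<notin> span {u, v}\<close> span_base[of e "{u, v}"] by auto
  ultimately have "card {e, u, v} = 3" by auto
  then have "dim {e, u, v} = 3" using dim_eq_card_independent[OF ind3] by simp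
  then show ?thesis using dim_eq_full[of "{e, u, v}"] by simp
qed

text \<open>Two coordinates give \<open>2 ^ (2 * q)\<close> cells at degree of order
  \<open>2 ^ q\<close>, whence the exponents of the planar bound. The coordinate left out is one in
  which the normal of the plane is nonzero. Losing \<open>h / 3\<close> lines at a point leaves two,
  because \<open>3 \<le> h\<close>, and these span together with \<open>?e\<close>.\<close>

lemma planar_szemeredi_trotter:
  fixes S :: "(real^3) set" and h :: real
  assumes P: "plane P" and M: "finite M" "\<And>l. l \<in> M \<Longrightarrow> is_line l" "\<And>l. l \<in> M \<Longrightarrow> l \<subseteq> P"
    and S: "finite S" and h: "3 \<le> h" and rich: "\<And>x. x \<in> S \<Longrightarrow> h \<le> card {l \<in> M. x \<in> l}"
  shows "card S \<le> 336 * card M / h + 5419008 * (card M)\<^sup>2 / h ^ 3"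
proof -
  obtain n b where n: "n \<noteq> 0" "P = {y. n \<bullet> y = b}" using P by (auto simp: plane_def)
  obtain i where i: "n $ i \<noteq> 0" using n(1) by (auto simp: vec_eq_iff)
  let ?A = "UNIV - {i} :: 3 set" and ?e = "axis i 1 :: real^3"
  let ?E = "\<lambda>x. {l \<in> M. x \<in> l}"
  have cardA: "card ?A = 2" by (simp add: card_Diff_singleton)
  have core: "h/3 * card S \<le> (0 + 56 * 2 ^ q) * real (card M) + (card S)\<^sup>2 / 2 ^ (card ?A * q)" for q
  proof (rule incidence_core[of M S ?E "h/3" ?A ?e 0 "\<lambda>_. False" "\<lambda>_. {}"])
    show "?A \<noteq> {}" using cardA by (metis card.empty zero_neq_numeral)
    show "\<And>j. j \<in> ?A \<Longrightarrow> ?e $ j = 0" by (simp add: axis_def)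
    show "h/3 < card (?E x)" if "x \<in> S" for x using rich[OF that] h by linarith
    fix x F assume x: "x \<in> S" and F: "F \<subseteq> ?E x" "card (?E x - F) \<le> h/3"
    have "card (?E x - F) = card (?E x) - card F" "card F \<le> card (?E x)"
      using F(1) M(1) by (auto intro: card_Diff_subset card_mono finite_subset)
    then have "2 \<le> card F" using rich[OF x] F(2) h by linarith
    then obtain G where "G \<subseteq> F" "card G = 2" using obtain_subset_with_card_n by metis
    then obtain l m where lm: "l \<in> F" "m \<in> F" "l \<noteq> m" using card_2_iff[of G] by auto
    then have l: "is_line l" "x \<in> l" "l \<subseteq> P" and m: "is_line m" "x \<in> m" "m \<subseteq> P" using F(1) M by auto
    obtain u where u: "u \<noteq> 0" "l = range (\<lambda>t. x + t *\<^sub>R u)" "direction l = range (\<lambda>t. t *\<^sub>R u)"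
      using is_line_param[OF l(1,2)] by blast
    obtain v where v: "v \<noteq> 0" "m = range (\<lambda>t. x + t *\<^sub>R v)" "direction m = range (\<lambda>t. t *\<^sub>R v)"
      using is_line_param[OF m(1,2)] by blast
    have "x + 1 *\<^sub>R u \<in> l" "x + 1 *\<^sub>R v \<in> m" using u(2) v(2) by blast+
    then have mem: "x + u \<in> l" "x + v \<in> m" by simp_all
    then have "n \<bullet> (x + u) = b" "n \<bullet> (x + v) = b" "n \<bullet> x = b" using l m n(2) by blast+
    then have perp: "n \<bullet> u = 0" "n \<bullet> v = 0" by (simp_all add: inner_add_right)
    have "u \<noteq> r *\<^sub>R v" for r
    proof
      assume "u = r *\<^sub>R v"
      then have "x + u \<in> m" using v(2) by auto
      then have "l = m" using line_eqI[OF l(1) m(1) l(2) mem(1) m(2)] u(1) by simp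
      then show False using lm(3) by simp
    qed
    moreover have "n \<bullet> ?e \<noteq> 0" using i by (simp add: inner_axis)
    ultimately have "span {?e, u, v} = UNIV" using span_three_eq_UNIV[OF perp _ v(1)] by blast
    moreover have "{?e, u, v} \<subseteq> insert ?e (\<Union>l\<in>F. direction l)"
    proof -
      have "1 *\<^sub>R u \<in> direction l" "1 *\<^sub>R v \<in> direction m" using u(3) v(3) by blast+
      then have "u \<in> direction l" "v \<in> direction m" by simp_all
      then show ?thesis using lm by blast
    qed
    ultimately show "span (insert ?e (\<Union>l\<in>F. direction l)) = UNIV \<or>
        False \<and> plane {} \<and> (\<forall>l\<in>?E x. l \<subseteq> {}) \<and> 3 \<le> card F"
      using span_mono by blast
  qed (use M S h in auto)
  have "h/3 * card S \<le> 112 * real (card M) \<or> (h/3) ^ 3 * card S \<le> 200704 * (real (card M))\<^sup>2"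
  proof (rule choose_scale_2)
    show "3/4 * (h/3 * card S) \<le> 56 * 2 ^ q * real (card M) + (real (card S))\<^sup>2 / 2 ^ (2 * q)" for q
    proof -
      have "0 \<le> h/3 * card S" using h by simp
      then show ?thesis using core[of q] unfolding cardA by (simp add: mult.commute)
    qed
  qed (use h in auto)
  then have "card S \<le> 336 * card M / h \<or> card S \<le> 5419008 * (card M)\<^sup>2 / h ^ 3"
    using h by (auto simp: field_simps power3_eq_cube)
  moreover have "0 \<le> 336 * card M / h" "0 \<le> 5419008 * (card M)\<^sup>2 / h ^ 3" using h by auto
  ultimately show ?thesis by linarith
qed

section \<open>Counting joints\<close>

lemma not_directions_span_in_plane:
  assumes "plane P" "\<And>l. l \<in> T \<Longrightarrow> l \<subseteq> P"
  shows "\<not> directions_span T"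
proof
  assume span: "directions_span T"
  obtain n b where n: "n \<noteq> 0" "P = {y. n \<bullet> y = b}" using assms(1) by (auto simp: plane_def)
  have "orthogonal n w" if w: "w \<in> (\<Union>l\<in>T. direction l)" for w
  proof -
    obtain l p q where l: "l \<in> T" "p \<in> l" "q \<in> l" "w = q - p" using w by (auto simp: direction_def)
    then have "n \<bullet> p = b" "n \<bullet> q = b" using assms(2)[OF l(1)] n(2) by auto
    then show ?thesis by (simp add: l(4) orthogonal_def inner_diff_right)
  qed
  moreover have "n \<in> span (\<Union>l\<in>T. direction l)" using span by (simp add: directions_span_def)
  ultimately have "orthogonal n n" using orthogonal_to_span by blast
  then show False using n(1) by (simp add: orthogonal_def)
qed

lemma directions_span_or_in_plane:
  assumes T: "\<And>l. l \<in> T \<Longrightarrow> is_line l \<and> x \<in> l" and "\<not> directions_span T"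
  obtains P where "plane P" "x \<in> P" "\<And>l. l \<in> T \<Longrightarrow> l \<subseteq> P"
proof -
  have "span (\<Union>l\<in>T. direction l) \<noteq> UNIV" using assms(2) by (simp add: directions_span_def)
  then obtain a where a: "a \<noteq> 0" "\<And>y. y \<in> span (\<Union>l\<in>T. direction l) \<Longrightarrow> a \<bullet> y = 0"
    using span_not_UNIV_orthogonal by blast
  show thesis
  proof (rule that[of "{y. a \<bullet> y = a \<bullet> x}"])
    show "plane {y. a \<bullet> y = a \<bullet> x}" using a(1) by (auto simp: plane_def)
    fix l assume l: "l \<in> T"
    show "l \<subseteq> {y. a \<bullet> y = a \<bullet> x}"
    proof
      fix y assume "y \<in> l"
      then have "y - x \<in> direction l" using T[OF l] by (auto simp: direction_def)
      then have "a \<bullet> (y - x) = 0" using a(2)[OF span_base] l by blast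
      then show "y \<in> {y. a \<bullet> y = a \<bullet> x}" by (simp add: inner_diff_right)
    qed
  qed simp
qed

lemma line_subset_plane:
  assumes "is_line l" "plane P" "x \<in> l" "y \<in> l" "x \<in> P" "y \<in> P" "x \<noteq> y"
  shows "l \<subseteq> P"
proof -
  obtain n b where n: "P = {y. n \<bullet> y = b}" using assms(2) by (auto simp: plane_def)
  obtain u where u: "l = range (\<lambda>t. x + t *\<^sub>R u)" using is_line_param[OF assms(1,3)] by blast
  then obtain t where t: "y = x + t *\<^sub>R u" using assms(4) by auto
  have "t \<noteq> 0" using t assms(7) by auto
  moreover have "n \<bullet> x = b" "n \<bullet> y = b" using assms(5,6) n by auto
  ultimately have "n \<bullet> u = 0" unfolding t by (simp add: inner_add_right)
  then show ?thesis using \<open>n \<bullet> x = b\<close> unfolding u n by (auto simp: inner_add_right)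
qed

text \<open>A spanning triple is not contained in \<open>P\<close>: pick a line of it outside
  \<open>P\<close> and then the other two freely.\<close>

lemma multiplicity_at_le:
  assumes "finite \<LL>" "plane P"
  shows "multiplicity_at \<LL> x \<le>
    card {l \<in> lines_through \<LL> x. \<not> l \<subseteq> P} * (card (lines_through \<LL> x))\<^sup>2"
proof -
  let ?LT = "lines_through \<LL> x"
  let ?off = "{l \<in> ?LT. \<not> l \<subseteq> P}"
  have fin: "finite ?LT" using assms(1) by (simp add: lines_through_def)
  have "{T. T \<subseteq> ?LT \<and> card T = 3 \<and> directions_span T} \<subseteq> (\<lambda>(a, b, c). {a, b, c}) ` (?off \<times> ?LT \<times> ?LT)"
  proof
    fix T assume "T \<in> {T. T \<subseteq> ?LT \<and> card T = 3 \<and> directions_span T}"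
    then have T: "T \<subseteq> ?LT" "card T = 3" "directions_span T" by auto
    obtain a where a: "a \<in> T" "\<not> a \<subseteq> P"
      using not_directions_span_in_plane[OF assms(2), of T] T(3) by blast
    have "card (T - {a}) = 2" using T(2) a(1) by (simp add: card_Diff_singleton)
    then obtain b c where bc: "T - {a} = {b, c}" by (meson card_2_iff)
    then have "T = {a, b, c}" using a(1) by blast
    then show "T \<in> (\<lambda>(a, b, c). {a, b, c}) ` (?off \<times> ?LT \<times> ?LT)"
      using T(1) a by (intro image_eqI[of _ _ "(a, b, c)"]) auto
  qed
  then have "multiplicity_at \<LL> x \<le> card ((\<lambda>(a, b, c). {a, b, c}) ` (?off \<times> ?LT \<times> ?LT))"
    unfolding multiplicity_at_def using fin by (intro card_mono) auto
  also have "\<dots> \<le> card (?off \<times> ?LT \<times> ?LT)" using fin by (intro card_image_le) auto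
  also have "\<dots> = card ?off * (card ?LT)\<^sup>2" by (simp add: card_cartesian_product power2_eq_square)
  finally show ?thesis .
qed

text \<open>At most \<open>c / \<mu>\<close> indices have \<open>M P > \<mu>\<close>, and
  \<open>few\<close> treats them; for the others \<open>(M P)^2 \<le> \<mu> * M P\<close> makes the
  quadratic bound linear.\<close>

lemma sum_le_split_at_threshold:
  fixes n M :: "'p \<Rightarrow> real" and a b c g \<mu> :: real
  assumes fin: "finite \<P>" and nonneg: "\<And>P. P \<in> \<P> \<Longrightarrow> 0 \<le> M P" "0 \<le> a" "0 \<le> b" "0 \<le> g" and \<mu>: "0 < \<mu>"
    and n: "\<And>P. P \<in> \<P> \<Longrightarrow> n P \<le> a * M P + b * (M P)\<^sup>2"
    and M: "(\<Sum>P\<in>\<P>. M P) \<le> c"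
    and few: "\<And>Q. Q \<subseteq> \<P> \<Longrightarrow> (\<Sum>P\<in>Q. n P) \<le> g * card Q"
  shows "(\<Sum>P\<in>\<P>. n P) \<le> a * c + b * \<mu> * c + g * c / \<mu>"
proof -
  let ?Q = "{P \<in> \<P>. \<mu> < M P}"
  have "\<mu> * card ?Q = (\<Sum>P\<in>?Q. \<mu>)" by simp
  also have "\<dots> \<le> (\<Sum>P\<in>?Q. M P)" by (intro sum_mono) auto
  also have "\<dots> \<le> (\<Sum>P\<in>\<P>. M P)" using fin nonneg by (intro sum_mono2) auto
  finally have "card ?Q \<le> c / \<mu>" using M \<mu> by (simp add: field_simps)
  then have "g * card ?Q \<le> g * (c / \<mu>)" using nonneg(4) by (rule mult_left_mono)
  moreover have "(\<Sum>P\<in>?Q. n P) \<le> g * card ?Q" by (rule few) auto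
  moreover have "(\<Sum>P\<in>\<P> - ?Q. n P) \<le> (a + b * \<mu>) * c"
  proof -
    have "(\<Sum>P\<in>\<P> - ?Q. n P) \<le> (\<Sum>P\<in>\<P> - ?Q. (a + b * \<mu>) * M P)"
    proof (rule sum_mono)
      fix P assume P: "P \<in> \<P> - ?Q"
      then have "b * (M P * M P) \<le> b * (\<mu> * M P)"
        using nonneg by (intro mult_left_mono mult_right_mono) auto
      then show "n P \<le> (a + b * \<mu>) * M P"
        using n[of P] P by (simp add: power2_eq_square algebra_simps)
    qed
    also have "\<dots> = (a + b * \<mu>) * (\<Sum>P\<in>\<P> - ?Q. M P)" by (simp add: sum_distrib_left)
    also have "\<dots> \<le> (a + b * \<mu>) * c"
    proof (rule mult_left_mono)
      have "(\<Sum>P\<in>\<P> - ?Q. M P) \<le> (\<Sum>P\<in>\<P>. M P)" using fin nonneg by (intro sum_mono2) auto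
      then show "(\<Sum>P\<in>\<P> - ?Q. M P) \<le> c" using M by simp
    qed (use nonneg \<mu> in auto)
    finally show ?thesis .
  qed
  moreover have "(\<Sum>P\<in>\<P>. n P) = (\<Sum>P\<in>\<P> - ?Q. n P) + (\<Sum>P\<in>?Q. n P)"
    using fin by (intro sum.subset_diff) auto
  ultimately show ?thesis by (simp add: algebra_simps)
qed

lemma mult_sqrt_le_of_square:
  fixes s L k N C :: real
  assumes "0 \<le> s" "0 \<le> L" "0 < k" "0 \<le> N" "0 \<le> C" and le: "s\<^sup>2 * N \<le> C\<^sup>2 * (L ^ 3 / k)"
  shows "s * sqrt N \<le> C * (L * sqrt L / sqrt k)"
proof (rule power2_le_imp_le)
  have "(C * (L * sqrt L / sqrt k))\<^sup>2 = C\<^sup>2 * (L ^ 3 / k)"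
    using assms by (simp add: power_mult_distrib power_divide power2_eq_square power3_eq_cube)
  then show "(s * sqrt N)\<^sup>2 \<le> (C * (L * sqrt L / sqrt k))\<^sup>2"
    using le assms(4) by (simp add: power_mult_distrib)
qed (use assms in auto)

definition joints_bound :: "real \<Rightarrow> real \<Rightarrow> real \<Rightarrow> real" where
  "joints_bound L N k = L * sqrt L / sqrt k + L / k * sqrt N"

section \<open>The set of joints: general estimates\<close>

text \<open>Nonemptiness makes \<open>card \<LL>\<close> and the later threshold
  \<open>\<tau>\<close> positive and yields \<open>N \<le> 8 * k ^ 3\<close>; for an empty set the
  theorem is trivial.\<close>

locale joint_set =
  fixes \<LL> :: "(real^3) set set" and N k :: nat and J :: "(real^3) set"
  assumes fin: "finite \<LL>" and lines: "\<And>l. l \<in> \<LL> \<Longrightarrow> is_line l" and N: "1 \<le> N" and k: "1 \<le> k"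
    and nonempty: "J \<noteq> {}" and J: "J = joints_mult_lines \<LL> N k"
begin

abbreviation LT :: "real^3 \<Rightarrow> (real^3) set set" where "LT \<equiv> lines_through \<LL>"

lemma finite_J: "finite J"
  using finite_joints[OF fin lines] unfolding J joints_mult_lines_def joints_mult_def
  by (rule rev_finite_subset) auto

lemma finite_LT: "finite (LT x)"
  using fin by (simp add: lines_through_def)

lemma LT_line: "l \<in> LT x \<Longrightarrow> is_line l \<and> x \<in> l"
  using lines by (simp add: lines_through_def)

lemma J_lines: "x \<in> J \<Longrightarrow> k \<le> card (LT x)" "x \<in> J \<Longrightarrow> card (LT x) < 2 * k"
  by (auto simp: J joints_mult_lines_def)

lemma J_mult: "x \<in> J \<Longrightarrow> N \<le> multiplicity_at \<LL> x"
  by (auto simp: J joints_mult_lines_def joints_mult_def)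

lemma LT_span: assumes "x \<in> J" shows "directions_span (LT x)"
proof -
  obtain T where "T \<subseteq> LT x" "directions_span T"
    using assms unfolding J joints_mult_lines_def joints_mult_def joints_def by blast
  then show ?thesis unfolding directions_span_def
    by (metis UN_mono order_refl span_mono top.extremum_uniqueI)
qed

lemma N_le_cube: "N \<le> 8 * k ^ 3"
proof -
  obtain x where x: "x \<in> J" using nonempty by blast
  \<comment> \<open>The plane is arbitrary: the estimate uses only that fewer than
    \<open>2 * k\<close> lines pass through \<open>x\<close>.\<close>
  have "plane {y. axis 1 1 \<bullet> y = 0}" unfolding plane_def
    by (intro exI[of _ "axis 1 1"] exI[of _ 0]) (simp add: axis_eq_0_iff)
  from multiplicity_at_le[OF fin this, of x]
  have "N \<le> card {l \<in> LT x. \<not> l \<subseteq> {y. axis 1 1 \<bullet> y = 0}} * (card (LT x))\<^sup>2"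
    using J_mult[OF x] by linarith
  also have "\<dots> \<le> (2 * k) * (2 * k)\<^sup>2"
  proof (intro mult_mono power_mono)
    have "card {l \<in> LT x. \<not> l \<subseteq> {y. axis 1 1 \<bullet> y = 0}} \<le> card (LT x)"
      using finite_LT by (intro card_mono) auto
    then show "card {l \<in> LT x. \<not> l \<subseteq> {y. axis 1 1 \<bullet> y = 0}} \<le> 2 * k" using J_lines(2)[OF x] by simp
  qed (use J_lines(2)[OF x] in auto)
  finally show ?thesis by (simp add: power2_eq_square power3_eq_cube)
qed

lemma card_LL_pos: "0 < card \<LL>"
proof -
  obtain x where "x \<in> J" using nonempty by blast
  then have "LT x \<noteq> {}" using J_lines(1)[of x] k by auto
  then show ?thesis using fin by (auto simp: lines_through_def card_gt_0_iff)
qed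

text \<open>Because \<open>N \<le> 8 * k ^ 3\<close>, the factor \<open>k ^ 4\<close> can be traded
  for \<open>N * k\<close> at the cost of 8. The number \<open>256000000000000\<close> is the square
  of \<open>16000000\<close>.\<close>

lemma square_bound:
  assumes "(real (card J))\<^sup>2 * k ^ 4 \<le> K * (real (card \<LL>)) ^ 3" "8 * K \<le> 256000000000000"
  shows "card J * sqrt N \<le> 16000000 * joints_bound (card \<LL>) N k"
proof -
  have "(real (card J))\<^sup>2 * N * k \<le> (real (card J))\<^sup>2 * (8 * real k ^ 3) * k"
    using N_le_cube by (intro mult_right_mono mult_left_mono) (auto simp flip: of_nat_power)
  also have "\<dots> = 8 * ((real (card J))\<^sup>2 * k ^ 4)" by (simp add: power3_eq_cube power4_eq_xxxx)
  also have "\<dots> \<le> 8 * K * (real (card \<LL>)) ^ 3" using assms(1) by simp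
  also have "\<dots> \<le> 256000000000000 * (real (card \<LL>)) ^ 3" using assms(2) by (intro mult_right_mono) auto
  finally have "(real (card J))\<^sup>2 * N \<le> 16000000\<^sup>2 * ((real (card \<LL>)) ^ 3 / k)"
    using k by (simp add: field_simps)
  then have "card J * sqrt N \<le> 16000000 * (card \<LL> * sqrt (card \<LL>) / sqrt k)"
    using k by (intro mult_sqrt_le_of_square) auto
  also have "\<dots> \<le> 16000000 * joints_bound (card \<LL>) N k" by (simp add: joints_bound_def)
  finally show ?thesis .
qed

lemma linear_bound:
  assumes "card J * real k \<le> 4480 * card \<LL>"
  shows "card J * sqrt N \<le> 16000000 * joints_bound (card \<LL>) N k"
proof -
  have "card J \<le> 4480 * (card \<LL> / k)" using assms k by (simp add: field_simps)
  then have "card J * sqrt N \<le> 4480 * (card \<LL> / k) * sqrt N" by (intro mult_right_mono) auto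
  also have "\<dots> = 4480 * (card \<LL> / k * sqrt N)" by simp
  also have "\<dots> \<le> 16000000 * (card \<LL> / k * sqrt N)" by (intro mult_right_mono) auto
  also have "\<dots> \<le> 16000000 * joints_bound (card \<LL>) N k" by (simp add: joints_bound_def)
  finally show ?thesis .
qed

text \<open>For bounded \<open>k\<close> powers of \<open>k\<close> are constants, so
  \<open>w\<close> can be taken below 1. Then no line of a joint may be lost, and every joint spans
  as it stands, without a planar case.\<close>

lemma bound_few_lines:
  assumes "k < 10"
  shows "card J * sqrt N \<le> 16000000 * joints_bound (card \<LL>) N k"
proof -
  have core: "1/2 * card J \<le> (0 + 56 * 2 ^ q) * real (card \<LL>) + (card J)\<^sup>2 / 2 ^ (card (UNIV :: 3 set) * q)" for q
  proof (rule incidence_core[of \<LL> J LT "1/2" UNIV 0 0 "\<lambda>_. False" "\<lambda>_. {}"])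
    show "1/2 < card (LT x)" if "x \<in> J" for x using J_lines(1)[OF that] k by linarith
    fix x F assume x: "x \<in> J" and F: "F \<subseteq> LT x" "card (LT x - F) \<le> (1/2 :: real)"
    have "card (LT x - F) = 0" using F(2) by linarith
    then have "F = LT x" using F(1) finite_LT[of x] by auto
    then show "span (insert 0 (\<Union>l\<in>F. direction l)) = UNIV \<or>
        False \<and> plane {} \<and> (\<forall>l\<in>LT x. l \<subseteq> {}) \<and> 3 \<le> card F"
      using LT_span[OF x] by (simp add: directions_span_def span_insert_0)
  qed (use fin lines finite_J in \<open>auto simp: lines_through_def\<close>)
  have "1/2 * real (card J) \<le> 112 * real (card \<LL>) \<or>
      (1/2) ^ 4 * (real (card J))\<^sup>2 \<le> 44957696 * (real (card \<LL>)) ^ 3"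
  proof (rule choose_scale_3)
    show "3/4 * (1/2 * real (card J)) \<le> 56 * 2 ^ q * real (card \<LL>) + (real (card J))\<^sup>2 / 2 ^ (3 * q)" for q
    proof -
      have card3: "card (UNIV :: 3 set) = 3" by simp
      show ?thesis using core[of q, unfolded card3 of_nat_power add_0] by linarith
    qed
  qed auto
  then consider "card J \<le> 224 * real (card \<LL>)" | "(real (card J))\<^sup>2 \<le> 719323136 * (real (card \<LL>)) ^ 3"
    by (auto simp: power_divide)
  then show ?thesis
  proof cases
    case 1
    have "card J * real k \<le> (224 * real (card \<LL>)) * 9" using 1 assms by (intro mult_mono) auto
    then show ?thesis by (intro linear_bound) simp
  next
    case 2
    have "real k ^ 4 \<le> 9 ^ 4" using assms by (intro power_mono) auto
    with 2 have "(real (card J))\<^sup>2 * k ^ 4 \<le> (719323136 * (real (card \<LL>)) ^ 3) * 9 ^ 4"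
      by (intro mult_mono) auto
    then have "(real (card J))\<^sup>2 * k ^ 4 \<le> 4719479095296 * (real (card \<LL>)) ^ 3" by simp
    then show ?thesis by (rule square_bound) simp
  qed
qed

end

section \<open>Planar joints and popular lines\<close>

context joint_set
begin

text \<open>The proportion 1/10 exceeds the \<open>k / 20\<close> lines that pruning may remove, so
  a joint whose surviving lines lie in one plane is planar.\<close>

definition dominant_plane :: "real^3 \<Rightarrow> (real^3) set \<Rightarrow> bool" where
  "dominant_plane x P \<longleftrightarrow> plane P \<and> x \<in> P \<and> 10 * card {l \<in> LT x. \<not> l \<subseteq> P} < card (LT x)"

definition planar :: "real^3 \<Rightarrow> bool" where
  "planar x \<longleftrightarrow> (\<exists>P. dominant_plane x P)"

definition \<pi> :: "real^3 \<Rightarrow> (real^3) set" where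
  "\<pi> x = (SOME P. dominant_plane x P)"

lemma dominant_plane_\<pi>: "planar x \<Longrightarrow> dominant_plane x (\<pi> x)"
  unfolding planar_def \<pi>_def by (rule someI_ex)

definition \<tau> :: real where
  "\<tau> = k * card J / (320 * card \<LL>)"

definition tangent_pts :: "(real^3) set \<Rightarrow> (real^3) set \<Rightarrow> (real^3) set" where
  "tangent_pts P l = {y \<in> J. planar y \<and> \<pi> y = P \<and> y \<in> l}"

text \<open>The threshold \<open>\<tau>\<close> is a small multiple of the average number of joints on a line, so each line
  is popular for few planes on average.\<close>

definition popular_lines :: "(real^3) set \<Rightarrow> (real^3) set set" where
  "popular_lines P = {l \<in> \<LL>. l \<subseteq> P \<and> \<tau> < card (tangent_pts P l)}"

definition popular_joints :: "(real^3) set" where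
  "popular_joints = {x \<in> J. planar x \<and> k / 2 \<le> card (popular_lines (\<pi> x) \<inter> LT x)}"

lemma \<tau>_pos: "0 < \<tau>"
  using card_LL_pos k nonempty finite_J by (auto simp: \<tau>_def card_gt_0_iff intro!: divide_pos_pos mult_pos_pos)

lemma \<tau>_eq: "\<tau> * card \<LL> = k * card J / 320"
  using card_LL_pos by (simp add: \<tau>_def)

lemma finite_tangent_pts: "finite (tangent_pts P l)"
  using finite_J by (simp add: tangent_pts_def)

text \<open>A planar joint keeps only the lines in its plane that are unpopular there: more than
  nine tenths lie in the plane and fewer than \<open>k / 2\<close> are popular, so at least
  \<open>4 * k / 10\<close> remain. By unpopularity each of them meets at most \<open>\<tau>\<close>
  joints with that plane. A nonplanar joint keeps all its lines.\<close>

lemma unpopular_core: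
  assumes k10: "10 \<le> k"
  shows "k / 20 * card (J - popular_joints) \<le>
     (\<tau> + 56 * 2 ^ q) * card \<LL> + (card (J - popular_joints))\<^sup>2 / 2 ^ (card (UNIV :: 3 set) * q)"
proof -
  define E where "E x = (if planar x then {l \<in> LT x. l \<subseteq> \<pi> x} - popular_lines (\<pi> x) else LT x)" for x
  have E_LT: "E x \<subseteq> LT x" for x by (auto simp: E_def)
  have planar_E: "4 * real k / 10 \<le> card (E x)" if x: "x \<in> J - popular_joints" and pl: "planar x" for x
  proof -
    let ?in = "{l \<in> LT x. l \<subseteq> \<pi> x}" and ?out = "{l \<in> LT x. \<not> l \<subseteq> \<pi> x}"
    have "card (?in \<union> ?out) = card ?in + card ?out"
      using finite_LT by (intro card_Un_disjoint) auto
    moreover have "?in \<union> ?out = LT x" by blast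
    ultimately have "card (LT x) = card ?in + card ?out" by metis
    moreover have "10 * card ?out < card (LT x)"
      using dominant_plane_\<pi>[OF pl] by (simp add: dominant_plane_def)
    ultimately have "9 * real (card (LT x)) / 10 \<le> card ?in" by linarith
    moreover have "card (popular_lines (\<pi> x) \<inter> LT x) < real k / 2"
      using x pl by (auto simp: popular_joints_def)
    moreover have "?in \<subseteq> E x \<union> (popular_lines (\<pi> x) \<inter> LT x)" using pl by (auto simp: E_def)
    then have "card ?in \<le> card (E x \<union> (popular_lines (\<pi> x) \<inter> LT x))"
      using finite_LT finite_subset[OF E_LT finite_LT] by (intro card_mono) auto
    then have "card ?in \<le> card (E x) + card (popular_lines (\<pi> x) \<inter> LT x)"
      using card_Un_le le_trans by blast
    moreover have "k \<le> card (LT x)" using x J_lines(1) by auto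
    ultimately show ?thesis by linarith
  qed
  show ?thesis
  proof (rule incidence_core[of \<LL> "J - popular_joints" E "k / 20" UNIV 0 \<tau> planar \<pi>])
    show "k / 20 < card (E x)" if x: "x \<in> J - popular_joints" for x
    proof (cases "planar x")
      case True
      then show ?thesis using planar_E[OF x True] k10 by linarith
    next
      case False
      then show ?thesis using J_lines(1)[of x] x k10 by (simp add: E_def)
    qed
    show "span (insert 0 (\<Union>l\<in>F. direction l)) = UNIV \<or>
        planar x \<and> plane (\<pi> x) \<and> (\<forall>l\<in>E x. l \<subseteq> \<pi> x) \<and> 3 \<le> card F"
      if x: "x \<in> J - popular_joints" and F: "F \<subseteq> E x" "card (E x - F) \<le> k / 20" for x F
    proof (cases "planar x")
      case True
      have "finite (E x)" using E_LT finite_LT finite_subset by blast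
      then have "card (E x - F) = card (E x) - card F" "card F \<le> card (E x)"
        using F(1) by (auto intro: card_Diff_subset card_mono finite_subset)
      then have "3 \<le> card F" using planar_E[OF x True] F(2) k10 by linarith
      then show ?thesis using dominant_plane_\<pi>[OF True] True by (auto simp: E_def dominant_plane_def)
    next
      case False
      then have E: "E x = LT x" by (simp add: E_def)
      have "directions_span F"
      proof (rule ccontr)
        assume "\<not> directions_span F"
        moreover have "is_line l \<and> x \<in> l" if "l \<in> F" for l using that F(1) E LT_line by blast
        ultimately obtain P where P: "plane P" "x \<in> P" "\<And>l. l \<in> F \<Longrightarrow> l \<subseteq> P"
          using directions_span_or_in_plane[of F x] by blast
        have "card {l \<in> LT x. \<not> l \<subseteq> P} \<le> card (LT x - F)"
          using P(3) finite_LT by (intro card_mono) auto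
        then have "dominant_plane x P"
          using P F(2) E J_lines(1)[of x] x k10 by (auto simp: dominant_plane_def)
        then show False using False by (auto simp: planar_def)
      qed
      then show ?thesis by (simp add: directions_span_def span_insert_0)
    qed
    show "card {x \<in> J - popular_joints. planar x \<and> l \<in> E x \<and> \<pi> x = P} \<le> \<tau>" for l P
    proof (cases "{x \<in> J - popular_joints. planar x \<and> l \<in> E x \<and> \<pi> x = P} = {}")
      case True
      then show ?thesis using \<tau>_pos by (simp only: card.empty)
    next
      case False
      then obtain x where x: "x \<in> J" "planar x" "l \<in> E x" "\<pi> x = P" by blast
      then have "l \<in> \<LL>" "l \<subseteq> P" "l \<notin> popular_lines P" by (auto simp: E_def lines_through_def)
      then have "card (tangent_pts P l) \<le> \<tau>" by (auto simp: popular_lines_def)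
      moreover have "{x \<in> J - popular_joints. planar x \<and> l \<in> E x \<and> \<pi> x = P} \<subseteq> tangent_pts P l"
        using E_LT by (auto simp: tangent_pts_def lines_through_def)
      then have "card {x \<in> J - popular_joints. planar x \<and> l \<in> E x \<and> \<pi> x = P} \<le> card (tangent_pts P l)"
        by (intro card_mono finite_tangent_pts)
      ultimately show ?thesis by linarith
    qed
    show "\<And>x. x \<in> J - popular_joints \<Longrightarrow> E x \<subseteq> \<LL>" using E_LT by (auto simp: lines_through_def)
    show "\<And>x l. x \<in> J - popular_joints \<Longrightarrow> l \<in> E x \<Longrightarrow> x \<in> l" using E_LT by (auto simp: lines_through_def)
  qed (use fin lines finite_J \<tau>_pos in auto)
qed

lemma bound_unpopular:
  assumes k10: "10 \<le> k" and half: "card J \<le> 2 * card (J - popular_joints)"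
  shows "card J * sqrt N \<le> 16000000 * joints_bound (card \<LL>) N k"
proof -
  let ?s = "real (card (J - popular_joints))"
  have "k / 20 * ?s \<le> 112 * real (card \<LL>) \<or> (k / 20) ^ 4 * ?s\<^sup>2 \<le> 44957696 * (real (card \<LL>)) ^ 3"
  proof (rule choose_scale_3)
    show "3/4 * (k / 20 * ?s) \<le> 56 * 2 ^ q * real (card \<LL>) + ?s\<^sup>2 / 2 ^ (3 * q)" for q
    proof -
      have "k * real (card J) \<le> k * (2 * ?s)" using half by (intro mult_left_mono) auto
      moreover have "0 \<le> real k * ?s" by simp
      \<comment> \<open>The denominator 320 in \<open>\<tau>\<close> serves here: as at least half
        of the joints are unpopular, \<open>\<tau> * card \<LL>\<close> takes up at most the quarter
        of the left side that \<open>choose_scale\<close> leaves free.\<close>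
      ultimately have "\<tau> * card \<LL> \<le> k / 20 * ?s / 4" unfolding \<tau>_eq of_nat_mult by linarith
      moreover have card3: "card (UNIV :: 3 set) = 3" by simp
      ultimately show ?thesis
        using unpopular_core[OF k10, of q, unfolded card3 of_nat_power distrib_right] by linarith
    qed
  qed (use k in auto)
  then consider "k * ?s \<le> 2240 * card \<LL>" | "?s\<^sup>2 * k ^ 4 \<le> 7193231360000 * (real (card \<LL>)) ^ 3"
    by (auto simp: power_divide mult.commute)
  then show ?thesis
  proof cases
    case 1
    have "card J * real k \<le> (2 * ?s) * k" using half by (intro mult_right_mono) auto
    then show ?thesis using 1 by (intro linear_bound) (simp add: mult.commute)
  next
    case 2
    have "(real (card J))\<^sup>2 \<le> (2 * ?s)\<^sup>2" using half by (intro power_mono) auto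
    then have "(real (card J))\<^sup>2 * k ^ 4 \<le> (2 * ?s)\<^sup>2 * k ^ 4" by (intro mult_right_mono) auto
    \<comment> \<open>The largest constant handed to \<open>square_bound\<close>; it dictates the
      size of \<open>16000000\<close>.\<close>
    then have "(real (card J))\<^sup>2 * k ^ 4 \<le> 28772925440000 * (real (card \<LL>)) ^ 3"
      using 2 by (simp add: power_mult_distrib)
    then show ?thesis by (rule square_bound) simp
  qed
qed

definition planes :: "(real^3) set set" where
  "planes = \<pi> ` popular_joints"

definition plane_joints :: "(real^3) set \<Rightarrow> (real^3) set" where
  "plane_joints P = {x \<in> popular_joints. \<pi> x = P}"

lemma finite_popular_joints: "finite popular_joints"
  using finite_J by (simp add: popular_joints_def)

lemma finite_planes: "finite planes"
  using finite_popular_joints by (simp add: planes_def)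

lemma popular_joint_plane:
  assumes "x \<in> popular_joints"
  shows "x \<in> J" "plane (\<pi> x)" "x \<in> \<pi> x"
  using dominant_plane_\<pi>[of x] assms by (auto simp: popular_joints_def dominant_plane_def)

lemma card_plane_joints:
  assumes k10: "10 \<le> k" and P: "P \<in> planes"
  shows "card (plane_joints P) \<le>
    672 / k * card (popular_lines P) + 43352064 / k ^ 3 * (real (card (popular_lines P)))\<^sup>2"
proof -
  have "card (plane_joints P) \<le> 336 * card (popular_lines P) / (k / 2) +
      5419008 * (card (popular_lines P))\<^sup>2 / (k / 2) ^ 3"
  proof (rule planar_szemeredi_trotter)
    show "plane P" using P popular_joint_plane by (auto simp: planes_def)
    show "finite (popular_lines P)" using fin by (simp add: popular_lines_def)
    show "finite (plane_joints P)" using finite_popular_joints by (simp add: plane_joints_def)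
    show "3 \<le> real k / 2" using k10 by linarith
    show "k / 2 \<le> card {l \<in> popular_lines P. x \<in> l}" if x: "x \<in> plane_joints P" for x
    proof -
      have "k / 2 \<le> card (popular_lines P \<inter> LT x)"
        using x by (auto simp: plane_joints_def popular_joints_def)
      moreover have "popular_lines P \<inter> LT x = {l \<in> popular_lines P. x \<in> l}"
        by (auto simp: popular_lines_def lines_through_def)
      ultimately show ?thesis by simp
    qed
  qed (use lines in \<open>auto simp: popular_lines_def\<close>)
  then show ?thesis by (simp add: power_divide)
qed

lemma sum_card_lines: "(\<Sum>l\<in>\<LL>. card {y \<in> J. y \<in> l}) \<le> 2 * k * card J"
proof -
  have "(\<Sum>l\<in>\<LL>. card {y \<in> J. y \<in> l}) = (\<Sum>y\<in>J. card (LT y))"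
    unfolding lines_through_def by (rule sum_card_filter_swap[OF fin finite_J])
  also have "\<dots> \<le> (\<Sum>y\<in>J. 2 * k)" by (intro sum_mono) (use J_lines(2) in \<open>auto intro: less_imp_le\<close>)
  finally show ?thesis by (simp add: mult.commute)
qed

text \<open>A plane and a line popular for it account for more than \<open>\<tau>\<close> incidences
  on that line. Different planes use different incidences, since \<open>\<pi>\<close> assigns one
  plane to each joint, and in all there are at most \<open>2 * k * card J\<close>, which is
  \<open>640 * \<tau> * card \<LL>\<close>.\<close>

lemma sum_popular_lines: "(\<Sum>P\<in>planes. real (card (popular_lines P))) \<le> 640 * card \<LL>"
proof -
  have "(\<Sum>P\<in>planes. real (card (popular_lines P))) * \<tau> = (\<Sum>P\<in>planes. \<Sum>l\<in>popular_lines P. \<tau>)"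
    by (simp add: sum_distrib_right)
  also have "\<dots> \<le> (\<Sum>P\<in>planes. \<Sum>l\<in>popular_lines P. real (card (tangent_pts P l)))"
    by (intro sum_mono) (auto simp: popular_lines_def)
  also have "\<dots> \<le> (\<Sum>P\<in>planes. \<Sum>l\<in>\<LL>. real (card (tangent_pts P l)))"
    using fin by (intro sum_mono sum_mono2) (auto simp: popular_lines_def)
  also have "\<dots> = (\<Sum>l\<in>\<LL>. \<Sum>P\<in>planes. real (card (tangent_pts P l)))" by (rule sum.swap)
  also have "\<dots> \<le> (\<Sum>l\<in>\<LL>. real (card {y \<in> J. y \<in> l}))"
  proof (rule sum_mono)
    fix l
    have "(\<Sum>P\<in>planes. card (tangent_pts P l)) = card (\<Union>P\<in>planes. tangent_pts P l)"
      using finite_planes finite_tangent_pts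
      by (intro card_UN_disjoint[symmetric]) (auto simp: tangent_pts_def)
    also have "\<dots> \<le> card {y \<in> J. y \<in> l}"
      using finite_J by (intro card_mono) (auto simp: tangent_pts_def)
    finally show "(\<Sum>P\<in>planes. real (card (tangent_pts P l))) \<le> real (card {y \<in> J. y \<in> l})"
      by (simp flip: of_nat_sum)
  qed
  also have "\<dots> \<le> real (2 * k * card J)"
    unfolding of_nat_sum[symmetric] of_nat_le_iff by (rule sum_card_lines)
  also have "\<dots> = 640 * card \<LL> * \<tau>" using \<tau>_eq by (simp add: mult_ac)
  finally show ?thesis using \<tau>_pos by simp
qed

text \<open>A line not contained in a plane meets it at most once, and every popular joint carries
  at least \<open>N / (4 k\<^sup>2)\<close> lines outside its plane.\<close>

lemma sum_plane_joints:
  assumes Q: "Q \<subseteq> planes"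
  shows "N * (\<Sum>P\<in>Q. card (plane_joints P)) \<le> 4 * k\<^sup>2 * card \<LL> * card Q"
proof -
  define GQ where "GQ = {x \<in> popular_joints. \<pi> x \<in> Q}"
  have finQ: "finite Q" using Q finite_planes finite_subset by blast
  have finGQ: "finite GQ" using finite_popular_joints by (simp add: GQ_def)
  have "(\<Sum>P\<in>Q. card (plane_joints P)) = card (\<Union>P\<in>Q. plane_joints P)"
    using finQ finite_popular_joints
    by (intro card_UN_disjoint[symmetric]) (auto simp: plane_joints_def)
  also have "(\<Union>P\<in>Q. plane_joints P) = GQ" by (auto simp: plane_joints_def GQ_def)
  finally have card_GQ: "(\<Sum>P\<in>Q. card (plane_joints P)) = card GQ" .
  have off: "N \<le> card {l \<in> \<LL>. x \<in> l \<and> \<not> l \<subseteq> \<pi> x} * (4 * k\<^sup>2)" if x: "x \<in> GQ" for x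
  proof -
    have xG: "x \<in> popular_joints" using x by (simp add: GQ_def)
    have "N \<le> card {l \<in> LT x. \<not> l \<subseteq> \<pi> x} * (card (LT x))\<^sup>2"
      using multiplicity_at_le[OF fin popular_joint_plane(2)[OF xG], of x]
        J_mult[OF popular_joint_plane(1)[OF xG]] by linarith
    also have "\<dots> \<le> card {l \<in> LT x. \<not> l \<subseteq> \<pi> x} * (2 * k)\<^sup>2"
      using J_lines(2)[OF popular_joint_plane(1)[OF xG]] by (intro mult_left_mono power_mono) auto
    also have "{l \<in> LT x. \<not> l \<subseteq> \<pi> x} = {l \<in> \<LL>. x \<in> l \<and> \<not> l \<subseteq> \<pi> x}"
      by (auto simp: lines_through_def)
    finally show ?thesis by (simp add: power_mult_distrib)
  qed
  have "N * card GQ = (\<Sum>x\<in>GQ. N)" by simp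
  also have "\<dots> \<le> (\<Sum>x\<in>GQ. card {l \<in> \<LL>. x \<in> l \<and> \<not> l \<subseteq> \<pi> x} * (4 * k\<^sup>2))"
    by (rule sum_mono) (rule off)
  also have "\<dots> = (\<Sum>l\<in>\<LL>. card {x \<in> GQ. x \<in> l \<and> \<not> l \<subseteq> \<pi> x}) * (4 * k\<^sup>2)"
    using sum_card_filter_swap[OF finGQ fin, of "\<lambda>x l. x \<in> l \<and> \<not> l \<subseteq> \<pi> x"]
    by (simp only: flip: sum_distrib_right)
  also have "\<dots> \<le> (\<Sum>l\<in>\<LL>. card Q) * (4 * k\<^sup>2)"
  proof (intro mult_right_mono sum_mono)
    fix l assume l: "l \<in> \<LL>"
    have "inj_on \<pi> {x \<in> GQ. x \<in> l \<and> \<not> l \<subseteq> \<pi> x}"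
    proof (rule inj_onI, rule ccontr)
      fix x y assume xy: "x \<in> {x \<in> GQ. x \<in> l \<and> \<not> l \<subseteq> \<pi> x}" "y \<in> {x \<in> GQ. x \<in> l \<and> \<not> l \<subseteq> \<pi> x}"
        "\<pi> x = \<pi> y" "x \<noteq> y"
      then have "x \<in> popular_joints" "y \<in> popular_joints" by (auto simp: GQ_def)
      then have "l \<subseteq> \<pi> x"
        using popular_joint_plane(2,3)[of x] popular_joint_plane(3)[of y] xy
        by (intro line_subset_plane[OF lines[OF l], of _ x y]) auto
      then show False using xy(1) by blast
    qed
    then show "card {x \<in> GQ. x \<in> l \<and> \<not> l \<subseteq> \<pi> x} \<le> card Q"
      by (rule card_inj_on_le[OF _ _ finQ]) (auto simp: GQ_def)
  qed auto
  finally show ?thesis unfolding card_GQ by (simp add: mult_ac)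
qed

lemma bound_popular:
  assumes k10: "10 \<le> k" and half: "card J \<le> 2 * card popular_joints"
  shows "card J * sqrt N \<le> 100000000000 * joints_bound (card \<LL>) N k"
proof -
  define r q \<nu> where "r = sqrt (card \<LL>)" and "q = sqrt k" and "\<nu> = sqrt N"
  have pos: "0 < r" "0 < q" "0 < \<nu>" using card_LL_pos k N by (auto simp: r_def q_def \<nu>_def)
  have sq: "real (card \<LL>) = r\<^sup>2" "real k = q\<^sup>2" "real N = \<nu>\<^sup>2" by (auto simp: r_def q_def \<nu>_def)
  \<comment> \<open>The threshold \<open>?\<mu>\<close> makes \<open>?b * ?\<mu> * ?c\<close> and
    \<open>?g * ?c / ?\<mu>\<close> both constant multiples of \<open>r ^ 3 / (q * \<nu>)\<close>.
    Naming the square roots turns the comparison into one of rational expressions.\<close>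
  let ?a = "672 / real k" and ?b = "43352064 / real k ^ 3" and ?c = "640 * real (card \<LL>)"
    and ?g = "4 * (real k)\<^sup>2 * card \<LL> / real N" and ?\<mu> = "r * q ^ 5 / \<nu>"
  have "(\<Sum>P\<in>planes. real (card (plane_joints P))) \<le> ?a * ?c + ?b * ?\<mu> * ?c + ?g * ?c / ?\<mu>"
  proof (rule sum_le_split_at_threshold[where M = "\<lambda>P. real (card (popular_lines P))"])
    show "(\<Sum>P\<in>Q. real (card (plane_joints P))) \<le> ?g * card Q" if "Q \<subseteq> planes" for Q
    proof -
      have "real (N * (\<Sum>P\<in>Q. card (plane_joints P))) \<le> real (4 * k\<^sup>2 * card \<LL> * card Q)"
        unfolding of_nat_le_iff by (rule sum_plane_joints[OF that])
      then show ?thesis using N by (simp add: field_simps)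
    qed
  qed (use finite_planes card_plane_joints[OF k10] sum_popular_lines pos in auto)
  also have "(\<Sum>P\<in>planes. real (card (plane_joints P))) = card popular_joints"
  proof -
    have "(\<Sum>P\<in>planes. card (plane_joints P)) = card (\<Union>P\<in>planes. plane_joints P)"
      using finite_planes finite_popular_joints
      by (intro card_UN_disjoint[symmetric]) (auto simp: plane_joints_def)
    also have "(\<Union>P\<in>planes. plane_joints P) = popular_joints" by (auto simp: plane_joints_def planes_def)
    finally show ?thesis by (simp flip: of_nat_sum)
  qed
  finally have "card popular_joints * \<nu> \<le> (?a * ?c + ?b * ?\<mu> * ?c + ?g * ?c / ?\<mu>) * \<nu>"
    using pos by (intro mult_right_mono) auto
  also have "\<dots> = 430080 * (r\<^sup>2 / q\<^sup>2 * \<nu>) + 27745323520 * (r ^ 3 / q)"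
    unfolding sq using pos by (simp add: field_simps power2_eq_square eval_nat_numeral)
  also have "\<dots> \<le> 50000000000 * (r ^ 3 / q + r\<^sup>2 / q\<^sup>2 * \<nu>)"
  proof -
    have "430080 * y + 27745323520 * x \<le> 50000000000 * (x + y)" if "0 \<le> x" "0 \<le> y" for x y :: real
      using that by simp
    from this[of "r ^ 3 / q" "r\<^sup>2 / q\<^sup>2 * \<nu>"] show ?thesis using pos by fastforce
  qed
  also have "r ^ 3 / q + r\<^sup>2 / q\<^sup>2 * \<nu> = joints_bound (card \<LL>) N k"
    unfolding joints_bound_def r_def[symmetric] q_def[symmetric] \<nu>_def[symmetric]
    unfolding sq by (simp add: power3_eq_cube power2_eq_square)
  finally have "card popular_joints * \<nu> \<le> 50000000000 * joints_bound (card \<LL>) N k" .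
  moreover have "card J * \<nu> \<le> (2 * card popular_joints) * \<nu>"
    using half pos by (intro mult_right_mono) (auto simp flip: of_nat_mult)
  ultimately show ?thesis unfolding \<nu>_def by linarith
qed

lemma joints_bound_le: "card J * sqrt N \<le> 100000000000 * joints_bound (card \<LL>) N k"
proof -
  have weaken: ?thesis if "card J * sqrt N \<le> 16000000 * joints_bound (card \<LL>) N k"
  proof -
    have "0 \<le> joints_bound (card \<LL>) N k" by (simp add: joints_bound_def)
    then show ?thesis using that by linarith
  qed
  show ?thesis
  proof (cases "k < 10")
    case True
    then show ?thesis by (intro weaken bound_few_lines)
  next
    case False
    have "card J = card popular_joints + card (J - popular_joints)"
      using finite_J finite_popular_joints card_Un_disjoint[of popular_joints "J - popular_joints"]
      by (auto simp: popular_joints_def Un_absorb1 Collect_mono)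
    then consider "card J \<le> 2 * card popular_joints" | "card J \<le> 2 * card (J - popular_joints)" by linarith
    then show ?thesis
    proof cases
      case 1
      with False show ?thesis by (intro bound_popular) auto
    next
      case 2
      with False show ?thesis by (intro weaken bound_unpopular) auto
    qed
  qed
qed

end

theorem proposition1p2:
  shows "\<exists>c::real. \<forall>(\<LL>::(real^3) set set) (N::nat) (k::nat).
    finite \<LL> \<longrightarrow> (\<forall>l\<in>\<LL>. is_line l) \<longrightarrow> N \<ge> 1 \<longrightarrow> k \<ge> 1 \<longrightarrow>
      real (card (joints_mult_lines \<LL> N k)) * real N powr (1/2)
        \<le> c * (real (card \<LL>) powr (3/2) / real k powr (1/2)
                + real (card \<LL>) / real k * real N powr (1/2))"
proof (intro exI[of _ 100000000000] allI impI)
  fix \<LL> :: "(real^3) set set" and N k :: nat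
  assume fin: "finite \<LL>" and lines: "\<forall>l\<in>\<LL>. is_line l" and N: "1 \<le> N" and k: "1 \<le> k"
  have half: "x powr (1/2) = sqrt x" "x powr (3/2) = x * sqrt x" if "0 \<le> x" for x :: real
  proof -
    show "x powr (1/2) = sqrt x" using that by (rule powr_half_sqrt)
    show "x powr (3/2) = x * sqrt x"
    proof (cases "x = 0")
      case False
      have "x powr (1 + 1/2) = x powr 1 * x powr (1/2)" by (rule powr_add)
      then show ?thesis using that False by (simp add: powr_half_sqrt)
    qed simp
  qed
  show "real (card (joints_mult_lines \<LL> N k)) * real N powr (1/2)
        \<le> 100000000000 * (real (card \<LL>) powr (3/2) / real k powr (1/2)
                + real (card \<LL>) / real k * real N powr (1/2))"
  proof (cases "joints_mult_lines \<LL> N k = {}")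
    case False
    interpret joint_set \<LL> N k "joints_mult_lines \<LL> N k"
      using fin lines N k False by unfold_locales auto
    show ?thesis using joints_bound_le by (simp add: joints_bound_def half)
  qed (simp add: half)
qed

end
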